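(* There is an algorithm that, given an $L$-shaped supergrid graph $L(m,n;k,l)$ and two distinct vertices $s$ and $t$ of it, computes a longest $(s,t)$-path of $L(m,n;k,l)$ in $O(mn)$ time.
   Context: The infinite supergrid graph has as vertices all points $(x,y)\in\mathbb{Z}^2$, two distinct vertices $u,v$ being adjacent iff $|u_x-v_x|\le 1$ and $|u_y-v_y|\le 1$. For integers $m,n>1$ and $k,l\ge 1$ with $m-k\ge 1$, $n-l\ge 1$, $L(m,n;k,l)$ is the subgraph of this infinite graph induced by $\{(x,y):1\le x\le m,\ 1\le y\le n\}\setminus\{(x,y): m-k+1\le x\le m,\ 1\le y\le l\}$. A longest $(s,t)$-path is a simple path from $s$ to $t$ having the maximum number of vertices among all simple paths from $s$ to $t$. *)

theory Defs
  imports Main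
begin

definition sg_adj :: "int \<times> int \<Rightarrow> int \<times> int \<Rightarrow> bool" where
  "sg_adj u v \<longleftrightarrow> u \<noteq> v \<and> \<bar>fst u - fst v\<bar> \<le> 1 \<and> \<bar>snd u - snd v\<bar> \<le> 1"

text \<open>Vertex set of L(m,n;k,l); the graph is the induced subgraph on it.\<close>
definition L_vertices :: "nat \<Rightarrow> nat \<Rightarrow> nat \<Rightarrow> nat \<Rightarrow> (int \<times> int) set" where
  "L_vertices m n k l =
     {(x, y). 1 \<le> x \<and> x \<le> int m \<and> 1 \<le> y \<and> y \<le> int n}
     - {(x, y). int m - int k + 1 \<le> x \<and> x \<le> int m \<and> 1 \<le> y \<and> y \<le> int l}"

definition is_st_path :: "(int \<times> int) set \<Rightarrow> int \<times> int \<Rightarrow> int \<times> int \<Rightarrow> (int \<times> int) list \<Rightarrow> bool" where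
  "is_st_path V s t p \<longleftrightarrow> p \<noteq> [] \<and> hd p = s \<and> last p = t \<and> distinct p \<and> set p \<subseteq> V \<and>
     (\<forall>i. Suc i < length p \<longrightarrow> sg_adj (p ! i) (p ! Suc i))"

definition is_longest_st_path :: "(int \<times> int) set \<Rightarrow> int \<times> int \<Rightarrow> int \<times> int \<Rightarrow> (int \<times> int) list \<Rightarrow> bool" where
  "is_longest_st_path V s t p \<longleftrightarrow> is_st_path V s t p \<and>
     (\<forall>q. is_st_path V s t q \<longrightarrow> length q \<le> length p)"

text \<open>Memory cells indexed by nat holding integers; every instruction costs one step.
  Indirect addressing uses nat of the stored value.\<close>
datatype instr =
    Const nat int
  | Add nat nat nat
  | Sub nat nat nat
  | Load nat nat
  | Store nat nat
  | Jz nat nat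
  | Jpos nat nat
  | Halt

type_synonym config = "nat \<times> (nat \<Rightarrow> int)"

definition halted :: "instr list \<Rightarrow> config \<Rightarrow> bool" where
  "halted P c \<longleftrightarrow> fst c \<ge> length P \<or> P ! fst c = Halt"

fun exec :: "instr \<Rightarrow> config \<Rightarrow> config" where
  "exec (Const d v) (pc, M) = (Suc pc, M(d := v))"
| "exec (Add d a b) (pc, M) = (Suc pc, M(d := M a + M b))"
| "exec (Sub d a b) (pc, M) = (Suc pc, M(d := M a - M b))"
| "exec (Load d a) (pc, M) = (Suc pc, M(d := M (nat (M a))))"
| "exec (Store a b) (pc, M) = (Suc pc, M(nat (M a) := M b))"
| "exec (Jz r j) (pc, M) = ((if M r = 0 then j else Suc pc), M)"
| "exec (Jpos r j) (pc, M) = ((if M r > 0 then j else Suc pc), M)"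
| "exec Halt (pc, M) = (pc, M)"

definition step :: "instr list \<Rightarrow> config \<Rightarrow> config" where
  "step P c = (if halted P c then c else exec (P ! fst c) c)"

definition run :: "instr list \<Rightarrow> nat \<Rightarrow> config \<Rightarrow> config" where
  "run P T c = (step P ^^ T) c"

definition input_mem :: "nat \<Rightarrow> nat \<Rightarrow> nat \<Rightarrow> nat \<Rightarrow> int \<times> int \<Rightarrow> int \<times> int \<Rightarrow> nat \<Rightarrow> int" where
  "input_mem m n k l s t i =
     (if i = 0 then int m else if i = 1 then int n else if i = 2 then int k
      else if i = 3 then int l else if i = 4 then fst s else if i = 5 then snd s
      else if i = 6 then fst t else if i = 7 then snd t else 0)"

definition output_path :: "(nat \<Rightarrow> int) \<Rightarrow> (int \<times> int) list" where
  "output_path M = map (\<lambda>i. (M (2 * i + 1), M (2 * i + 2))) [0..<nat (M 0)]"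

end

theory Submission
  imports Defs
begin

text \<open>A rectangle with both sides at least 2 has a Hamiltonian path between any two of its vertices, unless
  these form an inner column of two vertices, or an inner row, and so disconnect it. Cutting an L-shaped graph into
  rectangles, or inserting a Hamiltonian path of one part next to a corner of a Hamiltonian path of the
  other part, yields a Hamiltonian path of the whole graph if both arms have width at least 2 and the
  end points are not a cut pair. In all other cases the obstruction is local: either a cut vertex (parts
  behind it cannot be visited), or the cut pair consisting of the end points (only one side can be
  visited, so the longer of two paths is taken), or a detour of one vertex that is easily refuted.

  All paths are lists obtained from boustrophedon paths of rectangles by concatenation, reversal,
  splitting at a vertex, coordinate changes and case distinctions on linear inequalities. The class of
  lists that the machine computes in time linear in the area is closed under these operations.\<close>

section \<open>Structured code for the machine\<close>

text \<open>The obstacle is the machine: flat memory, no multiplication, no calls, and a time bound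
  to be proved for one fixed program. So no program is written down for the algorithm. The paths are
  ordinary functions, \<open>computable\<close> is preserved by every operation they are built from,
  and the program comes out of the proof that \<open>lpath\<close> is computable. This dictates the
  form of the path functions: coordinates and tests are linear in the eight inputs, lists are
  compared by length only, an inapplicable case of a rectangle is signalled by the empty list, and
  the bounds must hold for all inputs with positive sides, also where the returned list is no path
  at all.

  Optimality never requires computing a maximum. In each case a vertex set is exhibited that
  confines every path between the end points, or two such sets of which one confines it, and the
  constructed paths visit these sets completely. Only \<open>longest_top\<close> and
  \<open>longest_flat\<close> need more: there the obvious set contains one vertex that has to be
  given up.\<close>

text \<open>Code is relocatable: \<open>B p\<close> is the code to be placed at address \<open>p\<close>.\<close>

definition sem :: "(nat \<Rightarrow> instr list) \<Rightarrow> (nat \<Rightarrow> int) \<Rightarrow> nat \<Rightarrow> (nat \<Rightarrow> int) \<Rightarrow> bool" where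
  "sem B M T M' \<longleftrightarrow>
     (\<forall>pre post. run (pre @ B (length pre) @ post) T (length pre, M)
        = (length pre + length (B (length pre)), M'))"

lemma run_add: "run P (T + T') c = run P T' (run P T c)"
  by (simp add: run_def add.commute[of T T'] funpow_add)

lemma run_Suc: "run P (Suc T) c = run P T (step P c)"
  by (simp add: run_def funpow_Suc_right del: funpow.simps)

lemma run_0 [simp]: "run P 0 c = c"
  by (simp add: run_def)

lemma step_at:
  assumes "P = pre @ i # post" "p = length pre" "i \<noteq> Halt"
  shows "step P (p, M) = exec i (p, M)"
  using assms by (simp add: step_def halted_def)

fun straight :: "instr \<Rightarrow> bool" where
  "straight (Jz r j) = False"
| "straight (Jpos r j) = False"
| "straight Halt = False"
| "straight _ = True"

lemma sem_instr:
  assumes "straight i"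
  shows "sem (\<lambda>p. [i]) M 1 (snd (exec i (0, M)))"
  unfolding sem_def
proof (intro allI)
  fix pre post :: "instr list"
  have "step (pre @ [i] @ post) (length pre, M) = exec i (length pre, M)"
    using assms by (intro step_at[of _ pre i post]) auto
  also have "\<dots> = (length pre + 1, snd (exec i (0, M)))"
    using assms by (cases i) auto
  finally show "run (pre @ [i] @ post) 1 (length pre, M)
    = (length pre + length [i], snd (exec i (0, M)))"
    by (simp add: run_def)
qed

definition bseq :: "(nat \<Rightarrow> instr list) \<Rightarrow> (nat \<Rightarrow> instr list) \<Rightarrow> nat \<Rightarrow> instr list" where
  "bseq B C p = B p @ C (p + length (B p))"

lemma sem_seq:
  assumes "sem B M T M'" "sem C M' T' M''"
  shows "sem (bseq B C) M (T + T') M''"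
  unfolding sem_def
proof (intro allI)
  fix pre post :: "instr list"
  let ?p = "length pre"
  have 1: "run (pre @ B ?p @ (C (?p + length (B ?p)) @ post)) T (?p, M)
     = (?p + length (B ?p), M')"
    using assms(1) unfolding sem_def by blast
  have 2: "run ((pre @ B ?p) @ C (length (pre @ B ?p)) @ post) T' (length (pre @ B ?p), M')
     = (length (pre @ B ?p) + length (C (length (pre @ B ?p))), M'')"
    using assms(2) unfolding sem_def by blast
  show "run (pre @ bseq B C ?p @ post) (T + T') (?p, M)
     = (?p + length (bseq B C ?p), M'')"
    using 1 2 by (simp add: run_add bseq_def)
qed

lemma sem_nil: "sem (\<lambda>p. []) M 0 M"
  by (simp add: sem_def)

lemma sem_list:
  assumes "list_all straight is" "M' = fold (\<lambda>i M. snd (exec i (0, M))) is M"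
  shows "sem (\<lambda>p. is) M (length is) M'"
  using assms
proof (induction "is" arbitrary: M)
  case Nil
  then show ?case by (simp add: sem_nil)
next
  case (Cons i "is")
  have "sem (\<lambda>p. is) (snd (exec i (0, M))) (length is) M'" using Cons by simp
  from sem_seq[OF sem_instr this] show ?case
    using Cons.prems by (simp add: bseq_def[abs_def])
qed

text \<open>Unconditional jumps are a \<^term>\<open>Jz\<close> on cell 41, which is reset to 0 just before.\<close>

definition bif :: "nat \<Rightarrow> (nat \<Rightarrow> instr list) \<Rightarrow> (nat \<Rightarrow> instr list) \<Rightarrow> nat \<Rightarrow> instr list" where
  "bif r B C p =
     (let c = C (p + 1); q = p + 1 + length c + 2; b = B q
      in [Jpos r q] @ c @ [Const 41 0, Jz 41 (q + length b)] @ b)"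

lemma sem_if_pos:
  assumes "M r > 0" "sem B M T M'"
  shows "sem (bif r B C) M (Suc T) M'"
  unfolding sem_def
proof (intro allI)
  fix pre post :: "instr list"
  let ?p = "length pre"
  define c where "c = C (?p + 1)"
  define q where "q = ?p + 1 + length c + 2"
  define b where "b = B q"
  let ?pre = "pre @ [Jpos r q] @ c @ [Const 41 0, Jz 41 (q + length b)]"
  have P: "pre @ bif r B C ?p @ post = ?pre @ B (length ?pre) @ post"
    by (simp add: bif_def Let_def c_def q_def b_def)
  have q: "q = length ?pre" by (simp add: q_def)
  have "step (?pre @ B (length ?pre) @ post) (?p, M) = exec (Jpos r q) (?p, M)"
    by (intro step_at[of _ pre _ "c @ [Const 41 0, Jz 41 (q + length b)] @ B (length ?pre) @ post"]) simp_all
  then have "step (?pre @ B (length ?pre) @ post) (?p, M) = (length ?pre, M)"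
    using assms(1) q by simp
  moreover have "run (?pre @ B (length ?pre) @ post) T (length ?pre, M)
     = (length ?pre + length (B (length ?pre)), M')"
    using assms(2) unfolding sem_def by blast
  moreover have "length ?pre + length (B (length ?pre)) = ?p + length (bif r B C ?p)"
    by (simp add: bif_def Let_def c_def q_def b_def)
  ultimately show "run (pre @ bif r B C ?p @ post) (Suc T) (?p, M)
     = (?p + length (bif r B C ?p), M')"
    unfolding P run_Suc by simp
qed

text \<open>The branch for a failed test sits directly behind the jump and has to leap over the
  other branch. The three extra steps are the test and the two instructions of this leap, which also
  clear cell 41.\<close>

lemma sem_if_nonpos:
  assumes "\<not> M r > 0" "sem C M T M'"
  shows "sem (bif r B C) M (T + 3) (M'(41 := 0))"
  unfolding sem_def
proof (intro allI)
  fix pre post :: "instr list"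
  let ?p = "length pre"
  define c where "c = C (?p + 1)"
  define q where "q = ?p + 1 + length c + 2"
  define b where "b = B q"
  let ?pre = "pre @ [Jpos r q]"
  let ?post = "[Const 41 0, Jz 41 (q + length b)] @ b @ post"
  let ?P = "pre @ bif r B C ?p @ post"
  have P: "?P = ?pre @ C (length ?pre) @ ?post"
    by (simp add: bif_def Let_def c_def q_def b_def)
  have "step ?P (?p, M) = exec (Jpos r q) (?p, M)"
    by (intro step_at[of _ pre _ "C (length ?pre) @ ?post"]) (simp_all add: P)
  then have 1: "step ?P (?p, M) = (length ?pre, M)"
    using assms(1) by simp
  have 2: "run ?P T (length ?pre, M) = (length ?pre + length c, M')"
    using assms(2) unfolding sem_def P c_def by (metis length_append_singleton Suc_eq_plus1)
  have 3: "step ?P (length ?pre + length c, M') = (Suc (length ?pre + length c), M'(41 := 0))"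
    by (subst step_at[of _ "?pre @ c" "Const 41 0" "Jz 41 (q + length b) # b @ post"])
       (simp_all add: P c_def)
  have 4: "step ?P (Suc (length ?pre + length c), M'(41 := 0)) = (q + length b, M'(41 := 0))"
    by (subst step_at[of _ "?pre @ c @ [Const 41 0]" "Jz 41 (q + length b)" "b @ post"])
       (simp_all add: P c_def)
  have "run ?P (Suc (T + Suc (Suc 0))) (?p, M) = (q + length b, M'(41 := 0))"
    unfolding run_Suc 1 run_add 2 3 4 by simp
  moreover have "q + length b = ?p + length (bif r B C ?p)"
    by (simp add: bif_def Let_def c_def q_def b_def)
  ultimately show "run ?P (T + 3) (?p, M) = (?p + length (bif r B C ?p), M'(41 := 0))"
    by (simp add: numeral_3_eq_3)
qed

text \<open>\<open>E\<close> computes the tested value and is run again in every round; hence the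
  jump back leads to \<open>p\<close>, the start of \<open>E\<close>.\<close>

definition bwhile :: "nat \<Rightarrow> (nat \<Rightarrow> instr list) \<Rightarrow> (nat \<Rightarrow> instr list) \<Rightarrow> nat \<Rightarrow> instr list" where
  "bwhile r E B p =
     (let e = E p; q = p + length e; b = B (q + 3)
      in e @ [Jpos r (q + 3), Const 41 0, Jz 41 (q + 5 + length b)] @ b @ [Const 41 0, Jz 41 p])"

lemma sem_while_exit:
  assumes "sem E M T M'" "\<not> M' r > 0"
  shows "sem (bwhile r E B) M (T + 3) (M'(41 := 0))"
  unfolding sem_def
proof (intro allI)
  fix pre post :: "instr list"
  let ?p = "length pre"
  define e where "e = E ?p"
  define q where "q = ?p + length e"
  define b where "b = B (q + 3)"
  let ?P = "pre @ bwhile r E B ?p @ post"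
  let ?rest = "[Const 41 0, Jz 41 (q + 5 + length b)] @ b @ [Const 41 0, Jz 41 ?p] @ post"
  have P: "?P = pre @ E ?p @ [Jpos r (q + 3)] @ ?rest"
    by (simp add: bwhile_def Let_def e_def q_def b_def)
  have 1: "run ?P T (?p, M) = (q, M')"
    using assms(1) unfolding sem_def P q_def e_def by blast
  have 2: "step ?P (q, M') = (Suc q, M')"
    by (subst step_at[of _ "pre @ e" "Jpos r (q+3)" ?rest]) (use assms in \<open>simp_all add: P q_def e_def\<close>)
  have 3: "step ?P (Suc q, M') = (Suc (Suc q), M'(41 := 0))"
    by (subst step_at[of _ "pre @ e @ [Jpos r (q+3)]" "Const 41 0"
          "[Jz 41 (q + 5 + length b)] @ b @ [Const 41 0, Jz 41 ?p] @ post"])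
       (simp_all add: P q_def e_def)
  have 4: "step ?P (Suc (Suc q), M'(41 := 0)) = (q + 5 + length b, M'(41 := 0))"
    by (subst step_at[of _ "pre @ e @ [Jpos r (q+3), Const 41 0]" "Jz 41 (q + 5 + length b)"
          "b @ [Const 41 0, Jz 41 ?p] @ post"])
       (simp_all add: P q_def e_def)
  have "run ?P (T + Suc (Suc (Suc 0))) (?p, M) = (q + 5 + length b, M'(41 := 0))"
    unfolding run_add 1 run_Suc 2 3 4 by simp
  moreover have "q + 5 + length b = ?p + length (bwhile r E B ?p)"
    by (simp add: bwhile_def Let_def e_def q_def b_def)
  ultimately show "run ?P (T + 3) (?p, M) = (?p + length (bwhile r E B ?p), M'(41 := 0))"
    by (simp add: numeral_3_eq_3)
qed

text \<open>Only one round is unrolled; the induction is left to the users, who know the termination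
  measure. The three extra steps are the successful test and the jump back.\<close>

lemma sem_while_step:
  assumes "sem E M T1 M1" "M1 r > 0" "sem B M1 T2 M2" "sem (bwhile r E B) (M2(41 := 0)) T3 M3"
  shows "sem (bwhile r E B) M (T1 + T2 + T3 + 3) M3"
  unfolding sem_def
proof (intro allI)
  fix pre post :: "instr list"
  let ?p = "length pre"
  define e where "e = E ?p"
  define q where "q = ?p + length e"
  define b where "b = B (q + 3)"
  let ?P = "pre @ bwhile r E B ?p @ post"
  let ?j = "[Const 41 0, Jz 41 (q + 5 + length b)]"
  let ?pre = "pre @ e @ [Jpos r (q + 3)] @ ?j"
  let ?rest = "[Const 41 0, Jz 41 ?p] @ post"
  have P: "?P = pre @ E ?p @ [Jpos r (q + 3)] @ ?j @ b @ ?rest"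
    by (simp add: bwhile_def Let_def e_def q_def b_def)
  have lp: "length ?pre = q + 3" by (simp add: q_def)
  have P2: "?P = ?pre @ B (length ?pre) @ ?rest"
    unfolding lp by (simp add: P e_def b_def)
  have 1: "run ?P T1 (?p, M) = (q, M1)"
    using assms(1) unfolding sem_def P q_def e_def by blast
  have 2: "step ?P (q, M1) = (q + 3, M1)"
    by (subst step_at[of _ "pre @ e" "Jpos r (q+3)" "?j @ b @ ?rest"])
       (use assms in \<open>simp_all add: P q_def e_def\<close>)
  have 3: "run ?P T2 (q + 3, M1) = (q + 3 + length b, M2)"
  proof -
    have "run (?pre @ B (length ?pre) @ ?rest) T2 (length ?pre, M1)
       = (length ?pre + length (B (length ?pre)), M2)"
      using assms(3) unfolding sem_def by blast
    then show ?thesis unfolding P2[symmetric] unfolding lp b_def[symmetric] .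
  qed
  have 4: "step ?P (q + 3 + length b, M2) = (Suc (q + 3 + length b), M2(41 := 0))"
    by (subst step_at[of _ "?pre @ b" "Const 41 0" "[Jz 41 ?p] @ post"])
       (simp_all add: P q_def e_def)
  have 5: "step ?P (Suc (q + 3 + length b), M2(41 := 0)) = (?p, M2(41 := 0))"
    by (subst step_at[of _ "?pre @ b @ [Const 41 0]" "Jz 41 ?p" post])
       (simp_all add: P q_def e_def)
  have 6: "run ?P T3 (?p, M2(41 := 0)) = (?p + length (bwhile r E B ?p), M3)"
    using assms(4) unfolding sem_def by blast
  have "run ?P (T1 + Suc (T2 + Suc (Suc T3))) (?p, M) = (?p + length (bwhile r E B ?p), M3)"
    unfolding run_add 1 run_Suc 2 3 4 5 6 by simp
  then show "run ?P (T1 + T2 + T3 + 3) (?p, M) = (?p + length (bwhile r E B ?p), M3)"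
    by (simp add: numeral_3_eq_3 algebra_simps)
qed

section \<open>Programs with scalar variables and stacks of points\<close>

text \<open>Cells below 40 are variables, cells 40 to 63 are scratch, cell \<open>64 + j\<close> points to the first
  free slot of stack \<open>j\<close>, and the \<open>N\<close> stacks are interleaved in the memory above.\<close>

type_synonym state = "(nat \<Rightarrow> int) \<times> (nat \<Rightarrow> (int \<times> int) list)"

text \<open>Level \<open>i\<close> of the layout holds the \<open>i\<close>-th points of all stacks,
  two cells each. Thus every stack can grow without a bound known in advance, and consecutive points
  of one stack are \<open>2 * N\<close> cells apart.\<close>

definition slot :: "nat \<Rightarrow> nat \<Rightarrow> nat \<Rightarrow> nat" where
  "slot N j i = 64 + N + 2 * (N * i + j)"

text \<open>Cells 40 to 63 and the slots at and beyond the top of a stack are unconstrained: scratch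
  values may be overwritten freely, and popping a point amounts to lowering a pointer.\<close>

definition Rel :: "nat \<Rightarrow> (nat \<Rightarrow> int) \<Rightarrow> state \<Rightarrow> bool" where
  "Rel N M s \<longleftrightarrow> (\<forall>v<40. M v = fst s v) \<and>
     (\<forall>j<N. M (64 + j) = int (slot N j (length (snd s j))) \<and>
        (\<forall>i<length (snd s j). (M (slot N j i), M (slot N j i + 1)) = snd s j ! i))"

lemma slot_eq_iff:
  assumes "j < N" "j' < N"
  shows "slot N j i = slot N j' i' \<longleftrightarrow> i = i' \<and> j = j'"
proof
  assume "slot N j i = slot N j' i'"
  then have e: "N * i + j = N * i' + j'" by (simp add: slot_def)
  then have "(N * i + j) div N = (N * i' + j') div N" "(N * i + j) mod N = (N * i' + j') mod N"
    by simp_all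
  then show "i = i' \<and> j = j'" using assms by simp
qed simp

text \<open>All slots have the parity of \<open>N\<close>, so a cell for a first coordinate is never
  one for a second coordinate.\<close>

lemma slot_neq_Suc: "slot N j i \<noteq> Suc (slot N j' i')"
  unfolding slot_def by presburger

lemma slot_ge: "j < N \<Longrightarrow> slot N j i \<ge> 64 + N"
  by (simp add: slot_def)

lemma Rel_temp:
  assumes "Rel N M s" "40 \<le> r" "r < 64"
  shows "Rel N (M(r := x)) s"
  using assms slot_ge unfolding Rel_def by (fastforce simp: slot_def)

lemma Rel_var:
  assumes "Rel N M (\<sigma>, \<beta>)" "v < 40"
  shows "Rel N (M(v := x)) (\<sigma>(v := x), \<beta>)"
  using assms unfolding Rel_def by (fastforce simp: slot_def)

lemma Rel_push:
  assumes R: "Rel N M (\<sigma>, \<beta>)" and j: "j < N"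
    and a: "a = slot N j (length (\<beta> j))" and a': "a' = slot N j (Suc (length (\<beta> j)))"
  shows "Rel N (M(a := x, Suc a := y, 64 + j := int a')) (\<sigma>, \<beta>(j := \<beta> j @ [(x, y)]))"
  unfolding Rel_def fst_conv snd_conv
proof (intro conjI allI impI)
  fix v :: nat assume "v < 40"
  then show "(M(a := x, Suc a := y, 64 + j := int a')) v = \<sigma> v"
    using R j by (auto simp: Rel_def a slot_def)
next
  fix j' assume j': "j' < N"
  show "(M(a := x, Suc a := y, 64 + j := int a')) (64 + j')
      = int (slot N j' (length ((\<beta>(j := \<beta> j @ [(x, y)])) j')))"
    using R j j' by (auto simp: Rel_def a a' slot_def algebra_simps)
  fix i assume i: "i < length ((\<beta>(j := \<beta> j @ [(x, y)])) j')"
  let ?M = "M(a := x, Suc a := y, 64 + j := int a')"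
  have ne: "slot N j' i \<noteq> 64 + j" "Suc (slot N j' i) \<noteq> 64 + j"
    using j by (auto simp: slot_def)
  have ne2: "slot N j' i \<noteq> Suc a" "Suc (slot N j' i) \<noteq> a"
    using slot_neq_Suc[of N j' i j] slot_neq_Suc[of N j "length (\<beta> j)" j' i] by (simp_all add: a)
  have eq: "slot N j' i = a \<longleftrightarrow> i = length (\<beta> j) \<and> j' = j"
    unfolding a using slot_eq_iff[OF j' j] .
  show "(?M (slot N j' i), ?M (slot N j' i + 1)) = (\<beta>(j := \<beta> j @ [(x, y)])) j' ! i"
  proof (cases "j' = j \<and> i = length (\<beta> j)")
    case True
    then show ?thesis using ne ne2 eq j by (auto simp: a slot_def)
  next
    case False
    then have il: "i < length (\<beta> j')" and na: "slot N j' i \<noteq> a" using i eq by (auto split: if_splits)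
    have "(M (slot N j' i), M (slot N j' i + 1)) = \<beta> j' ! i"
      using R j' il by (simp add: Rel_def)
    then show ?thesis using ne ne2 na False il i by (auto simp: nth_append split: if_splits)
  qed
qed

lemma Rel_pop:
  assumes R: "Rel N M (\<sigma>, \<beta>)" and j: "j < N" and ne: "\<beta> j \<noteq> []"
    and a: "a = slot N j (length (\<beta> j) - 1)"
  shows "M (64 + j) - int (2 * N) = int a" "M a = fst (last (\<beta> j))" "M (Suc a) = snd (last (\<beta> j))"
    "Rel N (M(64 + j := int a)) (\<sigma>, \<beta>(j := butlast (\<beta> j)))"
proof -
  have l: "length (\<beta> j) = Suc (length (\<beta> j) - 1)" using ne by simp
  have "M (64 + j) = int (slot N j (length (\<beta> j)))" using R j by (simp add: Rel_def)
  then show "M (64 + j) - int (2 * N) = int a"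
    unfolding a by (subst (asm) l) (simp add: slot_def algebra_simps)
  have "(M a, M (a + 1)) = \<beta> j ! (length (\<beta> j) - 1)"
    using R j ne by (simp add: Rel_def a)
  then have "(M a, M (Suc a)) = last (\<beta> j)" using ne by (simp add: last_conv_nth)
  then show "M a = fst (last (\<beta> j))" "M (Suc a) = snd (last (\<beta> j))"
    by (metis fst_conv, metis snd_conv)
  have A: "slot N j' i \<noteq> 64 + j" "Suc (slot N j' i) \<noteq> 64 + j" for j' i
    using j by (auto simp: slot_def)
  show "Rel N (M(64 + j := int a)) (\<sigma>, \<beta>(j := butlast (\<beta> j)))"
    using R A unfolding Rel_def by (auto simp: a nth_butlast)
qed

text \<open>The name stands for \<open>realizable\<close>.\<close>

definition rz :: "nat \<Rightarrow> (state \<Rightarrow> bool) \<Rightarrow> (state \<Rightarrow> state \<Rightarrow> bool) \<Rightarrow> (state \<Rightarrow> nat) \<Rightarrow> bool" where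
  "rz N P Q T \<longleftrightarrow> (\<exists>B. \<forall>M s. Rel N M s \<longrightarrow> P s \<longrightarrow>
     (\<exists>t M' s'. sem B M t M' \<and> t \<le> T s \<and> Rel N M' s' \<and> Q s s'))"

lemma rz_conseq:
  assumes "rz N P Q T" "\<And>s. P' s \<Longrightarrow> P s" "\<And>s s'. P' s \<Longrightarrow> Q s s' \<Longrightarrow> Q' s s'"
    "\<And>s. P' s \<Longrightarrow> T s \<le> T' s"
  shows "rz N P' Q' T'"
  using assms unfolding rz_def by (meson order_trans)

lemma rz_pre: "rz N P Q T \<Longrightarrow> (\<And>s. P' s \<Longrightarrow> P s) \<Longrightarrow> rz N P' Q T"
  by (erule rz_conseq) auto

lemma rz_skip: "rz N P (\<lambda>s s'. s' = s) (\<lambda>_. 0)"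
  unfolding rz_def by (rule exI[of _ "\<lambda>p. []"]) (blast intro: sem_nil)

lemma rz_seq:
  assumes "rz N P Q T" "rz N P' Q' T'"
    and "\<And>s s'. P s \<Longrightarrow> Q s s' \<Longrightarrow> P' s' \<and> T s + T' s' \<le> TT s"
    and "\<And>s s' s''. P s \<Longrightarrow> Q s s' \<Longrightarrow> Q' s' s'' \<Longrightarrow> QQ s s''"
  shows "rz N P QQ TT"
proof -
  obtain B where B: "\<And>M s. Rel N M s \<Longrightarrow> P s \<Longrightarrow>
     \<exists>t M' s'. sem B M t M' \<and> t \<le> T s \<and> Rel N M' s' \<and> Q s s'"
    using assms(1) unfolding rz_def by blast
  obtain C where C: "\<And>M s. Rel N M s \<Longrightarrow> P' s \<Longrightarrow>
     \<exists>t M' s'. sem C M t M' \<and> t \<le> T' s \<and> Rel N M' s' \<and> Q' s s'"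
    using assms(2) unfolding rz_def by blast
  show ?thesis unfolding rz_def
  proof (intro exI[of _ "bseq B C"] allI impI)
    fix M s assume "Rel N M s" "P s"
    from B[OF this] obtain t M' s' where 1: "sem B M t M'" "t \<le> T s" "Rel N M' s'" "Q s s'" by blast
    have "P' s'" using assms(3) \<open>P s\<close> 1 by blast
    from C[OF 1(3) this] obtain t' M'' s'' where
      2: "sem C M' t' M''" "t' \<le> T' s'" "Rel N M'' s''" "Q' s' s''" by blast
    have "t + t' \<le> TT s" using assms(3)[OF \<open>P s\<close> 1(4)] 1 2 by linarith
    then show "\<exists>t M' s'. sem (bseq B C) M t M' \<and> t \<le> TT s \<and> Rel N M' s' \<and> QQ s s'"
      using sem_seq[OF 1(1) 2(1)] 2 assms(4)[OF \<open>P s\<close> 1(4) 2(4)] by blast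
  qed
qed

text \<open>The machine adds and subtracts but does not multiply, so an integer coefficient is
  encoded by the multiplicity of a variable in \<open>ps\<close> or \<open>ns\<close>, and an
  evaluation takes a fixed number of instructions. The bound \<open>k\<close> is 8 for expressions
  in the inputs and 40 for those in all variables.\<close>

definition lin :: "nat \<Rightarrow> ((nat \<Rightarrow> int) \<Rightarrow> int) \<Rightarrow> bool" where
  "lin k e \<longleftrightarrow> (\<exists>c ps ns. set ps \<subseteq> {..<k} \<and> set ns \<subseteq> {..<k} \<and>
     (\<forall>\<sigma>. e \<sigma> = c + (\<Sum>v\<leftarrow>ps. \<sigma> v) - (\<Sum>v\<leftarrow>ns. \<sigma> v)))"

lemma lin_const: "lin k (\<lambda>\<sigma>. c)"
  unfolding lin_def by (rule exI[of _ c], rule exI[of _ "[]"], rule exI[of _ "[]"]) simp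

lemma lin_var: "v < k \<Longrightarrow> lin k (\<lambda>\<sigma>. \<sigma> v)"
  unfolding lin_def by (rule exI[of _ 0], rule exI[of _ "[v]"], rule exI[of _ "[]"]) simp

lemma lin_add:
  assumes "lin k e" "lin k f"
  shows "lin k (\<lambda>\<sigma>. e \<sigma> + f \<sigma>)"
proof -
  obtain c ps ns where "set ps \<subseteq> {..<k}" "set ns \<subseteq> {..<k}"
    "\<And>\<sigma>. e \<sigma> = c + (\<Sum>v\<leftarrow>ps. \<sigma> v) - (\<Sum>v\<leftarrow>ns. \<sigma> v)"
    using assms(1) unfolding lin_def by blast
  moreover obtain c' ps' ns' where "set ps' \<subseteq> {..<k}" "set ns' \<subseteq> {..<k}"
    "\<And>\<sigma>. f \<sigma> = c' + (\<Sum>v\<leftarrow>ps'. \<sigma> v) - (\<Sum>v\<leftarrow>ns'. \<sigma> v)"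
    using assms(2) unfolding lin_def by blast
  ultimately show ?thesis unfolding lin_def
    by (intro exI[of _ "c + c'"] exI[of _ "ps @ ps'"] exI[of _ "ns @ ns'"]) auto
qed

lemma lin_minus:
  assumes "lin k e" "lin k f"
  shows "lin k (\<lambda>\<sigma>. e \<sigma> - f \<sigma>)"
proof -
  obtain c ps ns where "set ps \<subseteq> {..<k}" "set ns \<subseteq> {..<k}"
    "\<And>\<sigma>. e \<sigma> = c + (\<Sum>v\<leftarrow>ps. \<sigma> v) - (\<Sum>v\<leftarrow>ns. \<sigma> v)"
    using assms(1) unfolding lin_def by blast
  moreover obtain c' ps' ns' where "set ps' \<subseteq> {..<k}" "set ns' \<subseteq> {..<k}"
    "\<And>\<sigma>. f \<sigma> = c' + (\<Sum>v\<leftarrow>ps'. \<sigma> v) - (\<Sum>v\<leftarrow>ns'. \<sigma> v)"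
    using assms(2) unfolding lin_def by blast
  ultimately show ?thesis unfolding lin_def
    by (intro exI[of _ "c - c'"] exI[of _ "ps @ ns'"] exI[of _ "ns @ ps'"]) auto
qed

lemma lin_mono: "lin k e \<Longrightarrow> k \<le> k' \<Longrightarrow> lin k' e"
  unfolding lin_def by (meson lessThan_subset_iff order_trans)

lemma lin_cong: "lin k e \<Longrightarrow> (\<And>v. v < k \<Longrightarrow> \<sigma> v = \<sigma>' v) \<Longrightarrow> e \<sigma> = e \<sigma>'"
proof -
  assume "lin k e" and eq: "\<And>v. v < k \<Longrightarrow> \<sigma> v = \<sigma>' v"
  then obtain c ps ns where s: "set ps \<subseteq> {..<k}" "set ns \<subseteq> {..<k}"
    and e: "\<And>\<sigma>. e \<sigma> = c + (\<Sum>v\<leftarrow>ps. \<sigma> v) - (\<Sum>v\<leftarrow>ns. \<sigma> v)"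
    unfolding lin_def by blast
  have "map \<sigma> ps = map \<sigma>' ps" "map \<sigma> ns = map \<sigma>' ns"
    using s eq by auto
  then show "e \<sigma> = e \<sigma>'" unfolding e by (simp only:)
qed

lemma sem_add_list:
  assumes "set vs \<subseteq> {..<40}" "40 \<le> r"
  shows "\<exists>B. \<forall>M. sem B M (length vs) (M(r := M r + (\<Sum>v\<leftarrow>vs. M v)))"
  using assms(1)
proof (induction vs)
  case Nil
  show ?case using sem_nil by (intro exI[of _ "\<lambda>p. []"]) simp
next
  case (Cons v vs)
  then have "set vs \<subseteq> {..<40}" by simp
  from Cons.IH[OF this] obtain B
    where B: "\<And>M. sem B M (length vs) (M(r := M r + (\<Sum>v\<leftarrow>vs. M v)))" by blast
  show ?case
  proof (intro exI[of _ "bseq (\<lambda>p. [Add r r v]) B"] allI)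
    fix M :: "nat \<Rightarrow> int"
    have "v < 40" "set vs \<subseteq> {..<40}" using Cons by auto
    then have "map (M(r := M r + M v)) vs = map M vs" using assms(2) by (intro map_cong) auto
    then have *: "(\<Sum>u\<leftarrow>vs. (M(r := M r + M v)) u) = (\<Sum>u\<leftarrow>vs. M u)" by (simp only:)
    have "M(r := M r + M v, r := (M(r := M r + M v)) r + (\<Sum>u\<leftarrow>vs. (M(r := M r + M v)) u))
      = M(r := M r + (\<Sum>v\<leftarrow>v # vs. M v))" by (subst *) (simp add: algebra_simps)
    then show "sem (bseq (\<lambda>p. [Add r r v]) B) M (length (v # vs)) (M(r := M r + (\<Sum>v\<leftarrow>v # vs. M v)))"
      using sem_seq[OF sem_instr[of "Add r r v" M] B] by simp
  qed
qed

lemma sem_sub_list: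
  assumes "set vs \<subseteq> {..<40}" "40 \<le> r"
  shows "\<exists>B. \<forall>M. sem B M (length vs) (M(r := M r - (\<Sum>v\<leftarrow>vs. M v)))"
  using assms(1)
proof (induction vs)
  case Nil
  show ?case using sem_nil by (intro exI[of _ "\<lambda>p. []"]) simp
next
  case (Cons v vs)
  then have "set vs \<subseteq> {..<40}" by simp
  from Cons.IH[OF this] obtain B
    where B: "\<And>M. sem B M (length vs) (M(r := M r - (\<Sum>v\<leftarrow>vs. M v)))" by blast
  show ?case
  proof (intro exI[of _ "bseq (\<lambda>p. [Sub r r v]) B"] allI)
    fix M :: "nat \<Rightarrow> int"
    have "v < 40" "set vs \<subseteq> {..<40}" using Cons by auto
    then have "map (M(r := M r - M v)) vs = map M vs" using assms(2) by (intro map_cong) auto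
    then have *: "(\<Sum>u\<leftarrow>vs. (M(r := M r - M v)) u) = (\<Sum>u\<leftarrow>vs. M u)" by (simp only:)
    have "M(r := M r - M v, r := (M(r := M r - M v)) r - (\<Sum>u\<leftarrow>vs. (M(r := M r - M v)) u))
      = M(r := M r - (\<Sum>v\<leftarrow>v # vs. M v))" by (subst *) (simp add: algebra_simps)
    then show "sem (bseq (\<lambda>p. [Sub r r v]) B) M (length (v # vs)) (M(r := M r - (\<Sum>v\<leftarrow>v # vs. M v)))"
      using sem_seq[OF sem_instr[of "Sub r r v" M] B] by simp
  qed
qed

lemma sem_lin:
  assumes "lin 40 e" "40 \<le> r"
  shows "\<exists>B K. \<forall>M \<sigma>. (\<forall>v<40. M v = \<sigma> v) \<longrightarrow> sem B M K (M(r := e \<sigma>))"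
proof -
  obtain c ps ns where s: "set ps \<subseteq> {..<40}" "set ns \<subseteq> {..<40}"
    and e: "\<And>\<sigma>. e \<sigma> = c + (\<Sum>v\<leftarrow>ps. \<sigma> v) - (\<Sum>v\<leftarrow>ns. \<sigma> v)"
    using assms(1) unfolding lin_def by blast
  obtain B where B: "\<And>M. sem B M (length ps) (M(r := M r + (\<Sum>v\<leftarrow>ps. M v)))"
    using sem_add_list[OF s(1) assms(2)] by blast
  obtain C where C: "\<And>M. sem C M (length ns) (M(r := M r - (\<Sum>v\<leftarrow>ns. M v)))"
    using sem_sub_list[OF s(2) assms(2)] by blast
  show ?thesis
  proof (rule exI[of _ "bseq (bseq (\<lambda>p. [Const r c]) B) C"],
      rule exI[of _ "1 + length ps + length ns"], intro allI impI)
    fix M \<sigma> :: "nat \<Rightarrow> int" assume M: "\<forall>v<40. M v = \<sigma> v"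
    have m: "map (M(r := x)) ps = map \<sigma> ps" "map (M(r := x)) ns = map \<sigma> ns" for x
      using s M assms(2) by (auto simp del: fun_upd_apply) auto
    have "sem (bseq (bseq (\<lambda>p. [Const r c]) B) C) M (1 + length ps + length ns)
       (M(r := c + (\<Sum>v\<leftarrow>ps. \<sigma> v) - (\<Sum>v\<leftarrow>ns. \<sigma> v)))"
      using sem_seq[OF sem_seq[OF sem_instr[of "Const r c" M] B] C] m
      by (simp del: fun_upd_apply) (simp add: fun_upd_apply[of _ r _ r])
    then show "sem (bseq (bseq (\<lambda>p. [Const r c]) B) C) M (1 + length ps + length ns) (M(r := e \<sigma>))"
      by (simp add: e)
  qed
qed

text \<open>The value is built up in cell 40, because \<open>e\<close> may refer to \<open>v\<close>
  itself. It is then moved by adding a zero, as there is no copy instruction.\<close>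

lemma rz_asg:
  assumes "lin 40 e" "v < 40"
  shows "\<exists>K. rz N P (\<lambda>s s'. s' = ((fst s)(v := e (fst s)), snd s)) (\<lambda>_. K)"
proof -
  obtain B K where B: "\<And>M \<sigma>. (\<forall>v<40. M v = \<sigma> v) \<Longrightarrow> sem B M K (M(40 := e \<sigma>))"
    using sem_lin[OF assms(1), of 40] by auto
  let ?B = "bseq B (\<lambda>p. [Const 41 0, Add v 40 41])"
  show ?thesis unfolding rz_def
  proof (rule exI[of _ "K + 2"], rule exI[of _ ?B], intro allI impI)
    fix M and s :: state assume R: "Rel N M s"
    let ?M = "M(40 := e (fst s), 41 := 0)"
    have "sem B M K (M(40 := e (fst s)))" using R by (intro B) (auto simp: Rel_def)
    moreover have "sem (\<lambda>p. [Const 41 0, Add v 40 41]) (M(40 := e (fst s))) (length [Const 41 0, Add v 40 41])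
        (?M(v := e (fst s)))"
      by (intro sem_list) (simp_all add: fun_eq_iff)
    ultimately have "sem ?B M (K + 2) (?M(v := e (fst s)))" using sem_seq by fastforce
    moreover have "Rel N (?M(v := e (fst s))) ((fst s)(v := e (fst s)), snd s)"
      using R assms(2) by (intro Rel_var Rel_temp) auto
    ultimately show "\<exists>t M' s'. sem ?B M t M' \<and> t \<le> K + 2 \<and> Rel N M' s' \<and>
        s' = ((fst s)(v := e (fst s)), snd s)"
      by blast
  qed
qed

lemma rz_push:
  assumes "lin 40 e" "lin 40 f" "j < N"
  shows "\<exists>K. rz N P (\<lambda>s s'. s' = (fst s, (snd s)(j := snd s j @ [(e (fst s), f (fst s))]))) (\<lambda>_. K)"
proof -
  obtain B K where B: "\<And>M \<sigma>. (\<forall>v<40. M v = \<sigma> v) \<Longrightarrow> sem B M K (M(42 := e \<sigma>))"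
    using sem_lin[OF assms(1), of 42] by auto
  obtain C L where C: "\<And>M \<sigma>. (\<forall>v<40. M v = \<sigma> v) \<Longrightarrow> sem C M L (M(43 := f \<sigma>))"
    using sem_lin[OF assms(2), of 43] by auto
  let ?i = "\<lambda>i p. [i :: instr]"
  let ?is = "[Store (64 + j) 42, Const 44 1, Add 45 (64 + j) 44, Store 45 43,
      Const 44 (int (2 * N)), Add (64 + j) (64 + j) 44]"
  let ?B = "bseq (bseq B C) (\<lambda>p. ?is)"
  show ?thesis unfolding rz_def
  proof (rule exI[of _ "K + L + 6"], rule exI[of _ ?B], intro allI impI)
    fix M and s :: state assume R: "Rel N M s"
    obtain \<sigma> \<beta> where s: "s = (\<sigma>, \<beta>)" by force
    define a where "a = slot N j (length (\<beta> j))"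
    define a' where "a' = slot N j (Suc (length (\<beta> j)))"
    have a2: "int a' = int a + int (2 * N)" by (simp add: a_def a'_def slot_def algebra_simps)
    have pa: "M (64 + j) = int a" using R assms(3) by (simp add: Rel_def s a_def)
    have ge: "a \<ge> 64 + N" using slot_ge[OF assms(3)] by (simp add: a_def)
    have M: "\<forall>v<40. M v = \<sigma> v" using R by (simp add: Rel_def s)
    let ?M1 = "M(42 := e \<sigma>, 43 := f \<sigma>)"
    have "sem (bseq B C) M (K + L) ?M1"
      using M by (intro sem_seq[OF B C]) auto
    moreover have "sem (\<lambda>p. ?is) ?M1 (length ?is)
       (?M1(a := e \<sigma>, 44 := 1, 45 := int (Suc a), Suc a := f \<sigma>, 44 := int (2 * N), 64 + j := int a'))"
      using pa ge assms(3) a2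
      by (intro sem_list) (simp_all add: fun_upd_def fun_eq_iff nat_add_distrib)
    ultimately have 1: "sem ?B M (K + L + length ?is)
       (?M1(a := e \<sigma>, 44 := 1, 45 := int (Suc a), Suc a := f \<sigma>, 44 := int (2 * N), 64 + j := int a'))"
      by (rule sem_seq)
    have "?M1(a := e \<sigma>, 44 := 1, 45 := int (Suc a), Suc a := f \<sigma>, 44 := int (2 * N), 64 + j := int a')
       = (?M1(44 := int (2 * N), 45 := int (Suc a)))(a := e \<sigma>, Suc a := f \<sigma>, 64 + j := int a')"
      using ge by (auto simp: fun_eq_iff)
    moreover have R1: "Rel N (?M1(44 := int (2 * N), 45 := int (Suc a))) (\<sigma>, \<beta>)"
      using R unfolding s by (intro Rel_temp) auto
    ultimately have "Rel N (?M1(a := e \<sigma>, 44 := 1, 45 := int (Suc a), Suc a := f \<sigma>, 44 := int (2 * N), 64 + j := int a'))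
       (\<sigma>, \<beta>(j := \<beta> j @ [(e \<sigma>, f \<sigma>)]))"
      using Rel_push[OF R1 assms(3) a_def a'_def] by simp
    then show "\<exists>t M' s'. sem ?B M t M' \<and> t \<le> K + L + 6 \<and> Rel N M' s' \<and>
        s' = (fst s, (snd s)(j := snd s j @ [(e (fst s), f (fst s))]))"
      using 1 unfolding s fst_conv snd_conv
      by (intro exI conjI) (assumption | simp)+
  qed
qed

lemma rz_pop:
  assumes "j < N" "v < 40" "w < 40" "v \<noteq> w"
  shows "\<exists>K. rz N (\<lambda>s. snd s j \<noteq> []) (\<lambda>s s'. s' = ((fst s)(v := fst (last (snd s j)), w := snd (last (snd s j))),
      (snd s)(j := butlast (snd s j)))) (\<lambda>_. K)"
proof -
  let ?is = "[Const 44 (int (2 * N)), Sub (64 + j) (64 + j) 44, Load v (64 + j), Const 44 1,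
     Add 45 (64 + j) 44, Load w 45]"
  let ?B = "\<lambda>p. ?is"
  show ?thesis unfolding rz_def
  proof (rule exI[of _ "6"], rule exI[of _ ?B], intro allI impI)
    fix M and s :: state assume R: "Rel N M s" and ne: "snd s j \<noteq> []"
    obtain \<sigma> \<beta> where s: "s = (\<sigma>, \<beta>)" by force
    define a where "a = slot N j (length (\<beta> j) - 1)"
    note R' = R[unfolded s]
    have ne': "\<beta> j \<noteq> []" using ne s by simp
    note P = Rel_pop[OF R' assms(1) ne' a_def]
    have ge: "a \<ge> 64 + N" using slot_ge[OF assms(1)] by (simp add: a_def)
    define x y where "x = fst (last (\<beta> j))" and "y = snd (last (\<beta> j))"
    let ?M1 = "M(44 := int (2 * N))"
    let ?M2 = "?M1(64 + j := int a)"
    let ?M3 = "?M2(v := x)"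
    let ?M4 = "?M3(44 := 1)"
    let ?M5 = "?M4(45 := int (Suc a))"
    let ?M6 = "?M5(w := y)"
    have 1: "sem ?B M (length ?is) ?M6"
      using P(1-3) ge assms
      by (intro sem_list) (simp_all add: fun_upd_def fun_eq_iff nat_add_distrib x_def y_def)
    have "?M6 = (M(64 + j := int a))(44 := 1, 45 := int (Suc a), v := x, w := y)"
      using assms ge by (auto simp: fun_eq_iff)
    moreover have "Rel N ((M(64 + j := int a))(44 := 1, 45 := int (Suc a), v := x, w := y))
        (\<sigma>(v := x, w := y), \<beta>(j := butlast (\<beta> j)))"
      using Rel_var[OF Rel_var[OF Rel_temp[OF Rel_temp[OF P(4)]]]] assms by simp
    ultimately have "Rel N ?M6 (\<sigma>(v := x, w := y), \<beta>(j := butlast (\<beta> j)))" by simp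
    then show "\<exists>t M' s'. sem ?B M t M' \<and> t \<le> 6 \<and> Rel N M' s' \<and>
        s' = ((fst s)(v := fst (last (snd s j)), w := snd (last (snd s j))),
      (snd s)(j := butlast (snd s j)))"
      using 1 unfolding s fst_conv snd_conv x_def y_def
      by (intro exI conjI) (assumption | simp)+
  qed
qed

text \<open>The outcome of a test is the sign of the scratch cell 40.\<close>

definition test :: "nat \<Rightarrow> (state \<Rightarrow> bool) \<Rightarrow> bool" where
  "test N b \<longleftrightarrow> (\<exists>B K. \<forall>M s. Rel N M s \<longrightarrow>
     (\<exists>t M'. sem B M t M' \<and> t \<le> K \<and> Rel N M' s \<and> (M' 40 > 0 \<longleftrightarrow> b s)))"

lemma test_pos:
  assumes "lin 40 e"
  shows "test N (\<lambda>s. e (fst s) > 0)"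
proof -
  obtain B K where B: "\<And>M \<sigma>. (\<forall>v<40. M v = \<sigma> v) \<Longrightarrow> sem B M K (M(40 := e \<sigma>))"
    using sem_lin[OF assms(1), of 40] by auto
  show ?thesis unfolding test_def
  proof (rule exI[of _ B], rule exI[of _ K], intro allI impI)
    fix M and s :: state assume R: "Rel N M s"
    have "sem B M K (M(40 := e (fst s)))" using R by (intro B) (auto simp: Rel_def)
    moreover have "Rel N (M(40 := e (fst s))) s" using R by (intro Rel_temp) auto
    ultimately show "\<exists>t M'. sem B M t M' \<and> t \<le> K \<and> Rel N M' s \<and> (M' 40 > 0 \<longleftrightarrow> e (fst s) > 0)"
      by (metis fun_upd_same order_refl)
  qed
qed

text \<open>Lengths are not counted. Two stack pointers differ by \<open>2 * N\<close> times the
  difference of the lengths plus the offset \<open>2 * j - 2 * k\<close>, so the sign of a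
  difference of pointers, corrected by a constant, decides the comparison.\<close>

lemma test_longer:
  assumes "j < N" "k < N"
  shows "test N (\<lambda>s. length (snd s j) > length (snd s k) + c)"
proof -
  let ?d = "int (2 * N * c) + 2 * int j - 2 * int k"
  let ?is = "[Sub 40 (64 + j) (64 + k), Const 42 ?d, Sub 40 40 42]"
  let ?B = "\<lambda>p. ?is"
  show ?thesis unfolding test_def
  proof (rule exI[of _ ?B], rule exI[of _ 3], intro allI impI)
    fix M and s :: state assume R: "Rel N M s"
    let ?x = "int (slot N j (length (snd s j))) - int (slot N k (length (snd s k)))"
    have 1: "sem ?B M (length ?is) (M(42 := ?d, 40 := ?x - ?d))"
      using R assms by (intro sem_list) (simp_all add: Rel_def fun_eq_iff)
    have "?x - ?d = 2 * int N * (int (length (snd s j)) - int (length (snd s k)) - int c)"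
      by (simp add: slot_def algebra_simps)
    then have "?x - ?d > 0 \<longleftrightarrow> length (snd s j) > length (snd s k) + c"
      using assms by (simp add: zero_less_mult_iff) linarith
    moreover have "Rel N (M(42 := ?d, 40 := ?x - ?d)) s" using R by (intro Rel_temp) auto
    ultimately show "\<exists>t M'. sem ?B M t M' \<and> t \<le> 3 \<and> Rel N M' s \<and>
        (M' 40 > 0 \<longleftrightarrow> length (snd s j) > length (snd s k) + c)"
      using 1 by (intro exI[of _ "length ?is"] exI[of _ "M(42 := ?d, 40 := ?x - ?d)"]) simp
  qed
qed

lemma test_nonempty:
  assumes "j < N"
  shows "test N (\<lambda>s. snd s j \<noteq> [])"
proof -
  let ?is = "[Const 42 (int (slot N j 0)), Sub 40 (64 + j) 42]"
  let ?B = "\<lambda>p. ?is"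
  show ?thesis unfolding test_def
  proof (rule exI[of _ ?B], rule exI[of _ 2], intro allI impI)
    fix M and s :: state assume R: "Rel N M s"
    let ?x = "int (slot N j (length (snd s j)))" and ?d = "int (slot N j 0)"
    have 1: "sem ?B M (length ?is) (M(42 := ?d, 40 := ?x - ?d))"
      using R assms by (intro sem_list) (simp_all add: Rel_def fun_eq_iff)
    have "?x - ?d > 0 \<longleftrightarrow> snd s j \<noteq> []"
      using assms by (simp add: slot_def zero_less_mult_iff)
    moreover have "Rel N (M(42 := ?d, 40 := ?x - ?d)) s" using R by (intro Rel_temp) auto
    ultimately show "\<exists>t M'. sem ?B M t M' \<and> t \<le> 2 \<and> Rel N M' s \<and> (M' 40 > 0 \<longleftrightarrow> snd s j \<noteq> [])"
      using 1 by (intro exI[of _ "length ?is"] exI[of _ "M(42 := ?d, 40 := ?x - ?d)"]) simp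
  qed
qed

lemma test_not:
  assumes "test N b"
  shows "test N (\<lambda>s. \<not> b s)"
proof -
  obtain B K where B: "\<And>M s. Rel N M s \<Longrightarrow>
     \<exists>t M'. sem B M t M' \<and> t \<le> K \<and> Rel N M' s \<and> (M' 40 > 0 \<longleftrightarrow> b s)"
    using assms unfolding test_def by blast
  let ?B = "bseq B (bif 40 (\<lambda>p. [Const 40 0]) (\<lambda>p. [Const 40 1]))"
  show ?thesis unfolding test_def
  proof (rule exI[of _ ?B], rule exI[of _ "K + 4"], intro allI impI)
    fix M and s :: state assume R: "Rel N M s"
    from B[OF R] obtain t M' where 1: "sem B M t M'" "t \<le> K" "Rel N M' s" "M' 40 > 0 \<longleftrightarrow> b s" by blast
    show "\<exists>t M'. sem ?B M t M' \<and> t \<le> K + 4 \<and> Rel N M' s \<and> (M' 40 > 0 \<longleftrightarrow> \<not> b s)"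
    proof (cases "b s")
      case True
      have "sem ?B M (t + Suc 1) (M'(40 := 0))"
        using 1 True by (intro sem_seq[OF 1(1)] sem_if_pos) (auto intro: sem_instr[of "Const 40 0" M', simplified])
      moreover have "Rel N (M'(40 := 0)) s" using 1 by (intro Rel_temp) auto
      ultimately show ?thesis using 1 True by (intro exI[of _ "t + Suc 1"] exI[of _ "M'(40 := 0)"]) simp
    next
      case False
      have "sem ?B M (t + (1 + 3)) (M'(40 := 1, 41 := 0))"
        using 1 False by (intro sem_seq[OF 1(1)] sem_if_nonpos) (auto intro: sem_instr[of "Const 40 1" M', simplified])
      moreover have "Rel N (M'(40 := 1, 41 := 0)) s" using 1 by (intro Rel_temp) auto
      ultimately show ?thesis using 1 False by (intro exI[of _ "t + (1 + 3)"] exI[of _ "M'(40 := 1, 41 := 0)"]) simp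
    qed
  qed
qed

text \<open>Short circuit: if the first test fails, the nonpositive value in cell 40 is already the
  outcome.\<close>

lemma test_and:
  assumes "test N b" "test N c"
  shows "test N (\<lambda>s. b s \<and> c s)"
proof -
  obtain B K where B: "\<And>M s. Rel N M s \<Longrightarrow>
     \<exists>t M'. sem B M t M' \<and> t \<le> K \<and> Rel N M' s \<and> (M' 40 > 0 \<longleftrightarrow> b s)"
    using assms unfolding test_def by blast
  obtain C L where C: "\<And>M s. Rel N M s \<Longrightarrow>
     \<exists>t M'. sem C M t M' \<and> t \<le> L \<and> Rel N M' s \<and> (M' 40 > 0 \<longleftrightarrow> c s)"
    using assms unfolding test_def by blast
  let ?B = "bseq B (bif 40 C (\<lambda>p. []))"
  show ?thesis unfolding test_def
  proof (rule exI[of _ ?B], rule exI[of _ "K + L + 3"], intro allI impI)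
    fix M and s :: state assume R: "Rel N M s"
    from B[OF R] obtain t M' where 1: "sem B M t M'" "t \<le> K" "Rel N M' s" "M' 40 > 0 \<longleftrightarrow> b s" by blast
    show "\<exists>t M'. sem ?B M t M' \<and> t \<le> K + L + 3 \<and> Rel N M' s \<and> (M' 40 > 0 \<longleftrightarrow> b s \<and> c s)"
    proof (cases "b s")
      case True
      from C[OF 1(3)] obtain t' M'' where
        2: "sem C M' t' M''" "t' \<le> L" "Rel N M'' s" "M'' 40 > 0 \<longleftrightarrow> c s" by blast
      have "sem ?B M (t + Suc t') M''"
        using 1 True by (intro sem_seq[OF 1(1)] sem_if_pos 2) auto
      then show ?thesis using 1 2 True by (intro exI[of _ "t + Suc t'"] exI[of _ M'']) simp
    next
      case False
      have "sem ?B M (t + (0 + 3)) (M'(41 := 0))"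
        using 1 False by (intro sem_seq[OF 1(1)] sem_if_nonpos) (auto intro: sem_nil)
      moreover have "Rel N (M'(41 := 0)) s" using 1 by (intro Rel_temp) auto
      ultimately show ?thesis using 1 False by (intro exI[of _ "t + (0 + 3)"] exI[of _ "M'(41 := 0)"]) simp
    qed
  qed
qed

section \<open>Branching and loops with time bounds\<close>

lemma rz_if:
  assumes "test N b" "rz N (\<lambda>s. P s \<and> b s) Q T" "rz N (\<lambda>s. P s \<and> \<not> b s) Q T"
  shows "\<exists>K. rz N P Q (\<lambda>s. K + T s)"
proof -
  obtain E K where E: "\<And>M s. Rel N M s \<Longrightarrow>
     \<exists>t M'. sem E M t M' \<and> t \<le> K \<and> Rel N M' s \<and> (M' 40 > 0 \<longleftrightarrow> b s)"
    using assms(1) unfolding test_def by blast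
  obtain B where B: "\<And>M s. Rel N M s \<Longrightarrow> P s \<Longrightarrow> b s \<Longrightarrow>
     \<exists>t M' s'. sem B M t M' \<and> t \<le> T s \<and> Rel N M' s' \<and> Q s s'"
    using assms(2) unfolding rz_def by blast
  obtain C where C: "\<And>M s. Rel N M s \<Longrightarrow> P s \<Longrightarrow> \<not> b s \<Longrightarrow>
     \<exists>t M' s'. sem C M t M' \<and> t \<le> T s \<and> Rel N M' s' \<and> Q s s'"
    using assms(3) unfolding rz_def by blast
  let ?B = "bseq E (bif 40 B C)"
  show ?thesis unfolding rz_def
  proof (rule exI[of _ "K + 3"], rule exI[of _ ?B], intro allI impI)
    fix M and s :: state assume R: "Rel N M s" and P: "P s"
    from E[OF R] obtain t M' where 1: "sem E M t M'" "t \<le> K" "Rel N M' s" "M' 40 > 0 \<longleftrightarrow> b s" by blast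
    show "\<exists>t M' s'. sem ?B M t M' \<and> t \<le> K + 3 + T s \<and> Rel N M' s' \<and> Q s s'"
    proof (cases "b s")
      case True
      from B[OF 1(3) P True] obtain t' M'' s' where
        2: "sem B M' t' M''" "t' \<le> T s" "Rel N M'' s'" "Q s s'" by blast
      have "sem ?B M (t + Suc t') M''"
        using 1 True by (intro sem_seq[OF 1(1)] sem_if_pos 2) auto
      then show ?thesis using 1 2 True by (intro exI[of _ "t + Suc t'"] exI[of _ M''] exI[of _ s']) simp
    next
      case False
      from C[OF 1(3) P False] obtain t' M'' s' where
        2: "sem C M' t' M''" "t' \<le> T s" "Rel N M'' s'" "Q s s'" by blast
      have "sem ?B M (t + (t' + 3)) (M''(41 := 0))"
        using 1 False by (intro sem_seq[OF 1(1)] sem_if_nonpos 2) auto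
      moreover have "Rel N (M''(41 := 0)) s'" using 2 by (intro Rel_temp) auto
      ultimately show ?thesis using 1 2
        by (intro exI[of _ "t + (t' + 3)"] exI[of _ "M''(41 := 0)"] exI[of _ s']) simp
    qed
  qed
qed

text \<open>\<open>n\<close> ensures termination, while time is amortised: a round spends at most
  \<open>C * w s\<close>, and \<open>w s\<close> is taken out of the potential \<open>W\<close>.
  Being positive, \<open>w s\<close> also pays for the test and the jumps. Rounds of very different
  cost thus add up to a multiple of the initial potential, plus a constant for the last
  test.\<close>

lemma rz_while:
  fixes n w :: "state \<Rightarrow> nat"
  assumes b: "test N b"
    and body: "rz N (\<lambda>s. P s \<and> b s) Q T"
    and step: "\<And>s s'. P s \<Longrightarrow> b s \<Longrightarrow> Q s s' \<Longrightarrow> P s' \<and> n s' < n s \<and> W s' + w s \<le> W s \<and> T s \<le> C * w s \<and> 0 < w s"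
    and QQ: "\<And>s. P s \<Longrightarrow> \<not> b s \<Longrightarrow> QQ s s"
      "\<And>s s' s''. P s \<Longrightarrow> b s \<Longrightarrow> Q s s' \<Longrightarrow> QQ s' s'' \<Longrightarrow> QQ s s''"
  shows "\<exists>K. rz N P QQ (\<lambda>s. K * (W s + 1))"
proof -
  obtain E K where E: "\<And>M s. Rel N M s \<Longrightarrow>
     \<exists>t M'. sem E M t M' \<and> t \<le> K \<and> Rel N M' s \<and> (M' 40 > 0 \<longleftrightarrow> b s)"
    using b unfolding test_def by blast
  obtain B where B: "\<And>M s. Rel N M s \<Longrightarrow> P s \<Longrightarrow> b s \<Longrightarrow>
     \<exists>t M' s'. sem B M t M' \<and> t \<le> T s \<and> Rel N M' s' \<and> Q s s'"
    using body unfolding rz_def by blast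
  let ?B = "bwhile 40 E B"
  let ?K = "K + 3 + C"
  have "\<exists>t M' s'. sem ?B M t M' \<and> t \<le> ?K * (W s + 1) \<and> Rel N M' s' \<and> QQ s s'"
    if "Rel N M s" "P s" for M s
    using that
  proof (induction "n s" arbitrary: M s rule: less_induct)
    case less
    from E[OF less.prems(1)] obtain t M' where
      1: "sem E M t M'" "t \<le> K" "Rel N M' s" "M' 40 > 0 \<longleftrightarrow> b s" by blast
    show ?case
    proof (cases "b s")
      case True
      from B[OF 1(3) less.prems(2) True] obtain t' M'' s' where
        2: "sem B M' t' M''" "t' \<le> T s" "Rel N M'' s'" "Q s s'" by blast
      note st = step[OF less.prems(2) True 2(4)]
      have R: "Rel N (M''(41 := 0)) s'" using 2 by (intro Rel_temp) auto
      from less.hyps[OF _ R] st obtain t3 M3 s3 where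
        3: "sem ?B (M''(41 := 0)) t3 M3" "t3 \<le> ?K * (W s' + 1)" "Rel N M3 s3" "QQ s' s3" by blast
      have "sem ?B M (t + t' + t3 + 3) M3"
        using 1 True by (intro sem_while_step[OF 1(1) _ 2(1) 3(1)]) auto
      moreover have "t + t' + t3 + 3 \<le> ?K * (W s + 1)"
      proof -
        have "t + t' + t3 + 3 \<le> K + C * w s + ?K * (W s' + 1) + 3" using 1 2 3 st by linarith
        also have "\<dots> \<le> ?K * w s + ?K * (W s' + 1)"
        proof -
          have "K + 3 \<le> (K + 3) * w s" using st by simp
          then show ?thesis by (simp add: algebra_simps)
        qed
        also have "\<dots> = ?K * (W s' + w s + 1)" by (simp add: algebra_simps)
        also have "\<dots> \<le> ?K * (W s + 1)" using st by (intro mult_le_mono2) linarith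
        finally show ?thesis .
      qed
      ultimately show ?thesis using 3 QQ(2)[OF less.prems(2) True 2(4) 3(4)] by blast
    next
      case False
      have "sem ?B M (t + 3) (M'(41 := 0))" using 1 False by (intro sem_while_exit) auto
      moreover have "Rel N (M'(41 := 0)) s" using 1 by (intro Rel_temp) auto
      moreover have "t + 3 \<le> ?K * (W s + 1)"
      proof -
        have "t + 3 \<le> ?K * 1" using 1 by simp
        also have "\<dots> \<le> ?K * (W s + 1)" by (intro mult_le_mono2) simp
        finally show ?thesis .
      qed
      ultimately show ?thesis using QQ(1)[OF less.prems(2) False] by blast
    qed
  qed
  then show ?thesis unfolding rz_def by blast
qed

section \<open>Computable families of point lists\<close>

text \<open>Positive sides make the area at least 1, so that constant costs are absorbed by a
  multiple of the area.\<close>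

definition Dom :: "(nat \<Rightarrow> int) \<Rightarrow> bool" where
  "Dom \<sigma> \<longleftrightarrow> 1 \<le> \<sigma> 0 \<and> 1 \<le> \<sigma> 1"

definition area :: "(nat \<Rightarrow> int) \<Rightarrow> nat" where
  "area \<sigma> = nat (\<sigma> 0) * nat (\<sigma> 1)"

definition inputs_eq :: "(nat \<Rightarrow> int) \<Rightarrow> (nat \<Rightarrow> int) \<Rightarrow> bool" where
  "inputs_eq \<sigma> \<tau> \<longleftrightarrow> (\<forall>i<8. \<sigma> i = \<tau> i)"

lemma inputs_eq_refl [simp]: "inputs_eq \<sigma> \<sigma>"
  by (simp add: inputs_eq_def)

lemma inputs_eq_sym: "inputs_eq \<sigma> \<tau> \<Longrightarrow> inputs_eq \<tau> \<sigma>"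
  by (simp add: inputs_eq_def)

lemma inputs_eq_trans: "inputs_eq \<sigma> \<tau> \<Longrightarrow> inputs_eq \<tau> \<rho> \<Longrightarrow> inputs_eq \<sigma> \<rho>"
  by (simp add: inputs_eq_def)

lemma inputs_eq_upd [simp]: "v \<ge> 8 \<Longrightarrow> inputs_eq (\<sigma>(v := x)) \<tau> \<longleftrightarrow> inputs_eq \<sigma> \<tau>"
  "v \<ge> 8 \<Longrightarrow> inputs_eq \<tau> (\<sigma>(v := x)) \<longleftrightarrow> inputs_eq \<tau> \<sigma>"
  by (auto simp: inputs_eq_def)

lemma inputs_eq_area: "inputs_eq \<sigma> \<tau> \<Longrightarrow> area \<sigma> = area \<tau>"
  by (simp add: inputs_eq_def area_def)

lemma inputs_eq_Dom: "inputs_eq \<sigma> \<tau> \<Longrightarrow> Dom \<sigma> \<longleftrightarrow> Dom \<tau>"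
  by (simp add: inputs_eq_def Dom_def)

lemma lin_inputs: "lin 8 e \<Longrightarrow> inputs_eq \<sigma> \<tau> \<Longrightarrow> e \<sigma> = e \<tau>"
  by (rule lin_cong[of 8]) (auto simp: inputs_eq_def)

lemma area_pos: "Dom \<sigma> \<Longrightarrow> 1 \<le> area \<sigma>"
  by (auto simp: Dom_def area_def Suc_le_eq)

text \<open>The variables from 8 on are work space that any piece of code may change. A value that
  is referred to again after other code has run must therefore depend on the inputs only.\<close>

definition local :: "((nat \<Rightarrow> int) \<Rightarrow> 'a) \<Rightarrow> bool" where
  "local f \<longleftrightarrow> (\<forall>\<sigma> \<tau>. inputs_eq \<sigma> \<tau> \<longrightarrow> f \<sigma> = f \<tau>)"

lemma localD: "local f \<Longrightarrow> inputs_eq \<sigma> \<tau> \<Longrightarrow> f \<sigma> = f \<tau>"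
  by (simp add: local_def)

definition pre :: "nat \<Rightarrow> nat \<Rightarrow> state \<Rightarrow> bool" where
  "pre N d s \<longleftrightarrow> Dom (fst s) \<and> (\<forall>j. d < j \<and> j < N \<longrightarrow> snd s j = [])"

text \<open>The inputs are the variables 0 to 7. The result is appended to stack \<open>d\<close>, and the stacks
  above \<open>d\<close> are free for intermediate results.\<close>

definition computes ::
    "nat \<Rightarrow> nat \<Rightarrow> ((nat \<Rightarrow> int) \<Rightarrow> (int \<times> int) list) \<Rightarrow> nat \<Rightarrow> bool" where
  "computes N d f K \<longleftrightarrow> rz N (pre N d)
     (\<lambda>s s'. inputs_eq (fst s) (fst s') \<and> snd s' = (snd s)(d := snd s d @ f (fst s)))
     (\<lambda>s. K * area (fst s))"

text \<open>The length bound pays for reading or clearing a stack that holds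
  \<open>f \<sigma>\<close>. \<open>D\<close> is the number of further stacks used by the code. The
  total \<open>N\<close> stays open, since it enters the addresses of all slots and can only be
  fixed once the complete function is known.\<close>

definition computable :: "((nat \<Rightarrow> int) \<Rightarrow> (int \<times> int) list) \<Rightarrow> bool" where
  "computable f \<longleftrightarrow> local f \<and> (\<exists>L. \<forall>\<sigma>. Dom \<sigma> \<longrightarrow> length (f \<sigma>) \<le> L * area \<sigma>) \<and>
     (\<exists>D. \<forall>N d. d + D < N \<longrightarrow> (\<exists>K. computes N d f K))"

lemma computableI:
  assumes "local f" "\<And>\<sigma>. Dom \<sigma> \<Longrightarrow> length (f \<sigma>) \<le> L * area \<sigma>"
    "\<And>N d. d + D < N \<Longrightarrow> \<exists>K. computes N d f K"
  shows "computable f"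
  using assms unfolding computable_def by blast

lemma rz_const:
  assumes "rz N P Q (\<lambda>_. K)" "\<And>s. P' s \<Longrightarrow> P s \<and> Dom (fst s)"
    "\<And>s s'. P' s \<Longrightarrow> Q s s' \<Longrightarrow> Q' s s'"
  shows "rz N P' Q' (\<lambda>s. K * area (fst s))"
proof (rule rz_conseq[OF assms(1)])
  fix s assume "P' s"
  then have "1 \<le> area (fst s)" using assms(2) area_pos by blast
  then show "K \<le> K * area (fst s)" by simp
qed (use assms in auto)

lemma computable_Nil: "computable (\<lambda>\<sigma>. [])"
proof (rule computableI[where L = 0 and D = 0])
  show "\<exists>K. computes N d (\<lambda>\<sigma>. []) K" for N d
    unfolding computes_def by (rule exI[of _ 0], rule rz_conseq[OF rz_skip[where P = "\<lambda>_. True"]]) auto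
qed (auto simp: local_def)

lemma computable_point:
  assumes "lin 8 e" "lin 8 f"
  shows "computable (\<lambda>\<sigma>. [(e \<sigma>, f \<sigma>)])"
proof (rule computableI[where L = 1 and D = 0])
  show "local (\<lambda>\<sigma>. [(e \<sigma>, f \<sigma>)])"
    using assms by (auto simp: local_def intro: lin_inputs)
  show "length [(e \<sigma>, f \<sigma>)] \<le> 1 * area \<sigma>" if "Dom \<sigma>" for \<sigma>
    using area_pos[OF that] by simp
  fix N d :: nat assume "d + 0 < N"
  then obtain K where "rz N (pre N d)
      (\<lambda>s s'. s' = (fst s, (snd s)(d := snd s d @ [(e (fst s), f (fst s))]))) (\<lambda>_. K)"
    using rz_push[of e f d N] assms lin_mono[of 8 _ 40] by auto
  then show "\<exists>K. computes N d (\<lambda>\<sigma>. [(e \<sigma>, f \<sigma>)]) K"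
    unfolding computes_def by (intro exI[of _ K], elim rz_const) (auto simp: pre_def)
qed

lemma computes_append:
  assumes "computes N d f K" "computes N d g L" "local g"
  shows "computes N d (\<lambda>\<sigma>. f \<sigma> @ g \<sigma>) (K + L)"
  unfolding computes_def
proof (rule rz_seq[OF assms(1)[unfolded computes_def] assms(2)[unfolded computes_def]])
  fix s s' :: state assume "pre N d s"
    and "inputs_eq (fst s) (fst s') \<and> snd s' = (snd s)(d := snd s d @ f (fst s))"
  then show "pre N d s' \<and> K * area (fst s) + L * area (fst s') \<le> (K + L) * area (fst s)"
    using inputs_eq_Dom inputs_eq_area by (auto simp: pre_def algebra_simps)
next
  fix s s' s'' :: state assume "pre N d s"
    and "inputs_eq (fst s) (fst s') \<and> snd s' = (snd s)(d := snd s d @ f (fst s))"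
    and "inputs_eq (fst s') (fst s'') \<and> snd s'' = (snd s')(d := snd s' d @ g (fst s'))"
  then show "inputs_eq (fst s) (fst s'') \<and> snd s'' = (snd s)(d := snd s d @ f (fst s) @ g (fst s))"
    using localD[OF assms(3)] inputs_eq_trans by auto
qed

lemma computable_append:
  assumes "computable f" "computable g"
  shows "computable (\<lambda>\<sigma>. f \<sigma> @ g \<sigma>)"
proof -
  obtain L D where f: "local f" "\<And>\<sigma>. Dom \<sigma> \<Longrightarrow> length (f \<sigma>) \<le> L * area \<sigma>"
    "\<And>N d. d + D < N \<Longrightarrow> \<exists>K. computes N d f K" using assms(1) unfolding computable_def by blast
  obtain L' D' where g: "local g" "\<And>\<sigma>. Dom \<sigma> \<Longrightarrow> length (g \<sigma>) \<le> L' * area \<sigma>"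
    "\<And>N d. d + D' < N \<Longrightarrow> \<exists>K. computes N d g K" using assms(2) unfolding computable_def by blast
  show ?thesis
  proof (rule computableI[where L = "L + L'" and D = "D + D'"])
    show "local (\<lambda>\<sigma>. f \<sigma> @ g \<sigma>)" using f(1) g(1) by (auto simp: local_def)
    show "length (f \<sigma> @ g \<sigma>) \<le> (L + L') * area \<sigma>" if "Dom \<sigma>" for \<sigma>
      using f(2)[OF that] g(2)[OF that] by (simp add: algebra_simps)
    fix N d assume "d + (D + D') < N"
    then obtain K K' where "computes N d f K" "computes N d g K'"
      using f(3)[of d N] g(3)[of d N] by fastforce
    then show "\<exists>K. computes N d (\<lambda>\<sigma>. f \<sigma> @ g \<sigma>) K"
      using computes_append g(1) by blast
  qed
qed

definition cond :: "((nat \<Rightarrow> int) \<Rightarrow> bool) \<Rightarrow> bool" where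
  "cond b \<longleftrightarrow> local b \<and> (\<forall>N. test N (\<lambda>s. b (fst s)))"

lemma cond_less:
  assumes "lin 8 e" "lin 8 f"
  shows "cond (\<lambda>\<sigma>. e \<sigma> < f \<sigma>)"
  unfolding cond_def
proof
  show "local (\<lambda>\<sigma>. e \<sigma> < f \<sigma>)" unfolding local_def using assms lin_inputs by metis
  have "lin 40 (\<lambda>\<sigma>. f \<sigma> - e \<sigma>)" using assms by (auto intro!: lin_minus intro: lin_mono[of 8])
  from test_pos[OF this] show "\<forall>N. test N (\<lambda>s. e (fst s) < f (fst s))" by simp
qed

lemma cond_not: "cond b \<Longrightarrow> cond (\<lambda>\<sigma>. \<not> b \<sigma>)"
  unfolding cond_def local_def using test_not by auto

lemma cond_and: "cond b \<Longrightarrow> cond c \<Longrightarrow> cond (\<lambda>\<sigma>. b \<sigma> \<and> c \<sigma>)"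
  unfolding cond_def local_def using test_and by auto

lemma cond_or: "cond b \<Longrightarrow> cond c \<Longrightarrow> cond (\<lambda>\<sigma>. b \<sigma> \<or> c \<sigma>)"
  using cond_not[OF cond_and[OF cond_not cond_not]] by auto

lemma cond_le: "lin 8 e \<Longrightarrow> lin 8 f \<Longrightarrow> cond (\<lambda>\<sigma>. e \<sigma> \<le> f \<sigma>)"
  using cond_not[OF cond_less[of f e]] by (simp add: not_less)

lemma cond_eq: "lin 8 e \<Longrightarrow> lin 8 f \<Longrightarrow> cond (\<lambda>\<sigma>. e \<sigma> = f \<sigma>)"
  using cond_and[OF cond_le[of e f] cond_le[of f e]] by (simp add: order_eq_iff)

lemma computable_if:
  assumes "cond b" "computable f" "computable g"
  shows "computable (\<lambda>\<sigma>. if b \<sigma> then f \<sigma> else g \<sigma>)"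
proof -
  obtain L D where f: "local f" "\<And>\<sigma>. Dom \<sigma> \<Longrightarrow> length (f \<sigma>) \<le> L * area \<sigma>"
    "\<And>N d. d + D < N \<Longrightarrow> \<exists>K. computes N d f K" using assms(2) unfolding computable_def by blast
  obtain L' D' where g: "local g" "\<And>\<sigma>. Dom \<sigma> \<Longrightarrow> length (g \<sigma>) \<le> L' * area \<sigma>"
    "\<And>N d. d + D' < N \<Longrightarrow> \<exists>K. computes N d g K" using assms(3) unfolding computable_def by blast
  show ?thesis
  proof (rule computableI[where L = "L + L'" and D = "D + D'"])
    show "local (\<lambda>\<sigma>. if b \<sigma> then f \<sigma> else g \<sigma>)"
      using f(1) g(1) assms(1) by (auto simp: local_def cond_def)
    show "length (if b \<sigma> then f \<sigma> else g \<sigma>) \<le> (L + L') * area \<sigma>" if "Dom \<sigma>" for \<sigma>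
      using f(2)[OF that] g(2)[OF that] by (simp add: algebra_simps)
    fix N d assume "d + (D + D') < N"
    then obtain K K' where K: "computes N d f K" "computes N d g K'"
      using f(3)[of d N] g(3)[of d N] by fastforce
    let ?Q = "\<lambda>s s' :: state. inputs_eq (fst s) (fst s') \<and>
      snd s' = (snd s)(d := snd s d @ (if b (fst s) then f (fst s) else g (fst s)))"
    let ?T = "\<lambda>s :: state. (K + K') * area (fst s)"
    have "test N (\<lambda>s. b (fst s))" using assms(1) by (simp add: cond_def)
    moreover have "rz N (\<lambda>s. pre N d s \<and> b (fst s)) ?Q ?T"
      by (rule rz_conseq[OF K(1)[unfolded computes_def]]) (auto simp: algebra_simps)
    moreover have "rz N (\<lambda>s. pre N d s \<and> \<not> b (fst s)) ?Q ?T"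
      by (rule rz_conseq[OF K(2)[unfolded computes_def]]) (auto simp: algebra_simps)
    ultimately obtain K0 where "rz N (pre N d) ?Q (\<lambda>s. K0 + ?T s)"
      using rz_if[of N "\<lambda>s. b (fst s)" "pre N d" ?Q ?T] by auto
    moreover have "K0 + ?T s \<le> (K0 + K + K') * area (fst s)" if "pre N d s" for s
      using area_pos[of "fst s"] that by (simp add: pre_def algebra_simps)
    ultimately have "rz N (pre N d) ?Q (\<lambda>s. (K0 + K + K') * area (fst s))"
      by - (rule rz_conseq, assumption, auto)
    then show "\<exists>K. computes N d (\<lambda>\<sigma>. if b \<sigma> then f \<sigma> else g \<sigma>) K"
      unfolding computes_def by blast
  qed
qed

subsection \<open>Scanning a stack\<close>

text \<open>A transducer with one bit of memory. This is enough for coordinate changes, which ignore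
  the bit, and for cutting a list at a vertex, where the bit tells whether the vertex has been
  met.\<close>

fun scan :: "((nat \<Rightarrow> int) \<Rightarrow> bool \<Rightarrow> int \<times> int \<Rightarrow> bool \<times> (int \<times> int) list) \<Rightarrow> (nat \<Rightarrow> int) \<Rightarrow> bool
    \<Rightarrow> (int \<times> int) list \<Rightarrow> (int \<times> int) list" where
  "scan \<phi> \<sigma> c [] = []"
| "scan \<phi> \<sigma> c (x # xs) = snd (\<phi> \<sigma> c x) @ scan \<phi> \<sigma> (fst (\<phi> \<sigma> c x)) xs"

text \<open>A scanner sees the current point in the variables 30 and 31, and keeps a flag in variable 32.\<close>

definition scanner :: "((nat \<Rightarrow> int) \<Rightarrow> bool \<Rightarrow> int \<times> int \<Rightarrow> bool \<times> (int \<times> int) list) \<Rightarrow> bool" where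
  "scanner \<phi> \<longleftrightarrow> local \<phi> \<and> (\<forall>\<sigma> c x. length (snd (\<phi> \<sigma> c x)) \<le> 1) \<and>
    (\<forall>N d. d < N \<longrightarrow> (\<exists>K. rz N (\<lambda>s. fst s 32 \<in> {0, 1})
      (\<lambda>s s'. inputs_eq (fst s) (fst s') \<and>
        fst s' 32 = of_bool (fst (\<phi> (fst s) (fst s 32 = 1) (fst s 30, fst s 31))) \<and>
        snd s' = (snd s)(d := snd s d @ snd (\<phi> (fst s) (fst s 32 = 1) (fst s 30, fst s 31))))
      (\<lambda>_. K)))"

lemma scan_local: "local \<phi> \<Longrightarrow> inputs_eq \<sigma> \<tau> \<Longrightarrow> scan \<phi> \<sigma> c xs = scan \<phi> \<tau> c xs"
  by (induction xs arbitrary: c) (auto simp: local_def)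

lemma scan_length:
  "(\<And>c x. length (snd (\<phi> \<sigma> c x)) \<le> 1) \<Longrightarrow> length (scan \<phi> \<sigma> c xs) \<le> length xs"
proof (induction xs arbitrary: c)
  case (Cons x xs)
  then show ?case using add_mono[OF Cons.prems[of c x] Cons.IH[OF Cons.prems]] by simp
qed simp

text \<open>A stack is read from its top, so the scan sees the list reversed, and empties the stack
  on the way. Each round costs a constant, hence the bound by the length.\<close>

lemma rz_scan_loop:
  assumes \<phi>: "scanner \<phi>" and d: "d < e" "e < N"
  shows "\<exists>K. rz N (\<lambda>s. fst s 32 \<in> {0, 1})
    (\<lambda>s s'. inputs_eq (fst s) (fst s') \<and>
      snd s' = (snd s)(e := [], d := snd s d @ scan \<phi> (fst s) (fst s 32 = 1) (rev (snd s e))))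
    (\<lambda>s. K * (length (snd s e) + 1))"
proof -
  let ?I = "\<lambda>s :: state. fst s 32 \<in> {0, 1}"
  obtain K1 where K1: "rz N (\<lambda>s. snd s e \<noteq> []) (\<lambda>s s'.
      s' = ((fst s)(30 := fst (last (snd s e)), 31 := snd (last (snd s e))),
      (snd s)(e := butlast (snd s e)))) (\<lambda>_. K1)"
    using rz_pop[of e N 30 31] d by auto
  obtain K2 where K2: "rz N ?I
      (\<lambda>s s'. inputs_eq (fst s) (fst s') \<and>
        fst s' 32 = of_bool (fst (\<phi> (fst s) (fst s 32 = 1) (fst s 30, fst s 31))) \<and>
        snd s' = (snd s)(d := snd s d @ snd (\<phi> (fst s) (fst s 32 = 1) (fst s 30, fst s 31))))
      (\<lambda>_. K2)"
    using \<phi> d unfolding scanner_def by (meson less_trans)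
  have loc: "local \<phi>" using \<phi> by (simp add: scanner_def)
  define Q where "Q = (\<lambda>s s' :: state. inputs_eq (fst s) (fst s') \<and>
        fst s' 32 = of_bool (fst (\<phi> (fst s) (fst s 32 = 1) (last (snd s e)))) \<and>
        snd s' = (snd s)(e := butlast (snd s e),
           d := snd s d @ snd (\<phi> (fst s) (fst s 32 = 1) (last (snd s e)))))"
  have body: "rz N (\<lambda>s. ?I s \<and> snd s e \<noteq> []) Q (\<lambda>_. K1 + K2)"
  proof (rule rz_seq[OF rz_pre[OF K1, of "\<lambda>s. ?I s \<and> snd s e \<noteq> []"] K2])
    fix s s' s'' :: state
    assume s: "?I s \<and> snd s e \<noteq> []"
      and 1: "s' = ((fst s)(30 := fst (last (snd s e)), 31 := snd (last (snd s e))),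
      (snd s)(e := butlast (snd s e)))"
      and 2: "inputs_eq (fst s') (fst s'') \<and>
        fst s'' 32 = of_bool (fst (\<phi> (fst s') (fst s' 32 = 1) (fst s' 30, fst s' 31))) \<and>
        snd s'' = (snd s')(d := snd s' d @ snd (\<phi> (fst s') (fst s' 32 = 1) (fst s' 30, fst s' 31)))"
    have "\<phi> (fst s') = \<phi> (fst s)" using 1 by (intro localD[OF loc]) simp
    then show "Q s s''" using 1 2 d unfolding Q_def by auto
  qed auto
  have step: "?I s' \<and> length (snd s' e) < length (snd s e) \<and>
      length (snd s' e) + 1 \<le> length (snd s e) \<and> K1 + K2 \<le> (K1 + K2) * 1 \<and> (0::nat) < 1"
    if "?I s" "snd s e \<noteq> []" "Q s s'" for s s'
    using that d by (auto simp: Q_def)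
  have test: "test N (\<lambda>s. snd s e \<noteq> [])" using d by (intro test_nonempty)
  show ?thesis
  proof (rule rz_while[OF test body step])
    show "inputs_eq (fst s) (fst s) \<and> snd s = (snd s)(e := [],
        d := snd s d @ scan \<phi> (fst s) (fst s 32 = 1) (rev (snd s e)))"
      if "\<not> snd s e \<noteq> []" for s
      using that by (auto simp: fun_eq_iff)
  next
    fix s s' s'' :: state
    assume s: "?I s" "snd s e \<noteq> []" "Q s s'"
      "inputs_eq (fst s') (fst s'') \<and> snd s'' = (snd s')(e := [],
         d := snd s' d @ scan \<phi> (fst s') (fst s' 32 = 1) (rev (snd s' e)))"
    have r: "rev (snd s e) = last (snd s e) # rev (butlast (snd s e))"
      using s(2) by (metis append_butlast_last_id rev.simps(2) rev_rev_ident rev_swap)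
    have "inputs_eq (fst s) (fst s')" using s by (simp add: Q_def)
    then have l: "scan \<phi> (fst s') = scan \<phi> (fst s)"
      using scan_local[OF loc] inputs_eq_sym by (intro ext) blast
    show "inputs_eq (fst s) (fst s'') \<and> snd s'' = (snd s)(e := [],
         d := snd s d @ scan \<phi> (fst s) (fst s 32 = 1) (rev (snd s e)))"
      using s d inputs_eq_trans unfolding r l Q_def by (auto simp: fun_eq_iff)
  qed auto
qed

text \<open>The argument list is produced on the next stack and is gone after the scan, so that the
  stacks above \<open>d\<close> are empty again for whatever follows.\<close>

lemma computes_scan:
  assumes f: "computes N e f K" "e = Suc d" "e < N" "local f"
    "\<And>\<sigma>. Dom \<sigma> \<Longrightarrow> length (f \<sigma>) \<le> L * area \<sigma>" and \<phi>: "scanner \<phi>"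
  shows "\<exists>K. computes N d (\<lambda>\<sigma>. scan \<phi> \<sigma> c (rev (f \<sigma>))) K"
proof -
  let ?c = "of_bool c :: int"
  obtain K1 where K1: "rz N (\<lambda>_. True) (\<lambda>s s'. s' = ((fst s)(32 := ?c), snd s)) (\<lambda>_. K1)"
    using rz_asg[of "\<lambda>_. ?c" 32 N "\<lambda>_. True"] lin_const by auto
  obtain K2 where K2: "rz N (\<lambda>s. fst s 32 \<in> {0, 1})
    (\<lambda>s s'. inputs_eq (fst s) (fst s') \<and>
      snd s' = (snd s)(e := [], d := snd s d @ scan \<phi> (fst s) (fst s 32 = 1) (rev (snd s e))))
    (\<lambda>s. K2 * (length (snd s e) + 1))"
    using rz_scan_loop[OF \<phi>, of d e N] f by auto
  have loc: "local \<phi>" using \<phi> by (simp add: scanner_def)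
  let ?Q1 = "\<lambda>s s' :: state. inputs_eq (fst s) (fst s') \<and> fst s' 32 = ?c \<and> snd s' = (snd s)(e := f (fst s))"
  have A: "rz N (pre N d) ?Q1 (\<lambda>s. (K + K1) * area (fst s))"
  proof (rule rz_seq[OF rz_pre[OF f(1)[unfolded computes_def], of "pre N d"] K1])
    fix s s' :: state assume "pre N d s" "inputs_eq (fst s) (fst s') \<and> snd s' = (snd s)(e := snd s e @ f (fst s))"
    then show "True \<and> K * area (fst s) + K1 \<le> (K + K1) * area (fst s)"
      using area_pos[of "fst s"] by (auto simp: pre_def algebra_simps)
  next
    fix s s' s'' :: state
    assume "pre N d s" "inputs_eq (fst s) (fst s') \<and> snd s' = (snd s)(e := snd s e @ f (fst s))"
      "s'' = ((fst s')(32 := ?c), snd s')"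
    then show "?Q1 s s''" using f by (auto simp: pre_def)
  qed (use f in \<open>auto simp: pre_def\<close>)
  have "rz N (pre N d) (\<lambda>s s'. inputs_eq (fst s) (fst s') \<and>
       snd s' = (snd s)(d := snd s d @ scan \<phi> (fst s) c (rev (f (fst s)))))
     (\<lambda>s. (K + K1 + K2 * (L + 1)) * area (fst s))"
  proof (rule rz_seq[OF A K2])
    fix s s' :: state assume s: "pre N d s" "?Q1 s s'"
    have "length (snd s' e) + 1 \<le> (L + 1) * area (fst s)"
      using s f(5)[of "fst s"] area_pos[of "fst s"] by (auto simp: pre_def algebra_simps intro: add_mono)
    then have "K2 * (length (snd s' e) + 1) \<le> K2 * (L + 1) * area (fst s)"
      by (metis mult.assoc mult_le_mono2)
    then show "fst s' 32 \<in> {0, 1} \<and> (K + K1) * area (fst s) + K2 * (length (snd s' e) + 1)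
      \<le> (K + K1 + K2 * (L + 1)) * area (fst s)"
      using s by (auto simp: algebra_simps)
  next
    fix s s' s'' :: state assume s: "pre N d s" "?Q1 s s'"
      "inputs_eq (fst s') (fst s'') \<and>
      snd s'' = (snd s')(e := [], d := snd s' d @ scan \<phi> (fst s') (fst s' 32 = 1) (rev (snd s' e)))"
    have l: "scan \<phi> (fst s') = scan \<phi> (fst s)"
      using scan_local[OF loc] inputs_eq_sym s by (intro ext) blast
    have "snd s e = []" using s f by (simp add: pre_def)
    then show "inputs_eq (fst s) (fst s'') \<and>
       snd s'' = (snd s)(d := snd s d @ scan \<phi> (fst s) c (rev (f (fst s))))"
      using s f inputs_eq_trans unfolding l by (auto simp: fun_eq_iff)
  qed
  then show ?thesis unfolding computes_def by blast
qed

lemma computable_scan: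
  assumes "computable f" "scanner \<phi>"
  shows "computable (\<lambda>\<sigma>. scan \<phi> \<sigma> c (rev (f \<sigma>)))"
proof -
  obtain L D where f: "local f" "\<And>\<sigma>. Dom \<sigma> \<Longrightarrow> length (f \<sigma>) \<le> L * area \<sigma>"
    "\<And>N d. d + D < N \<Longrightarrow> \<exists>K. computes N d f K" using assms(1) unfolding computable_def by blast
  have loc: "local \<phi>" using assms(2) by (simp add: scanner_def)
  show ?thesis
  proof (rule computableI[where L = L and D = "Suc D"])
    show "local (\<lambda>\<sigma>. scan \<phi> \<sigma> c (rev (f \<sigma>)))"
      unfolding local_def using scan_local[OF loc] localD[OF f(1)] by metis
    show "length (scan \<phi> \<sigma> c (rev (f \<sigma>))) \<le> L * area \<sigma>" if "Dom \<sigma>" for \<sigma>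
      using f(2)[OF that] scan_length[of \<phi> \<sigma> c "rev (f \<sigma>)"] assms(2)
      by (auto simp: scanner_def intro: order_trans)
    fix N d assume d: "d + Suc D < N"
    then obtain K where "computes N (Suc d) f K" using f(3)[of "Suc d" N] by auto
    then show "\<exists>K. computes N d (\<lambda>\<sigma>. scan \<phi> \<sigma> c (rev (f \<sigma>))) K"
      using computes_scan[OF _ refl _ f(1) f(2) assms(2)] d by simp
  qed
qed

section \<open>Hamiltonian paths of point sets\<close>

text \<open>Adjacency is expressed by \<open>successively\<close> rather than by indices as in
  \<open>is_st_path\<close>, since this distributes over concatenation. The visited set is an
  explicit argument, so that gluing paths becomes set arithmetic.\<close>

definition hamp :: "(int \<times> int) set \<Rightarrow> int \<times> int \<Rightarrow> int \<times> int \<Rightarrow> (int \<times> int) list \<Rightarrow> bool" where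
  "hamp X s t p \<longleftrightarrow> p \<noteq> [] \<and> hd p = s \<and> last p = t \<and> distinct p \<and> set p = X \<and> successively sg_adj p"

lemma sg_adj_sym: "sg_adj u v \<longleftrightarrow> sg_adj v u"
  by (auto simp: sg_adj_def)

lemma sg_adj_Pair [simp]:
  "sg_adj (x, y) (x', y') \<longleftrightarrow> (x \<noteq> x' \<or> y \<noteq> y') \<and> \<bar>x - x'\<bar> \<le> 1 \<and> \<bar>y - y'\<bar> \<le> 1"
  by (auto simp: sg_adj_def)

lemma hamp_st_path: "hamp X s t p \<Longrightarrow> X \<subseteq> V \<Longrightarrow> is_st_path V s t p"
  by (auto simp: hamp_def is_st_path_def successively_conv_nth)

lemma hampD: "hamp X s t p \<Longrightarrow> s \<in> X" "hamp X s t p \<Longrightarrow> t \<in> X" "hamp X s t p \<Longrightarrow> p \<noteq> []"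
  by (auto simp: hamp_def)

lemma hamp_single: "hamp {s} s s [s]"
  by (simp add: hamp_def)

lemma hamp_append:
  assumes "hamp X s u p" "hamp Y v t q" "sg_adj u v" "X \<inter> Y = {}" "Z = X \<union> Y"
  shows "hamp Z s t (p @ q)"
  using assms by (auto simp: hamp_def successively_append_iff)

lemma hamp_Cons:
  assumes "hamp X u t p" "sg_adj s u" "s \<notin> X" "Z = insert s X"
  shows "hamp Z s t (s # p)"
  using hamp_append[OF hamp_single assms(1,2)] assms(3,4) by auto

lemma hamp_rev:
  assumes "hamp X s t p"
  shows "hamp X t s (rev p)"
proof -
  have "successively (\<lambda>x y. sg_adj y x) p \<longleftrightarrow> successively sg_adj p"
    by (simp add: sg_adj_sym)
  then show ?thesis using assms by (auto simp: hamp_def hd_rev last_rev)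
qed

lemma hamp_map:
  assumes "hamp X s t p" "\<And>u v. sg_adj u v \<Longrightarrow> sg_adj (g u) (g v)" "inj g"
  shows "hamp (g ` X) (g s) (g t) (map g p)"
proof -
  have "successively sg_adj (map g p)"
    using assms unfolding hamp_def successively_map by (auto intro: successively_mono)
  then show ?thesis
    using assms by (auto simp: hamp_def hd_map last_map distinct_map inj_on_def)
qed

lemma length_hamp: "hamp X s t p \<Longrightarrow> length p = card X"
  by (auto simp: hamp_def distinct_card)

section \<open>Rectangles, from a corner\<close>

text \<open>The \<open>w\<close> integers met on a walk from \<open>p\<close> in direction
  \<open>d\<close>; any \<open>d\<close> other than 1 is read as -1.\<close>

definition iv :: "int \<Rightarrow> int \<Rightarrow> int \<Rightarrow> int set" where
  "iv p d w = (if d = 1 then {p..p + w - 1} else {p - w + 1..p})"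

definition line :: "int \<Rightarrow> int \<Rightarrow> int \<Rightarrow> int \<Rightarrow> int \<Rightarrow> (int \<times> int) list" where
  "line x y dx dy n = map (\<lambda>r. (x + dx * int r, y + dy * int r)) [0..<nat n]"

lemma line_0: "n \<le> 0 \<Longrightarrow> line x y dx dy n = []"
  by (simp add: line_def)

lemma line_Suc: "n > 0 \<Longrightarrow> line x y dx dy n = (x, y) # line (x + dx) (y + dy) dx dy (n - 1)"
proof -
  assume "n > 0"
  then obtain k where k: "nat n = Suc k" "nat (n - 1) = k" by (cases "nat n") auto
  show ?thesis unfolding line_def k
    by (simp del: upt_Suc add: upt_conv_Cons map_Suc_upt[symmetric] algebra_simps)
qed

lemma hamp_vline:
  assumes "d \<in> {1, -1}" "0 < h"
  shows "hamp ({x} \<times> iv y d h) (x, y) (x, y + d * (h - 1)) (line x y 0 d h)"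
  using assms(2)
proof (induction "nat h" arbitrary: y h)
  case (Suc k)
  show ?case
  proof (cases "h = 1")
    case True
    then show ?thesis using hamp_single[of "(x,y)"] assms(1) by (auto simp: line_Suc line_0 iv_def)
  next
    case False
    then have "h > 1" "k = nat (h - 1)" using Suc by auto
    then have "hamp ({x} \<times> iv (y + d) d (h - 1)) (x, y + d) (x, y + d + d * (h - 1 - 1))
        (line x (y + d) 0 d (h - 1))" using Suc.hyps(1)[of "h - 1" "y + d"] by simp
    then have "hamp ({x} \<times> iv y d h) (x, y) (x, y + d + d * (h - 1 - 1))
        ((x, y) # line x (y + d) 0 d (h - 1))"
      by (rule hamp_Cons) (use assms(1) \<open>h > 1\<close> in \<open>auto simp: iv_def\<close>)
    moreover have "y + d + d * (h - 1 - 1) = y + d * (h - 1)" by (simp add: algebra_simps)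
    ultimately show ?thesis unfolding line_Suc[OF Suc.prems] by (simp only: add_0_right)
  qed
qed auto

lemma line_swap: "map prod.swap (line x y dx dy n) = line y x dy dx n"
  by (simp add: line_def)

lemma hamp_swap: "hamp X s t p \<Longrightarrow> hamp (prod.swap ` X) (prod.swap s) (prod.swap t) (map prod.swap p)"
  by (rule hamp_map) (auto simp: sg_adj_def)

lemma hamp_hline:
  assumes "d \<in> {1, -1}" "0 < w"
  shows "hamp (iv x d w \<times> {y}) (x, y) (x + d * (w - 1), y) (line x y d 0 w)"
  using hamp_swap[OF hamp_vline[OF assms, of y x]] by (simp add: line_swap product_swap)

text \<open>The offsets \<open>(i, j)\<close> at which a Hamiltonian path from the corner
  \<open>(0, 0)\<close> can end: in a single column or row only the opposite end, otherwise every
  other vertex.\<close>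

definition qvalid :: "int \<Rightarrow> int \<Rightarrow> int \<Rightarrow> int \<Rightarrow> bool" where
  "qvalid w h i j \<longleftrightarrow> 0 \<le> i \<and> i < w \<and> 0 \<le> j \<and> j < h \<and>
     (w = 1 \<and> j = h - 1 \<or> w \<noteq> 1 \<and> h = 1 \<and> i = w - 1 \<or> w \<noteq> 1 \<and> h \<noteq> 1 \<and> (i \<noteq> 0 \<or> j \<noteq> 0))"

text \<open>A path from the corner \<open>(px, py)\<close> of a \<open>w \<times> h\<close> rectangle extending in the directions
  \<open>dx, dy\<close>, to the point with offsets \<open>i, j\<close>: strip off a whole column or row, and go on from
  the adjacent corner of the remaining rectangle.\<close>

function qp :: "int \<Rightarrow> int \<Rightarrow> int \<Rightarrow> int \<Rightarrow> int \<Rightarrow> int \<Rightarrow> int \<Rightarrow> int \<Rightarrow> (int \<times> int) list" where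
  "qp px py dx dy w h i j =
    (if w \<le> 0 \<or> h \<le> 0 then []
     else if 1 \<le> i \<and> qvalid (w - 1) h (i - 1) (h - 1 - j)
     then line px py 0 dy h @ qp (px + dx) (py + dy * (h - 1)) dx (- dy) (w - 1) h (i - 1) (h - 1 - j)
     else if 1 \<le> j \<and> qvalid w (h - 1) (w - 1 - i) (j - 1)
     then line px py dx 0 w @ qp (px + dx * (w - 1)) (py + dy) (- dx) dy w (h - 1) (w - 1 - i) (j - 1)
     else if h \<le> 2
     then line px py 0 dy h @ qp (px + dx) py dx dy (w - 1) h (i - 1) j
     else line px py dx 0 w @ qp px (py + dy) dx dy w (h - 1) i (j - 1))"
  by pat_completeness auto
termination by (relation "measure (\<lambda>(px, py, dx, dy, w, h, i, j). nat w + nat h)") auto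

declare qp.simps [simp del]

lemma length_line [simp]: "length (line x y dx dy n) = nat n"
  by (simp add: line_def)

text \<open>Every branch strips a whole line off the rectangle, whether or not the arguments are
  valid. The bound must hold for invalid ones too, as \<open>computable\<close> asks for it on all
  of \<open>Dom\<close>.\<close>

lemma length_qp: "length (qp px py dx dy w h i j) \<le> nat w * nat h"
proof (induction px py dx dy w h i j rule: qp.induct)
  case (1 px py dx dy w h i j)
  show ?case
  proof (cases "w \<le> 0 \<or> h \<le> 0")
    case False
    then have "nat w = Suc (nat (w - 1))" "nat h = Suc (nat (h - 1))" by auto
    then have e: "nat w * nat h = nat h + nat (w - 1) * nat h" "nat w * nat h = nat w + nat w * nat (h - 1)"
      by (metis mult_Suc, metis mult_Suc_right)
    show ?thesis using 1 False by (subst qp.simps) (use e in \<open>auto intro: add_left_mono\<close>)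
  qed (simp add: qp.simps)
qed

lemma iv_split: "0 < w \<Longrightarrow> d \<in> {1, -1} \<Longrightarrow> iv p d w = insert p (iv (p + d) d (w - 1))"
  by (auto simp: iv_def)

lemma iv_notin: "d \<in> {1, -1} \<Longrightarrow> p \<notin> iv (p + d) d w"
  by (auto simp: iv_def)

lemma iv_flip: "d \<in> {1, -1} \<Longrightarrow> iv (p + d * (w - 1)) (- d) w = iv p d w"
  by (auto simp: iv_def)

lemma hamp_qp:
  assumes "qvalid w h i j" "dx \<in> {1, -1}" "dy \<in> {1, -1}"
  shows "hamp (iv px dx w \<times> iv py dy h) (px, py) (px + dx * i, py + dy * j) (qp px py dx dy w h i j)"
  using assms
proof (induction px py dx dy w h i j rule: qp.induct)
  case (1 px py dx dy w h i j)
  have wh: "0 < w" "0 < h" using 1 by (auto simp: qvalid_def)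
  have sx: "iv px dx w = insert px (iv (px + dx) dx (w - 1))" "px \<notin> iv (px + dx) dx (w - 1)"
    using iv_split[OF wh(1) 1(6)] iv_notin[OF 1(6)] by blast+
  have sy: "iv py dy h = insert py (iv (py + dy) dy (h - 1))" "py \<notin> iv (py + dy) dy (h - 1)"
    using iv_split[OF wh(2) 1(7)] iv_notin[OF 1(7)] by blast+
  have ux: "iv px dx w \<times> iv py dy h = {px} \<times> iv py dy h \<union> iv (px + dx) dx (w - 1) \<times> iv py dy h"
    by (subst sx(1)) auto
  have uy: "iv px dx w \<times> iv py dy h = iv px dx w \<times> {py} \<union> iv px dx w \<times> iv (py + dy) dy (h - 1)"
    by (subst sy(1)) auto
  note vl = hamp_vline[OF 1(7) wh(2), of px py]
  note hl = hamp_hline[OF 1(6) wh(1), of px py]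
  have dx: "{px} \<times> iv py dy h \<inter> iv (px + dx) dx (w - 1) \<times> iv py dy h = {}" using sx(2) by auto
  have dy: "iv px dx w \<times> {py} \<inter> iv px dx w \<times> iv (py + dy) dy (h - 1) = {}" using sy(2) by auto
  have ax: "sg_adj (px, y) (px + dx, y)" "sg_adj (px, py + dy) (px + dx, py)" for y using 1(6,7) by auto
  have ay: "sg_adj (x, py) (x, py + dy)" "sg_adj (px + dx, py) (px, py + dy)" for x using 1(6,7) by auto
  consider (A) "1 \<le> i \<and> qvalid (w - 1) h (i - 1) (h - 1 - j)"
    | (B) "\<not> (1 \<le> i \<and> qvalid (w - 1) h (i - 1) (h - 1 - j))"
       "1 \<le> j \<and> qvalid w (h - 1) (w - 1 - i) (j - 1)"
    | (C) "\<not> (1 \<le> i \<and> qvalid (w - 1) h (i - 1) (h - 1 - j))"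
       "\<not> (1 \<le> j \<and> qvalid w (h - 1) (w - 1 - i) (j - 1))" by blast
  then show ?case
  proof cases
    case A
    have "hamp (iv (px + dx) dx (w - 1) \<times> iv (py + dy * (h - 1)) (- dy) h)
       (px + dx, py + dy * (h - 1)) (px + dx + dx * (i - 1), py + dy * (h - 1) + - dy * (h - 1 - j))
       (qp (px + dx) (py + dy * (h - 1)) dx (- dy) (w - 1) h (i - 1) (h - 1 - j))"
      using 1 A wh by auto
    moreover have "px + dx + dx * (i - 1) = px + dx * i" by (simp add: algebra_simps)
    moreover have "py + dy * (h - 1) + - dy * (h - 1 - j) = py + dy * j" by (simp add: algebra_simps)
    ultimately have "hamp (iv (px + dx) dx (w - 1) \<times> iv py dy h)
       (px + dx, py + dy * (h - 1)) (px + dx * i, py + dy * j)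
       (qp (px + dx) (py + dy * (h - 1)) dx (- dy) (w - 1) h (i - 1) (h - 1 - j))"
      using iv_flip[OF 1(7)] by (simp only:)
    from hamp_append[OF vl this ax(1) dx ux] show ?thesis
      using A wh by (subst qp.simps) simp
  next
    case B
    have "hamp (iv (px + dx * (w - 1)) (- dx) w \<times> iv (py + dy) dy (h - 1))
       (px + dx * (w - 1), py + dy) (px + dx * (w - 1) + - dx * (w - 1 - i), py + dy + dy * (j - 1))
       (qp (px + dx * (w - 1)) (py + dy) (- dx) dy w (h - 1) (w - 1 - i) (j - 1))"
      using 1 B wh by auto
    moreover have "py + dy + dy * (j - 1) = py + dy * j" by (simp add: algebra_simps)
    moreover have "px + dx * (w - 1) + - dx * (w - 1 - i) = px + dx * i" by (simp add: algebra_simps)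
    ultimately have "hamp (iv px dx w \<times> iv (py + dy) dy (h - 1))
       (px + dx * (w - 1), py + dy) (px + dx * i, py + dy * j)
       (qp (px + dx * (w - 1)) (py + dy) (- dx) dy w (h - 1) (w - 1 - i) (j - 1))"
      using iv_flip[OF 1(6)] by (simp only:)
    from hamp_append[OF hl this ay(1) dy uy] show ?thesis
      using B wh by (subst qp.simps) auto
  next
    case C
    \<comment> \<open>If neither strip leaves a valid rest, the rectangle is a single vertex, or one
      side is 2 and the target is \<open>(1, 1)\<close>, the diagonal neighbour of the corner. Then
      the line is stripped all the same, and the rest is entered by a diagonal step at its other
      corner.\<close>
    consider (a) "w = 1" "h = 1" "i = 0" "j = 0" | (b) "h = 2" "2 \<le> w" "i = 1" "j = 1"
      | (c) "w = 2" "3 \<le> h" "i = 1" "j = 1"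
      using C 1(5) unfolding qvalid_def by smt
    then show ?thesis
    proof cases
      case a
      have "iv px dx w = {px}" using a 1(6) by (auto simp: iv_def)
      with a C vl show ?thesis by (subst qp.simps) (simp add: qp.simps[of _ _ _ _ 0])
    next
      case b
      have "qvalid (w - 1) h (i - 1) j" using b by (auto simp: qvalid_def)
      then have "hamp (iv (px + dx) dx (w - 1) \<times> iv py dy h)
         (px + dx, py) (px + dx + dx * (i - 1), py + dy * j)
         (qp (px + dx) py dx dy (w - 1) h (i - 1) j)"
        using 1 C wh b by auto
      moreover have "px + dx + dx * (i - 1) = px + dx * i" by (simp add: algebra_simps)
      ultimately have "hamp (iv (px + dx) dx (w - 1) \<times> iv py dy h) (px + dx, py) (px + dx * i, py + dy * j)
         (qp (px + dx) py dx dy (w - 1) h (i - 1) j)" by simp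
      from hamp_append[OF vl this _ dx ux] ax(2) show ?thesis
        using C wh b by (subst qp.simps) simp
    next
      case c
      have "qvalid w (h - 1) i (j - 1)" using c by (auto simp: qvalid_def)
      then have "hamp (iv px dx w \<times> iv (py + dy) dy (h - 1))
         (px, py + dy) (px + dx * i, py + dy + dy * (j - 1))
         (qp px (py + dy) dx dy w (h - 1) i (j - 1))"
        using 1 C wh c by auto
      moreover have "py + dy + dy * (j - 1) = py + dy * j" by (simp add: algebra_simps)
      ultimately have "hamp (iv px dx w \<times> iv (py + dy) dy (h - 1)) (px, py + dy) (px + dx * i, py + dy * j)
         (qp px (py + dy) dx dy w (h - 1) i (j - 1))" by simp
      from hamp_append[OF hl this _ dy uy] ay(2) show ?thesis
        using C wh c by (subst qp.simps) simp
    qed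
  qed
qed

section \<open>Coordinate changes, splitting and comparison of computable lists\<close>

lemma test_eq:
  assumes "lin 40 e" "lin 40 f"
  shows "test N (\<lambda>s. e (fst s) = f (fst s))"
proof -
  have "test N (\<lambda>s. \<not> e (fst s) - f (fst s) > 0 \<and> \<not> f (fst s) - e (fst s) > 0)"
    using test_and[OF test_not[OF test_pos[OF lin_minus[OF assms]]]
        test_not[OF test_pos[OF lin_minus[OF assms(2,1)]]]] .
  moreover have "(\<lambda>s :: state. \<not> e (fst s) - f (fst s) > 0 \<and> \<not> f (fst s) - e (fst s) > 0)
     = (\<lambda>s. e (fst s) = f (fst s))" by (auto simp: fun_eq_iff)
  ultimately show ?thesis by simp
qed

lemma scanner_map:
  assumes "lin 8 u" "lin 8 v" "lin 40 (\<lambda>\<sigma>. u \<sigma> + p (\<sigma> 30) (\<sigma> 31))" "lin 40 (\<lambda>\<sigma>. v \<sigma> + q (\<sigma> 30) (\<sigma> 31))"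
  shows "scanner (\<lambda>\<sigma> c x. (c, [(u \<sigma> + p (fst x) (snd x), v \<sigma> + q (fst x) (snd x))]))"
  unfolding scanner_def
proof (intro conjI allI impI)
  show "local (\<lambda>\<sigma> c x. (c, [(u \<sigma> + p (fst x) (snd x), v \<sigma> + q (fst x) (snd x))]))"
    using lin_inputs[OF assms(1)] lin_inputs[OF assms(2)] unfolding local_def by (metis (no_types, lifting))
  fix N d :: nat assume "d < N"
  from rz_push[OF assms(3,4) this, of "\<lambda>s. fst s 32 \<in> {0, 1}"] obtain K where
    K: "rz N (\<lambda>s. fst s 32 \<in> {0, 1}) (\<lambda>s s'. s' = (fst s, (snd s)(d := snd s d @
       [(u (fst s) + p (fst s 30) (fst s 31), v (fst s) + q (fst s 30) (fst s 31))]))) (\<lambda>_. K)"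
    by blast
  show "\<exists>K. rz N (\<lambda>s. fst s 32 \<in> {0, 1}) (\<lambda>s s'. inputs_eq (fst s) (fst s') \<and>
      fst s' 32 = of_bool (fst (fst s 32 = 1,
        [(u (fst s) + p (fst (fst s 30, fst s 31)) (snd (fst s 30, fst s 31)),
          v (fst s) + q (fst (fst s 30, fst s 31)) (snd (fst s 30, fst s 31)))])) \<and>
      snd s' = (snd s)(d := snd s d @ snd (fst s 32 = 1,
        [(u (fst s) + p (fst (fst s 30, fst s 31)) (snd (fst s 30, fst s 31)),
          v (fst s) + q (fst (fst s 30, fst s 31)) (snd (fst s 30, fst s 31)))]))) (\<lambda>_. K)"
    by (rule exI[of _ K], rule rz_conseq[OF K]) auto
qed auto

lemma scan_map: "scan (\<lambda>\<sigma> c x. (c, [g \<sigma> x])) \<sigma> c xs = map (g \<sigma>) xs"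
  by (induction xs arbitrary: c) auto

lemma computable_rev_map:
  assumes "computable f" "lin 8 u" "lin 8 v"
    "lin 40 (\<lambda>\<sigma>. u \<sigma> + p (\<sigma> 30) (\<sigma> 31))" "lin 40 (\<lambda>\<sigma>. v \<sigma> + q (\<sigma> 30) (\<sigma> 31))"
  shows "computable (\<lambda>\<sigma>. map (\<lambda>x. (u \<sigma> + p (fst x) (snd x), v \<sigma> + q (fst x) (snd x))) (rev (f \<sigma>)))"
  using computable_scan[OF assms(1) scanner_map[OF assms(2-5)], of True]
  unfolding scan_map[of "\<lambda>\<sigma> x. (u \<sigma> + p (fst x) (snd x), v \<sigma> + q (fst x) (snd x))"] .

text \<open>The scan that changes no point already reverses the list. Operations that keep the order
  are obtained by reversing first.\<close>

lemma computable_rev: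
  assumes "computable f"
  shows "computable (\<lambda>\<sigma>. rev (f \<sigma>))"
  using computable_rev_map[OF assms, of "\<lambda>_. 0" "\<lambda>_. 0" "\<lambda>x y. x" "\<lambda>x y. y"]
  by (simp add: lin_const lin_var)

lemma computable_map:
  assumes "computable f" "lin 8 u" "lin 8 v"
    "lin 40 (\<lambda>\<sigma>. u \<sigma> + p (\<sigma> 30) (\<sigma> 31))" "lin 40 (\<lambda>\<sigma>. v \<sigma> + q (\<sigma> 30) (\<sigma> 31))"
  shows "computable (\<lambda>\<sigma>. map (\<lambda>x. (u \<sigma> + p (fst x) (snd x), v \<sigma> + q (fst x) (snd x))) (f \<sigma>))"
  using computable_rev_map[OF computable_rev[OF assms(1)] assms(2-5)] by simp

lemma lin_add40: "lin 8 u \<Longrightarrow> v < 40 \<Longrightarrow> lin 40 (\<lambda>\<sigma>. u \<sigma> + \<sigma> v)"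
  by (intro lin_add lin_var) (auto intro: lin_mono)

lemma lin_diff40: "lin 8 u \<Longrightarrow> v < 40 \<Longrightarrow> lin 40 (\<lambda>\<sigma>. u \<sigma> - \<sigma> v)"
  by (intro lin_minus lin_var) (auto intro: lin_mono)

lemma computable_shift:
  assumes "computable f" "lin 8 u" "lin 8 v"
  shows "computable (\<lambda>\<sigma>. map (\<lambda>(x, y). (u \<sigma> + x, v \<sigma> + y)) (f \<sigma>))"
  using computable_map[OF assms, of "\<lambda>x y. x" "\<lambda>x y. y"] assms
  by (simp add: lin_add40 case_prod_unfold)

lemma computable_reflect_x:
  assumes "computable f" "lin 8 u"
  shows "computable (\<lambda>\<sigma>. map (\<lambda>(x, y). (u \<sigma> - x, y)) (f \<sigma>))"
  using computable_map[OF assms(1,2) lin_const[of 8 0], of "\<lambda>x y. - x" "\<lambda>x y. y"] assms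
  by (simp add: lin_diff40 lin_var case_prod_unfold)

lemma computable_reflect_y:
  assumes "computable f" "lin 8 u"
  shows "computable (\<lambda>\<sigma>. map (\<lambda>(x, y). (x, u \<sigma> - y)) (f \<sigma>))"
  using computable_map[OF assms(1) lin_const[of 8 0] assms(2), of "\<lambda>x y. x" "\<lambda>x y. - y"] assms
  by (simp add: lin_diff40 lin_var case_prod_unfold)

lemma computable_swap:
  assumes "computable f"
  shows "computable (\<lambda>\<sigma>. map prod.swap (f \<sigma>))"
  using computable_map[OF assms lin_const[of 8 0] lin_const[of 8 0], of "\<lambda>x y. y" "\<lambda>x y. x"]
  by (simp add: lin_var prod.swap_def[abs_def] case_prod_unfold)

text \<open>If \<open>v\<close> does not occur, \<open>before v\<close> is the whole list and
  \<open>after v\<close> is empty; \<open>ins\<close> relies on the former to find out whether a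
  vertex occurs.\<close>

fun after :: "'a \<Rightarrow> 'a list \<Rightarrow> 'a list" where
  "after v [] = []"
| "after v (x # xs) = (if x = v then xs else after v xs)"

abbreviation before :: "'a \<Rightarrow> 'a list \<Rightarrow> 'a list" where
  "before v xs \<equiv> takeWhile (\<lambda>x. x \<noteq> v) xs"

lemma scan_before:
  "scan (\<lambda>\<sigma> c x. (c \<and> x \<noteq> v \<sigma>, if c \<and> x \<noteq> v \<sigma> then [x] else [])) \<sigma> c xs = (if c then before (v \<sigma>) xs else [])"
  by (induction xs arbitrary: c) auto

lemma scan_after:
  "scan (\<lambda>\<sigma> c x. (c \<or> x = v \<sigma>, if c then [x] else [])) \<sigma> c xs = (if c then xs else after (v \<sigma>) xs)"
  by (induction xs arbitrary: c) auto

lemma scanner_before: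
  assumes "lin 8 a" "lin 8 b"
  shows "scanner (\<lambda>\<sigma> c x. (c \<and> x \<noteq> (a \<sigma>, b \<sigma>), if c \<and> x \<noteq> (a \<sigma>, b \<sigma>) then [x] else []))"
    (is "scanner ?\<phi>")
  unfolding scanner_def
proof (intro conjI allI impI)
  show "local ?\<phi>"
    using lin_inputs[OF assms(1)] lin_inputs[OF assms(2)] unfolding local_def by (metis (no_types, lifting))
  fix N d :: nat assume d: "d < N"
  let ?Q = "\<lambda>s s'. inputs_eq (fst s) (fst s') \<and>
      fst s' 32 = of_bool (fst (?\<phi> (fst s) (fst s 32 = 1) (fst s 30, fst s 31))) \<and>
      snd s' = (snd s)(d := snd s d @ snd (?\<phi> (fst s) (fst s 32 = 1) (fst s 30, fst s 31)))"
  let ?b = "\<lambda>s :: state. fst s 32 = 1 \<and> \<not> (fst s 30 = a (fst s) \<and> fst s 31 = b (fst s))"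
  have l: "lin 40 a" "lin 40 b" using assms by (auto intro: lin_mono)
  have T: "test N ?b"
    using l by (intro test_and test_not test_eq lin_var lin_const) auto
  obtain K1 where K1: "rz N (\<lambda>s. True) (\<lambda>s s'. s' = (fst s, (snd s)(d := snd s d @ [(fst s 30, fst s 31)]))) (\<lambda>_. K1)"
    using rz_push[of "\<lambda>\<sigma>. \<sigma> 30" "\<lambda>\<sigma>. \<sigma> 31" d N "\<lambda>s. True"] d lin_var[of 30 40] lin_var[of 31 40] by auto
  obtain K2 where K2: "rz N (\<lambda>s. True) (\<lambda>s s'. s' = ((fst s)(32 := 0), snd s)) (\<lambda>_. K2)"
    using rz_asg[of "\<lambda>_. 0" 32 N "\<lambda>s. True"] lin_const by auto
  have "\<exists>K. rz N (\<lambda>s. fst s 32 \<in> {0, 1}) ?Q (\<lambda>s. K + (K1 + K2))"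
    by (rule rz_if[OF T]; rule rz_conseq[OF K1] rz_conseq[OF K2]) auto
  then show "\<exists>K. rz N (\<lambda>s. fst s 32 \<in> {0, 1}) ?Q (\<lambda>_. K)" by blast
qed auto

lemma scanner_after:
  assumes "lin 8 a" "lin 8 b"
  shows "scanner (\<lambda>\<sigma> c x. (c \<or> x = (a \<sigma>, b \<sigma>), if c then [x] else []))"
    (is "scanner ?\<phi>")
  unfolding scanner_def
proof (intro conjI allI impI)
  show "local ?\<phi>"
    using lin_inputs[OF assms(1)] lin_inputs[OF assms(2)] unfolding local_def by (metis (no_types, lifting))
  fix N d :: nat assume d: "d < N"
  let ?Q = "\<lambda>s s'. inputs_eq (fst s) (fst s') \<and>
      fst s' 32 = of_bool (fst (?\<phi> (fst s) (fst s 32 = 1) (fst s 30, fst s 31))) \<and>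
      snd s' = (snd s)(d := snd s d @ snd (?\<phi> (fst s) (fst s 32 = 1) (fst s 30, fst s 31)))"
  let ?I = "\<lambda>s :: state. fst s 32 \<in> {0, 1}"
  let ?b = "\<lambda>s :: state. fst s 32 = 1"
  let ?c = "\<lambda>s :: state. fst s 30 = a (fst s) \<and> fst s 31 = b (fst s)"
  have l: "lin 40 a" "lin 40 b" using assms by (auto intro: lin_mono)
  have T: "test N ?b" "test N ?c"
    using l by (intro test_and test_eq lin_var lin_const; simp)+
  obtain K1 where K1: "rz N (\<lambda>s. True) (\<lambda>s s'. s' = (fst s, (snd s)(d := snd s d @ [(fst s 30, fst s 31)]))) (\<lambda>_. K1)"
    using rz_push[of "\<lambda>\<sigma>. \<sigma> 30" "\<lambda>\<sigma>. \<sigma> 31" d N "\<lambda>s. True"] d lin_var[of 30 40] lin_var[of 31 40] by auto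
  obtain K2 where K2: "rz N (\<lambda>s. True) (\<lambda>s s'. s' = ((fst s)(32 := 1), snd s)) (\<lambda>_. K2)"
    using rz_asg[of "\<lambda>_. 1" 32 N "\<lambda>s. True"] lin_const by auto
  have "\<exists>K. rz N (\<lambda>s. ?I s \<and> \<not> ?b s) ?Q (\<lambda>s. K + K2)"
    by (rule rz_if[OF T(2)]; rule rz_conseq[OF K2] rz_conseq[OF rz_skip]) auto
  then obtain K3 where K3: "rz N (\<lambda>s. ?I s \<and> \<not> ?b s) ?Q (\<lambda>s. K3 + K2)" by blast
  have "\<exists>K. rz N ?I ?Q (\<lambda>s. K + (K1 + K2 + K3))"
    by (rule rz_if[OF T(1)]; rule rz_conseq[OF K3] rz_conseq[OF K1]) auto
  then show "\<exists>K. rz N ?I ?Q (\<lambda>_. K)" by blast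
qed auto

lemma computable_before:
  assumes "computable f" "lin 8 a" "lin 8 b"
  shows "computable (\<lambda>\<sigma>. before (a \<sigma>, b \<sigma>) (f \<sigma>))"
  using computable_scan[OF computable_rev[OF assms(1)] scanner_before[OF assms(2,3)], of True]
  unfolding scan_before[of "\<lambda>\<sigma>. (a \<sigma>, b \<sigma>)"] by simp

lemma computable_after:
  assumes "computable f" "lin 8 a" "lin 8 b"
  shows "computable (\<lambda>\<sigma>. after (a \<sigma>, b \<sigma>) (f \<sigma>))"
  using computable_scan[OF computable_rev[OF assms(1)] scanner_after[OF assms(2,3)], of False]
  unfolding scan_after[of "\<lambda>\<sigma>. (a \<sigma>, b \<sigma>)"] by simp

lemma rz_clear:
  assumes "e < N"
  shows "\<exists>K. rz N (\<lambda>s. True) (\<lambda>s s'. inputs_eq (fst s) (fst s') \<and> snd s' = (snd s)(e := []))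
    (\<lambda>s. K * (length (snd s e) + 1))"
proof -
  obtain K1 where K1: "rz N (\<lambda>s. snd s e \<noteq> []) (\<lambda>s s'.
      s' = ((fst s)(30 := fst (last (snd s e)), 31 := snd (last (snd s e))),
      (snd s)(e := butlast (snd s e)))) (\<lambda>_. K1)"
    using rz_pop[of e N 30 31] assms by auto
  show ?thesis
  proof (rule rz_while[OF test_nonempty[OF assms] rz_pre[OF K1]])
    fix s s' :: state
    assume "snd s e \<noteq> []" "s' = ((fst s)(30 := fst (last (snd s e)), 31 := snd (last (snd s e))),
      (snd s)(e := butlast (snd s e)))"
    then show "True \<and> length (snd s' e) < length (snd s e) \<and> length (snd s' e) + 1 \<le> length (snd s e) \<and>
       K1 \<le> K1 * 1 \<and> (0::nat) < 1" by auto
  qed (auto simp: fun_eq_iff)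
qed

text \<open>\<open>f\<close> and \<open>g\<close> are put on the two stacks above \<open>d\<close>
  only to compare the pointers. Both are cleared before the selected branch runs, since it expects
  these stacks to be empty; a list that is compared and then returned is computed twice.\<close>

lemma computes_less:
  assumes f: "computes N e f Kf" "local f" "\<And>\<sigma>. Dom \<sigma> \<Longrightarrow> length (f \<sigma>) \<le> L * area \<sigma>"
    and g: "computes N e' g Kg" "local g" "\<And>\<sigma>. Dom \<sigma> \<Longrightarrow> length (g \<sigma>) \<le> L' * area \<sigma>"
    and h: "computes N d h Kh" "local h" and k: "computes N d k Kk" "local k"
    and e: "e = Suc d" "e' = Suc e" "e' < N"
  shows "\<exists>K. computes N d (\<lambda>\<sigma>. if length (f \<sigma>) < length (g \<sigma>) then h \<sigma> else k \<sigma>) K"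
proof -
  let ?Q1 = "\<lambda>s s' :: state. inputs_eq (fst s) (fst s') \<and> snd s' = (snd s)(e := f (fst s), e' := g (fst s))"
  have A: "rz N (pre N d) ?Q1 (\<lambda>s. (Kf + Kg) * area (fst s))"
  proof (rule rz_seq[OF rz_pre[OF f(1)[unfolded computes_def], of "pre N d"] g(1)[unfolded computes_def]])
    fix s s' :: state
    assume "pre N d s" "inputs_eq (fst s) (fst s') \<and> snd s' = (snd s)(e := snd s e @ f (fst s))"
    then show "pre N e' s' \<and> Kf * area (fst s) + Kg * area (fst s') \<le> (Kf + Kg) * area (fst s)"
      using inputs_eq_Dom inputs_eq_area e by (auto simp: pre_def algebra_simps)
  next
    fix s s' s'' :: state
    assume a: "pre N d s" "inputs_eq (fst s) (fst s') \<and> snd s' = (snd s)(e := snd s e @ f (fst s))"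
      "inputs_eq (fst s') (fst s'') \<and> snd s'' = (snd s')(e' := snd s' e' @ g (fst s'))"
    then have "g (fst s') = g (fst s)" using localD[OF g(2)] inputs_eq_sym by metis
    then show "?Q1 s s''" using a e inputs_eq_trans by (auto simp: pre_def)
  qed (use e in \<open>auto simp: pre_def\<close>)
  define P2 where "P2 = (\<lambda>s :: state. Dom (fst s) \<and> snd s e = f (fst s) \<and> snd s e' = g (fst s) \<and>
     (\<forall>j. d < j \<and> j < N \<longrightarrow> j = e \<or> j = e' \<or> snd s j = []))"
  obtain K1 where K1: "rz N (\<lambda>s. True) (\<lambda>s s'. inputs_eq (fst s) (fst s') \<and> snd s' = (snd s)(e := []))
    (\<lambda>s. K1 * (length (snd s e) + 1))" using rz_clear[of e N] e by auto
  obtain K2 where K2: "rz N (\<lambda>s. True) (\<lambda>s s'. inputs_eq (fst s) (fst s') \<and> snd s' = (snd s)(e' := []))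
    (\<lambda>s. K2 * (length (snd s e') + 1))" using rz_clear[of e' N] e by auto
  let ?K = "K1 * (L + 1) + K2 * (L' + 1)"
  let ?Q2 = "\<lambda>s s' :: state. inputs_eq (fst s) (fst s') \<and> snd s' = (snd s)(e := [], e' := [])"
  have B: "rz N P2 ?Q2 (\<lambda>s. ?K * area (fst s))"
  proof (rule rz_seq[OF rz_pre[OF K1, of P2] K2])
    fix s s' :: state
    assume a: "P2 s" "inputs_eq (fst s) (fst s') \<and> snd s' = (snd s)(e := [])"
    have "length (snd s e) + 1 \<le> (L + 1) * area (fst s)" "length (snd s e') + 1 \<le> (L' + 1) * area (fst s)"
      using a f(3)[of "fst s"] g(3)[of "fst s"] area_pos[of "fst s"] unfolding P2_def by simp_all
    then have "K1 * (length (snd s e) + 1) \<le> K1 * ((L + 1) * area (fst s))"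
      "K2 * (length (snd s e') + 1) \<le> K2 * ((L' + 1) * area (fst s))" by (simp_all only: mult_le_mono2)
    then show "True \<and> K1 * (length (snd s e) + 1) + K2 * (length (snd s' e') + 1) \<le> ?K * area (fst s)"
      using a e by (simp add: algebra_simps)
  next
    fix s s' s'' :: state
    assume "P2 s" "inputs_eq (fst s) (fst s') \<and> snd s' = (snd s)(e := [])"
      "inputs_eq (fst s') (fst s'') \<and> snd s'' = (snd s')(e' := [])"
    then show "?Q2 s s''" using e inputs_eq_trans by auto
  qed auto
  have C: "rz N P2 (\<lambda>s s'. inputs_eq (fst s) (fst s') \<and> snd s' = (snd s)(e := [], e' := [], d := snd s d @ r (fst s)))
      (\<lambda>s. (?K + Kr) * area (fst s))" if r: "computes N d r Kr" "local r" for r Kr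
  proof (rule rz_seq[OF B r(1)[unfolded computes_def]])
    fix s s' :: state assume "P2 s" "?Q2 s s'"
    then show "pre N d s' \<and> ?K * area (fst s) + Kr * area (fst s') \<le> (?K + Kr) * area (fst s)"
      using inputs_eq_Dom inputs_eq_area by (auto simp: P2_def pre_def algebra_simps)
  next
    fix s s' s'' :: state
    assume a: "P2 s" "?Q2 s s'"
      "inputs_eq (fst s') (fst s'') \<and> snd s'' = (snd s')(d := snd s' d @ r (fst s'))"
    then have "r (fst s') = r (fst s)" using localD[OF r(2)] inputs_eq_sym by metis
    then show "inputs_eq (fst s) (fst s'') \<and> snd s'' = (snd s)(e := [], e' := [], d := snd s d @ r (fst s))"
      using a e inputs_eq_trans by auto
  qed
  let ?Q3 = "\<lambda>s s' :: state. inputs_eq (fst s) (fst s') \<and> snd s' = (snd s)(e := [], e' := [],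
      d := snd s d @ (if length (f (fst s)) < length (g (fst s)) then h (fst s) else k (fst s)))"
  have T: "test N (\<lambda>s. length (snd s e') > length (snd s e) + 0)" using e by (intro test_longer) auto
  have "\<exists>K. rz N P2 ?Q3 (\<lambda>s. K + (?K + Kh + Kk) * area (fst s))"
    by (rule rz_if[OF T]; rule rz_conseq[OF C[OF h]] rz_conseq[OF C[OF k]]) (auto simp: P2_def algebra_simps)
  then obtain K3 where K3: "rz N P2 ?Q3 (\<lambda>s. K3 + (?K + Kh + Kk) * area (fst s))" by blast
  have "rz N (pre N d) (\<lambda>s s'. inputs_eq (fst s) (fst s') \<and> snd s' = (snd s)(
      d := snd s d @ (if length (f (fst s)) < length (g (fst s)) then h (fst s) else k (fst s))))
    (\<lambda>s. (Kf + Kg + K3 + ?K + Kh + Kk) * area (fst s))"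
  proof (rule rz_seq[OF A K3])
    fix s s' :: state assume a: "pre N d s" "?Q1 s s'"
    have "P2 s'" using a e localD[OF f(2), of "fst s" "fst s'"] localD[OF g(2), of "fst s" "fst s'"]
      inputs_eq_Dom[of "fst s" "fst s'"] by (auto simp: P2_def pre_def)
    moreover have "area (fst s') = area (fst s)" "1 \<le> area (fst s)"
      using a inputs_eq_area area_pos by (auto simp: pre_def)
    ultimately show "P2 s' \<and> (Kf + Kg) * area (fst s) + (K3 + (?K + Kh + Kk) * area (fst s'))
       \<le> (Kf + Kg + K3 + ?K + Kh + Kk) * area (fst s)" by (simp add: algebra_simps)
  next
    fix s s' s'' :: state assume a: "pre N d s" "?Q1 s s'" "?Q3 s' s''"
    have "f (fst s') = f (fst s)" "g (fst s') = g (fst s)" "h (fst s') = h (fst s)" "k (fst s') = k (fst s)"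
      using a localD[OF f(2), of "fst s" "fst s'"] localD[OF g(2), of "fst s" "fst s'"]
        localD[OF h(2), of "fst s" "fst s'"] localD[OF k(2), of "fst s" "fst s'"] by auto
    moreover have "snd s e = []" "snd s e' = []" using a e by (auto simp: pre_def)
    ultimately show "inputs_eq (fst s) (fst s'') \<and> snd s'' = (snd s)(
      d := snd s d @ (if length (f (fst s)) < length (g (fst s)) then h (fst s) else k (fst s)))"
      using a e inputs_eq_trans by (auto simp: fun_eq_iff)
  qed
  then show ?thesis unfolding computes_def by blast
qed

lemma computable_less:
  assumes "computable f" "computable g" "computable h" "computable k"
  shows "computable (\<lambda>\<sigma>. if length (f \<sigma>) < length (g \<sigma>) then h \<sigma> else k \<sigma>)"
proof -
  obtain L D where f: "local f" "\<And>\<sigma>. Dom \<sigma> \<Longrightarrow> length (f \<sigma>) \<le> L * area \<sigma>"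
    "\<And>N d. d + D < N \<Longrightarrow> \<exists>K. computes N d f K" using assms(1) unfolding computable_def by blast
  obtain L' D' where g: "local g" "\<And>\<sigma>. Dom \<sigma> \<Longrightarrow> length (g \<sigma>) \<le> L' * area \<sigma>"
    "\<And>N d. d + D' < N \<Longrightarrow> \<exists>K. computes N d g K" using assms(2) unfolding computable_def by blast
  obtain L1 D1 where h: "local h" "\<And>\<sigma>. Dom \<sigma> \<Longrightarrow> length (h \<sigma>) \<le> L1 * area \<sigma>"
    "\<And>N d. d + D1 < N \<Longrightarrow> \<exists>K. computes N d h K" using assms(3) unfolding computable_def by blast
  obtain L2 D2 where k: "local k" "\<And>\<sigma>. Dom \<sigma> \<Longrightarrow> length (k \<sigma>) \<le> L2 * area \<sigma>"
    "\<And>N d. d + D2 < N \<Longrightarrow> \<exists>K. computes N d k K" using assms(4) unfolding computable_def by blast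
  show ?thesis
  proof (rule computableI[where L = "L1 + L2" and D = "D + D' + D1 + D2 + 2"])
    show "local (\<lambda>\<sigma>. if length (f \<sigma>) < length (g \<sigma>) then h \<sigma> else k \<sigma>)"
      unfolding local_def using localD[OF f(1)] localD[OF g(1)] localD[OF h(1)] localD[OF k(1)] by metis
    show "length (if length (f \<sigma>) < length (g \<sigma>) then h \<sigma> else k \<sigma>) \<le> (L1 + L2) * area \<sigma>"
      if "Dom \<sigma>" for \<sigma> using h(2)[OF that] k(2)[OF that] by (simp add: algebra_simps)
    fix N d assume d: "d + (D + D' + D1 + D2 + 2) < N"
    obtain Kf where "computes N (Suc d) f Kf" using f(3)[of "Suc d" N] d by auto
    moreover obtain Kg where "computes N (Suc (Suc d)) g Kg" using g(3)[of "Suc (Suc d)" N] d by auto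
    moreover obtain Kh where "computes N d h Kh" using h(3)[of d N] d by auto
    moreover obtain Kk where "computes N d k Kk" using k(3)[of d N] d by auto
    ultimately show "\<exists>K. computes N d (\<lambda>\<sigma>. if length (f \<sigma>) < length (g \<sigma>) then h \<sigma> else k \<sigma>) K"
      using computes_less[OF _ f(1,2) _ g(1,2) _ h(1) _ k(1) refl refl] d by simp
  qed
qed

lemma computable_nonempty:
  assumes "computable f" "computable h" "computable k"
  shows "computable (\<lambda>\<sigma>. if f \<sigma> \<noteq> [] then h \<sigma> else k \<sigma>)"
  using computable_less[OF computable_Nil assms] by simp

subsection \<open>Paths from a corner\<close>

lemma rz_asgs:
  assumes "\<forall>(v, e) \<in> set as. v < 40 \<and> lin 40 e"
  shows "\<exists>K. rz N P (\<lambda>s s'. s' = (fold (\<lambda>(v, e) \<sigma>. \<sigma>(v := e \<sigma>)) as (fst s), snd s)) (\<lambda>_. K)"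
  using assms
proof (induction as arbitrary: P)
  case Nil
  show ?case by (rule exI[of _ 0], rule rz_conseq[OF rz_skip]) auto
next
  case (Cons a as)
  obtain v e where a: "a = (v, e)" by force
  obtain K1 where K1: "rz N P (\<lambda>s s'. s' = ((fst s)(v := e (fst s)), snd s)) (\<lambda>_. K1)"
    using rz_asg[of e v N P] Cons.prems a by auto
  obtain K2 where K2: "rz N (\<lambda>_. True)
      (\<lambda>s s'. s' = (fold (\<lambda>(v, e) \<sigma>. \<sigma>(v := e \<sigma>)) as (fst s), snd s)) (\<lambda>_. K2)"
  proof -
    have "\<forall>(v, e) \<in> set as. v < 40 \<and> lin 40 e" using Cons.prems by simp
    from Cons.IH[OF this, of "\<lambda>_. True"] that show ?thesis by blast
  qed
  show ?case
    by (rule exI[of _ "K1 + K2"], rule rz_seq[OF K1 K2]) (simp_all add: a del: fun_upd_apply)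
qed

text \<open>Variables 16 and 17 hold the current point, 18 and 19 the direction, 20 the number of
  points left. On exit, 16 and 17 are one step past the last point, which is exploited in
  \<open>rz_qp\<close>.\<close>

lemma rz_line:
  assumes "d < N"
  shows "\<exists>K. rz N (\<lambda>s. 0 \<le> fst s 20) (\<lambda>s s'. s' = ((fst s)(
      16 := fst s 16 + fst s 18 * fst s 20, 17 := fst s 17 + fst s 19 * fst s 20, 20 := 0),
     (snd s)(d := snd s d @ line (fst s 16) (fst s 17) (fst s 18) (fst s 19) (fst s 20))))
    (\<lambda>s. K * (nat (fst s 20) + 1))"
proof -
  obtain K1 where K1: "rz N (\<lambda>s. 0 \<le> fst s 20 \<and> 0 < fst s 20)
     (\<lambda>s s'. s' = (fst s, (snd s)(d := snd s d @ [(fst s 16, fst s 17)]))) (\<lambda>_. K1)"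
    using rz_push[of "\<lambda>\<sigma>. \<sigma> 16" "\<lambda>\<sigma>. \<sigma> 17" d N] assms lin_var[of 16 40] lin_var[of 17 40] by auto
  let ?as = "[(16, \<lambda>\<sigma>. \<sigma> 16 + \<sigma> 18), (17, \<lambda>\<sigma>. \<sigma> 17 + \<sigma> 19), (20, \<lambda>\<sigma>. \<sigma> 20 - 1)]
     :: (nat \<times> ((nat \<Rightarrow> int) \<Rightarrow> int)) list"
  have l: "\<forall>(v, e) \<in> set ?as. v < 40 \<and> lin 40 e"
    by (auto intro!: lin_add lin_minus lin_var lin_const)
  obtain K2 where K2: "rz N (\<lambda>_. True) (\<lambda>s s'. s' = (fold (\<lambda>(v, e) \<sigma>. \<sigma>(v := e \<sigma>)) ?as (fst s), snd s)) (\<lambda>_. K2)"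
    using rz_asgs[OF l, of N "\<lambda>_. True"] by blast
  let ?Q = "\<lambda>s s' :: state. s' = ((fst s)(16 := fst s 16 + fst s 18, 17 := fst s 17 + fst s 19,
     20 := fst s 20 - 1), (snd s)(d := snd s d @ [(fst s 16, fst s 17)]))"
  have body: "rz N (\<lambda>s. 0 \<le> fst s 20 \<and> 0 < fst s 20) ?Q (\<lambda>_. K1 + K2)"
    by (rule rz_seq[OF K1 K2]) (auto simp: fun_eq_iff)
  have T: "test N (\<lambda>s. 0 < fst s 20)" using test_pos[OF lin_var[of 20 40]] by simp
  show ?thesis
  proof (rule rz_while[OF T body])
    fix s s' :: state assume "0 \<le> fst s 20" "0 < fst s 20" "?Q s s'"
    then show "0 \<le> fst s' 20 \<and> nat (fst s' 20) < nat (fst s 20) \<and> nat (fst s' 20) + 1 \<le> nat (fst s 20)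
       \<and> K1 + K2 \<le> (K1 + K2) * 1 \<and> (0::nat) < 1" by auto
  next
    fix s :: state assume "0 \<le> fst s 20" "\<not> 0 < fst s 20"
    then have "fst s 20 = 0" by simp
    then show "s = ((fst s)(
      16 := fst s 16 + fst s 18 * fst s 20, 17 := fst s 17 + fst s 19 * fst s 20, 20 := 0),
     (snd s)(d := snd s d @ line (fst s 16) (fst s 17) (fst s 18) (fst s 19) (fst s 20)))"
      by (cases s) (auto simp: line_0 fun_eq_iff)
  next
    fix s s' s'' :: state assume a: "0 < fst s 20" "?Q s s'" and b: "s'' = ((fst s')(
      16 := fst s' 16 + fst s' 18 * fst s' 20, 17 := fst s' 17 + fst s' 19 * fst s' 20, 20 := 0),
     (snd s')(d := snd s' d @ line (fst s' 16) (fst s' 17) (fst s' 18) (fst s' 19) (fst s' 20)))"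
    show "s'' = ((fst s)(
      16 := fst s 16 + fst s 18 * fst s 20, 17 := fst s 17 + fst s 19 * fst s 20, 20 := 0),
     (snd s)(d := snd s d @ line (fst s 16) (fst s 17) (fst s 18) (fst s 19) (fst s 20)))"
      unfolding b line_Suc[OF a(1)] using a by (auto simp: fun_eq_iff algebra_simps)
  qed
qed

text \<open>The line is drawn with the copies in 16 to 20, so that the arguments of
  \<open>qp\<close> in 8 to 15 are intact when \<open>U\<close> updates them for the next round. As
  the line is nonempty, its length absorbs all constant costs.\<close>

lemma rz_strip:
  assumes d: "d < N" and U: "\<forall>(v, e) \<in> set U. v < 40 \<and> lin 40 e"
    and e: "lin 40 ex" "lin 40 ey" "lin 40 en"
    and r: "\<And>\<sigma> v x. v \<in> {16, 17, 18, 19, 20} \<Longrightarrow> ex (\<sigma>(v := x)) = ex \<sigma> \<and> ey (\<sigma>(v := x)) = ey \<sigma> \<and> en (\<sigma>(v := x)) = en \<sigma>"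
  shows "\<exists>K. rz N (\<lambda>s. 0 < en (fst s)) (\<lambda>s s'. s' = (fold (\<lambda>(v, e) \<sigma>. \<sigma>(v := e \<sigma>)) U ((fst s)(
        16 := fst s 8 + ex (fst s) * en (fst s), 17 := fst s 9 + ey (fst s) * en (fst s),
        18 := ex (fst s), 19 := ey (fst s), 20 := 0)),
      (snd s)(d := snd s d @ line (fst s 8) (fst s 9) (ex (fst s)) (ey (fst s)) (en (fst s)))))
    (\<lambda>s. K * nat (en (fst s)))"
proof -
  let ?as = "[(16, \<lambda>\<sigma>. \<sigma> 8), (17, \<lambda>\<sigma>. \<sigma> 9), (18, ex), (19, ey), (20, en)]
     :: (nat \<times> ((nat \<Rightarrow> int) \<Rightarrow> int)) list"
  have l: "\<forall>(v, e) \<in> set ?as. v < 40 \<and> lin 40 e"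
    using e by (auto intro!: lin_var)
  obtain K1 where K1: "rz N (\<lambda>s. 0 < en (fst s))
      (\<lambda>s s'. s' = (fold (\<lambda>(v, e) \<sigma>. \<sigma>(v := e \<sigma>)) ?as (fst s), snd s)) (\<lambda>_. K1)"
    using rz_asgs[OF l, of N "\<lambda>s. 0 < en (fst s)"] by blast
  obtain K2 where K2: "rz N (\<lambda>s. 0 \<le> fst s 20) (\<lambda>s s'. s' = ((fst s)(
      16 := fst s 16 + fst s 18 * fst s 20, 17 := fst s 17 + fst s 19 * fst s 20, 20 := 0),
     (snd s)(d := snd s d @ line (fst s 16) (fst s 17) (fst s 18) (fst s 19) (fst s 20))))
    (\<lambda>s. K2 * (nat (fst s 20) + 1))" using rz_line[OF d] by blast
  obtain K3 where K3: "rz N (\<lambda>_. True)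
      (\<lambda>s s'. s' = (fold (\<lambda>(v, e) \<sigma>. \<sigma>(v := e \<sigma>)) U (fst s), snd s)) (\<lambda>_. K3)"
    using rz_asgs[OF U, of N "\<lambda>_. True"] by blast
  have A: "rz N (\<lambda>s. 0 < en (fst s)) (\<lambda>s s'. s' = ((fst s)(
        16 := fst s 8 + ex (fst s) * en (fst s), 17 := fst s 9 + ey (fst s) * en (fst s),
        18 := ex (fst s), 19 := ey (fst s), 20 := 0),
      (snd s)(d := snd s d @ line (fst s 8) (fst s 9) (ex (fst s)) (ey (fst s)) (en (fst s)))))
     (\<lambda>s. (K1 + 2 * K2) * nat (en (fst s)))"
  proof (rule rz_seq[OF K1 K2])
    fix s s' :: state assume a: "0 < en (fst s)" "s' = (fold (\<lambda>(v, e) \<sigma>. \<sigma>(v := e \<sigma>)) ?as (fst s), snd s)"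
    then have n: "fst s' 20 = en (fst s)" by (simp add: r)
    have "K1 * 1 \<le> K1 * nat (en (fst s))" "K2 * (nat (en (fst s)) + 1) \<le> K2 * (2 * nat (en (fst s)))"
      using a(1) by (intro mult_le_mono2; simp)+
    then have "K1 + K2 * (nat (en (fst s)) + 1) \<le> (K1 + 2 * K2) * nat (en (fst s))"
      unfolding add_mult_distrib by linarith
    then show "0 \<le> fst s' 20 \<and> K1 + K2 * (nat (fst s' 20) + 1) \<le> (K1 + 2 * K2) * nat (en (fst s))"
      using a(1) unfolding n by linarith
  qed (auto simp: r fun_eq_iff)
  show ?thesis
  proof (rule exI[of _ "K1 + 2 * K2 + K3"], rule rz_seq[OF A K3])
    fix s s' :: state assume "0 < en (fst s)"
    then have "K3 * 1 \<le> K3 * nat (en (fst s))" by (intro mult_le_mono2) simp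
    then show "True \<and> (K1 + 2 * K2) * nat (en (fst s)) + K3 \<le> (K1 + 2 * K2 + K3) * nat (en (fst s))"
      unfolding add_mult_distrib by simp
  qed auto
qed

lemma lin_uminus: "lin k e \<Longrightarrow> lin k (\<lambda>\<sigma>. - e \<sigma>)"
  using lin_minus[OF lin_const[of k 0]] by simp

lemma test_less:
  assumes "lin 40 e" "lin 40 f"
  shows "test N (\<lambda>s. e (fst s) < f (fst s))"
  using test_pos[OF lin_minus[OF assms(2,1)]] by simp

lemma test_le:
  assumes "lin 40 e" "lin 40 f"
  shows "test N (\<lambda>s. e (fst s) \<le> f (fst s))"
  using test_not[OF test_less[OF assms(2,1)]] by (simp add: not_less)

lemma test_or:
  assumes "test N b" "test N c"
  shows "test N (\<lambda>s. b s \<or> c s)"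
  using test_not[OF test_and[OF test_not test_not], OF assms] by simp

lemma test_qvalid:
  assumes "lin 40 w" "lin 40 h" "lin 40 i" "lin 40 j"
  shows "test N (\<lambda>s. qvalid (w (fst s)) (h (fst s)) (i (fst s)) (j (fst s)))"
  unfolding qvalid_def
  by (intro test_and test_or test_not test_eq test_less test_le assms lin_minus lin_const)

definition qv :: "(nat \<Rightarrow> int) \<Rightarrow> (int \<times> int) list" where
  "qv \<sigma> = qp (\<sigma> 8) (\<sigma> 9) (\<sigma> 10) (\<sigma> 11) (\<sigma> 12) (\<sigma> 13) (\<sigma> 14) (\<sigma> 15)"

text \<open>In each branch of \<open>qp\<close> the recursive call comes last, so a loop appending
  the stripped lines computes it. The potential is the area of the remaining rectangle, and the work
  of a round is the length of the line stripped from it.\<close>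

lemma rz_qp:
  assumes d: "d < N"
  shows "\<exists>K. rz N (\<lambda>s. True) (\<lambda>s s'. inputs_eq (fst s) (fst s') \<and> snd s' = (snd s)(d := snd s d @ qv (fst s)))
    (\<lambda>s. K * (nat (fst s 12) * nat (fst s 13) + 1))"
proof -
  let ?b = "\<lambda>s :: state. 0 < fst s 12 \<and> 0 < fst s 13"
  let ?A = "\<lambda>s :: state. 1 \<le> fst s 14 \<and> qvalid (fst s 12 - 1) (fst s 13) (fst s 14 - 1) (fst s 13 - 1 - fst s 15)"
  let ?B = "\<lambda>s :: state. 1 \<le> fst s 15 \<and> qvalid (fst s 12) (fst s 13 - 1) (fst s 12 - 1 - fst s 14) (fst s 15 - 1)"
  let ?C = "\<lambda>s :: state. fst s 13 \<le> 2"
  let ?W = "\<lambda>s :: state. nat (fst s 12) * nat (fst s 13)"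
  let ?l = "\<lambda>s :: state. if ?A s then nat (fst s 13) else if ?B s then nat (fst s 12)
     else if ?C s then nat (fst s 13) else nat (fst s 12)"
  define Q where "Q = (\<lambda>s s' :: state. inputs_eq (fst s) (fst s') \<and> nat (fst s' 12) + nat (fst s' 13) < nat (fst s 12) + nat (fst s 13) \<and>
     ?W s' + ?l s \<le> ?W s \<and> (\<exists>xs. snd s' = (snd s)(d := snd s d @ xs) \<and> qv (fst s) = xs @ qv (fst s')))"
  have lv: "lin 40 (\<lambda>\<sigma>. \<sigma> 8)" "lin 40 (\<lambda>\<sigma>. \<sigma> 9)" "lin 40 (\<lambda>\<sigma>. \<sigma> 10)" "lin 40 (\<lambda>\<sigma>. \<sigma> 11)" "lin 40 (\<lambda>\<sigma>. \<sigma> 12)"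
    "lin 40 (\<lambda>\<sigma>. \<sigma> 13)" "lin 40 (\<lambda>\<sigma>. \<sigma> 14)" "lin 40 (\<lambda>\<sigma>. \<sigma> 15)" "lin 40 (\<lambda>\<sigma>. \<sigma> 16)" "lin 40 (\<lambda>\<sigma>. \<sigma> 17)"
    "lin 40 (\<lambda>\<sigma>. c)" for c by (simp_all add: lin_var lin_const)
  have TA: "test N ?A" and TB: "test N ?B" and TC: "test N ?C" and Tb: "test N ?b"
    by (intro test_and test_qvalid test_le test_less lin_minus lv)+
  have area: "nat (w - 1) * nat h + nat h \<le> nat w * nat h" "nat w * nat (h - 1) + nat w \<le> nat w * nat h"
    if "0 < w" "0 < h" for w h
  proof -
    have "nat w = Suc (nat (w - 1))" "nat h = Suc (nat (h - 1))" using that by auto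
    then show "nat (w - 1) * nat h + nat h \<le> nat w * nat h" "nat w * nat (h - 1) + nat w \<le> nat w * nat h"
      by (metis add.commute mult_Suc order_refl, metis add.commute mult_Suc_right order_refl)
  qed
  \<comment> \<open>The assignments are executed in this order, after the line has moved 16 and 17
    one step too far. Hence \<open>\<sigma> 17 - \<sigma> 11\<close> is
    \<open>py + dy * (h - 1)\<close>, obtained without a multiplication, and 11 is negated only
    afterwards. In the second list \<open>\<sigma> 16 - \<sigma> 10\<close> plays the same
    role.\<close>
  let ?UA = "[(8, \<lambda>\<sigma>. \<sigma> 8 + \<sigma> 10), (9, \<lambda>\<sigma>. \<sigma> 17 - \<sigma> 11), (11, \<lambda>\<sigma>. 0 - \<sigma> 11), (12, \<lambda>\<sigma>. \<sigma> 12 - 1),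
     (14, \<lambda>\<sigma>. \<sigma> 14 - 1), (15, \<lambda>\<sigma>. \<sigma> 13 - 1 - \<sigma> 15)] :: (nat \<times> ((nat \<Rightarrow> int) \<Rightarrow> int)) list"
  let ?UB = "[(8, \<lambda>\<sigma>. \<sigma> 16 - \<sigma> 10), (9, \<lambda>\<sigma>. \<sigma> 9 + \<sigma> 11), (10, \<lambda>\<sigma>. 0 - \<sigma> 10), (13, \<lambda>\<sigma>. \<sigma> 13 - 1),
     (14, \<lambda>\<sigma>. \<sigma> 12 - 1 - \<sigma> 14), (15, \<lambda>\<sigma>. \<sigma> 15 - 1)] :: (nat \<times> ((nat \<Rightarrow> int) \<Rightarrow> int)) list"
  let ?UC = "[(8, \<lambda>\<sigma>. \<sigma> 8 + \<sigma> 10), (12, \<lambda>\<sigma>. \<sigma> 12 - 1), (14, \<lambda>\<sigma>. \<sigma> 14 - 1)]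
     :: (nat \<times> ((nat \<Rightarrow> int) \<Rightarrow> int)) list"
  let ?UD = "[(9, \<lambda>\<sigma>. \<sigma> 9 + \<sigma> 11), (13, \<lambda>\<sigma>. \<sigma> 13 - 1), (15, \<lambda>\<sigma>. \<sigma> 15 - 1)]
     :: (nat \<times> ((nat \<Rightarrow> int) \<Rightarrow> int)) list"
  have U: "\<forall>(v, e) \<in> set ?UA. v < 40 \<and> lin 40 e" "\<forall>(v, e) \<in> set ?UB. v < 40 \<and> lin 40 e"
    "\<forall>(v, e) \<in> set ?UC. v < 40 \<and> lin 40 e" "\<forall>(v, e) \<in> set ?UD. v < 40 \<and> lin 40 e"
    by (auto intro!: lin_add lin_minus lin_uminus lv)
  have V: "\<exists>K. rz N (\<lambda>s. 0 < fst s 13) (\<lambda>s s'. s' = (fold (\<lambda>(v, e) \<sigma>. \<sigma>(v := e \<sigma>)) U ((fst s)(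
        16 := fst s 8 + 0 * fst s 13, 17 := fst s 9 + fst s 11 * fst s 13,
        18 := 0, 19 := fst s 11, 20 := 0)),
      (snd s)(d := snd s d @ line (fst s 8) (fst s 9) 0 (fst s 11) (fst s 13))))
    (\<lambda>s. K * nat (fst s 13))" if "\<forall>(v, e) \<in> set U. v < 40 \<and> lin 40 e" for U
    by (rule rz_strip[OF d that]) (auto intro: lv)
  have H: "\<exists>K. rz N (\<lambda>s. 0 < fst s 12) (\<lambda>s s'. s' = (fold (\<lambda>(v, e) \<sigma>. \<sigma>(v := e \<sigma>)) U ((fst s)(
        16 := fst s 8 + fst s 10 * fst s 12, 17 := fst s 9 + 0 * fst s 12,
        18 := fst s 10, 19 := 0, 20 := 0)),
      (snd s)(d := snd s d @ line (fst s 8) (fst s 9) (fst s 10) 0 (fst s 12))))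
    (\<lambda>s. K * nat (fst s 12))" if "\<forall>(v, e) \<in> set U. v < 40 \<and> lin 40 e" for U
    by (rule rz_strip[OF d that]) (auto intro: lv)
  obtain KA where KA: "rz N (\<lambda>s. ?b s \<and> ?A s) Q (\<lambda>s. KA * ?l s)"
  proof -
    from V[OF U(1)] obtain K where K: "rz N (\<lambda>s. 0 < fst s 13) (\<lambda>s s'. s' = (fold (\<lambda>(v, e) \<sigma>. \<sigma>(v := e \<sigma>)) ?UA ((fst s)(
        16 := fst s 8 + 0 * fst s 13, 17 := fst s 9 + fst s 11 * fst s 13,
        18 := 0, 19 := fst s 11, 20 := 0)),
      (snd s)(d := snd s d @ line (fst s 8) (fst s 9) 0 (fst s 11) (fst s 13))))
    (\<lambda>s. K * nat (fst s 13))" by blast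
    have "rz N (\<lambda>s. ?b s \<and> ?A s) Q (\<lambda>s. K * ?l s)"
    proof (rule rz_conseq[OF K])
      fix s s' :: state assume s: "?b s \<and> ?A s" and s': "s' = (fold (\<lambda>(v, e) \<sigma>. \<sigma>(v := e \<sigma>)) ?UA ((fst s)(
        16 := fst s 8 + 0 * fst s 13, 17 := fst s 9 + fst s 11 * fst s 13,
        18 := 0, 19 := fst s 11, 20 := 0)),
        (snd s)(d := snd s d @ line (fst s 8) (fst s 9) 0 (fst s 11) (fst s 13)))"
      have "qv (fst s) = line (fst s 8) (fst s 9) 0 (fst s 11) (fst s 13) @ qv (fst s')"
        using s unfolding s' qv_def by (subst qp.simps) (simp add: algebra_simps)
      then show "Q s s'" using s area(1)[of "fst s 12" "fst s 13"] unfolding Q_def by (auto simp: s')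
    qed auto
    then show ?thesis using that by blast
  qed
  obtain KB where KB: "rz N (\<lambda>s. (?b s \<and> \<not> ?A s) \<and> ?B s) Q (\<lambda>s. KB * ?l s)"
  proof -
    from H[OF U(2)] obtain K where K: "rz N (\<lambda>s. 0 < fst s 12) (\<lambda>s s'. s' = (fold (\<lambda>(v, e) \<sigma>. \<sigma>(v := e \<sigma>)) ?UB ((fst s)(
        16 := fst s 8 + fst s 10 * fst s 12, 17 := fst s 9 + 0 * fst s 12,
        18 := fst s 10, 19 := 0, 20 := 0)),
      (snd s)(d := snd s d @ line (fst s 8) (fst s 9) (fst s 10) 0 (fst s 12))))
    (\<lambda>s. K * nat (fst s 12))" by blast
    have "rz N (\<lambda>s. (?b s \<and> \<not> ?A s) \<and> ?B s) Q (\<lambda>s. K * ?l s)"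
    proof (rule rz_conseq[OF K])
      fix s s' :: state assume s: "(?b s \<and> \<not> ?A s) \<and> ?B s" and s': "s' = (fold (\<lambda>(v, e) \<sigma>. \<sigma>(v := e \<sigma>)) ?UB ((fst s)(
        16 := fst s 8 + fst s 10 * fst s 12, 17 := fst s 9 + 0 * fst s 12,
        18 := fst s 10, 19 := 0, 20 := 0)),
      (snd s)(d := snd s d @ line (fst s 8) (fst s 9) (fst s 10) 0 (fst s 12)))"
      have "qv (fst s) = line (fst s 8) (fst s 9) (fst s 10) 0 (fst s 12) @ qv (fst s')"
        using s unfolding s' qv_def by (subst qp.simps) (auto simp: algebra_simps)
      then show "Q s s'" using s area(2)[of "fst s 12" "fst s 13"] unfolding Q_def by (auto simp: s')
    qed auto
    then show ?thesis using that by blast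
  qed
  obtain KC where KC: "rz N (\<lambda>s. ((?b s \<and> \<not> ?A s) \<and> \<not> ?B s) \<and> ?C s) Q (\<lambda>s. KC * ?l s)"
  proof -
    from V[OF U(3)] obtain K where K: "rz N (\<lambda>s. 0 < fst s 13) (\<lambda>s s'. s' = (fold (\<lambda>(v, e) \<sigma>. \<sigma>(v := e \<sigma>)) ?UC ((fst s)(
        16 := fst s 8 + 0 * fst s 13, 17 := fst s 9 + fst s 11 * fst s 13,
        18 := 0, 19 := fst s 11, 20 := 0)),
      (snd s)(d := snd s d @ line (fst s 8) (fst s 9) 0 (fst s 11) (fst s 13))))
    (\<lambda>s. K * nat (fst s 13))" by blast
    have "rz N (\<lambda>s. ((?b s \<and> \<not> ?A s) \<and> \<not> ?B s) \<and> ?C s) Q (\<lambda>s. K * ?l s)"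
    proof (rule rz_conseq[OF K])
      fix s s' :: state assume s: "((?b s \<and> \<not> ?A s) \<and> \<not> ?B s) \<and> ?C s" and s': "s' = (fold (\<lambda>(v, e) \<sigma>. \<sigma>(v := e \<sigma>)) ?UC ((fst s)(
        16 := fst s 8 + 0 * fst s 13, 17 := fst s 9 + fst s 11 * fst s 13,
        18 := 0, 19 := fst s 11, 20 := 0)),
        (snd s)(d := snd s d @ line (fst s 8) (fst s 9) 0 (fst s 11) (fst s 13)))"
      have "qv (fst s) = line (fst s 8) (fst s 9) 0 (fst s 11) (fst s 13) @ qv (fst s')"
        using s unfolding s' qv_def by (subst qp.simps) auto
      then show "Q s s'" using s area(1)[of "fst s 12" "fst s 13"] unfolding Q_def by (auto simp: s')
    qed auto
    then show ?thesis using that by blast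
  qed
  obtain KD where KD: "rz N (\<lambda>s. ((?b s \<and> \<not> ?A s) \<and> \<not> ?B s) \<and> \<not> ?C s) Q (\<lambda>s. KD * ?l s)"
  proof -
    from H[OF U(4)] obtain K where K: "rz N (\<lambda>s. 0 < fst s 12) (\<lambda>s s'. s' = (fold (\<lambda>(v, e) \<sigma>. \<sigma>(v := e \<sigma>)) ?UD ((fst s)(
        16 := fst s 8 + fst s 10 * fst s 12, 17 := fst s 9 + 0 * fst s 12,
        18 := fst s 10, 19 := 0, 20 := 0)),
      (snd s)(d := snd s d @ line (fst s 8) (fst s 9) (fst s 10) 0 (fst s 12))))
    (\<lambda>s. K * nat (fst s 12))" by blast
    have "rz N (\<lambda>s. ((?b s \<and> \<not> ?A s) \<and> \<not> ?B s) \<and> \<not> ?C s) Q (\<lambda>s. K * ?l s)"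
    proof (rule rz_conseq[OF K])
      fix s s' :: state assume s: "((?b s \<and> \<not> ?A s) \<and> \<not> ?B s) \<and> \<not> ?C s" and s': "s' = (fold (\<lambda>(v, e) \<sigma>. \<sigma>(v := e \<sigma>)) ?UD ((fst s)(
        16 := fst s 8 + fst s 10 * fst s 12, 17 := fst s 9 + 0 * fst s 12,
        18 := fst s 10, 19 := 0, 20 := 0)),
      (snd s)(d := snd s d @ line (fst s 8) (fst s 9) (fst s 10) 0 (fst s 12)))"
      have "qv (fst s) = line (fst s 8) (fst s 9) (fst s 10) 0 (fst s 12) @ qv (fst s')"
        using s unfolding s' qv_def by (subst qp.simps) auto
      then show "Q s s'" using s area(2)[of "fst s 12" "fst s 13"] unfolding Q_def by (auto simp: s')
    qed auto
    then show ?thesis using that by blast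
  qed
  have m: "rz N P Q (\<lambda>s. K * ?l s) \<Longrightarrow> K \<le> K' \<Longrightarrow> rz N P Q (\<lambda>s. K' * ?l s)" for P K K'
    by (erule rz_conseq) auto
  have pos: "1 \<le> ?l s" if "?b s" for s using that by auto
  have absorb: "rz N P Q (\<lambda>s. (K + K') * ?l s)"
    if "rz N P Q (\<lambda>s. K + K' * ?l s)" "\<And>s. P s \<Longrightarrow> ?b s" for P K K'
  proof (rule rz_conseq[OF that(1)])
    fix s assume "P s"
    then have "K * 1 \<le> K * ?l s" by (intro mult_le_mono2 pos that(2))
    then show "K + K' * ?l s \<le> (K + K') * ?l s" unfolding add_mult_distrib by linarith
  qed auto
  let ?K = "KA + KB + KC + KD"
  have "\<exists>K. rz N (\<lambda>s. (?b s \<and> \<not> ?A s) \<and> \<not> ?B s) Q (\<lambda>s. K + ?K * ?l s)"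
    by (rule rz_if[OF TC m[OF KC] m[OF KD]]) auto
  then obtain K1 where K1: "rz N (\<lambda>s. (?b s \<and> \<not> ?A s) \<and> \<not> ?B s) Q (\<lambda>s. (K1 + ?K) * ?l s)"
    using absorb[of "\<lambda>s. (?b s \<and> \<not> ?A s) \<and> \<not> ?B s" _ ?K] by blast
  have "\<exists>K. rz N (\<lambda>s. ?b s \<and> \<not> ?A s) Q (\<lambda>s. K + (K1 + ?K) * ?l s)"
    by (rule rz_if[OF TB m[OF KB] K1]) auto
  then obtain K2 where K2: "rz N (\<lambda>s. ?b s \<and> \<not> ?A s) Q (\<lambda>s. (K2 + (K1 + ?K)) * ?l s)"
    using absorb[of "\<lambda>s. ?b s \<and> \<not> ?A s" _ "K1 + ?K"] by blast
  have "\<exists>K. rz N ?b Q (\<lambda>s. K + (K2 + (K1 + ?K)) * ?l s)"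
    by (rule rz_if[OF TA m[OF KA] K2]) auto
  then obtain K3 where K3: "rz N ?b Q (\<lambda>s. (K3 + (K2 + (K1 + ?K))) * ?l s)"
    using absorb[of ?b _ "K2 + (K1 + ?K)"] by blast
  show ?thesis
  proof (rule rz_while[OF Tb rz_pre[OF K3], where n = "\<lambda>s. nat (fst s 12) + nat (fst s 13)" and w = ?l and
        C = "K3 + (K2 + (K1 + ?K))"])
    fix s s' :: state assume "?b s" "Q s s'"
    then show "True \<and> nat (fst s' 12) + nat (fst s' 13) < nat (fst s 12) + nat (fst s 13) \<and>
      ?W s' + ?l s \<le> ?W s \<and> (K3 + (K2 + (K1 + ?K))) * ?l s \<le> (K3 + (K2 + (K1 + ?K))) * ?l s \<and> 0 < ?l s"
      using pos[of s] unfolding Q_def by (auto simp del: One_nat_def)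
  next
    fix s :: state assume "\<not> ?b s"
    then show "inputs_eq (fst s) (fst s) \<and> snd s = (snd s)(d := snd s d @ qv (fst s))"
      by (auto simp: qv_def qp.simps not_less)
  next
    fix s s' s'' :: state
    assume "Q s s'" "inputs_eq (fst s') (fst s'') \<and> snd s'' = (snd s')(d := snd s' d @ qv (fst s'))"
    then show "inputs_eq (fst s) (fst s'') \<and> snd s'' = (snd s)(d := snd s d @ qv (fst s))"
      unfolding Q_def using inputs_eq_trans by auto
  qed auto
qed

text \<open>A path of a rectangle is only computed if the rectangle fits into the bounds \<open>u\<close> and \<open>v\<close>. Thus the
  running time is linear in the area also for meaningless arguments.\<close>

definition budget :: "((nat \<Rightarrow> int) \<Rightarrow> int) \<Rightarrow> ((nat \<Rightarrow> int) \<Rightarrow> int) \<Rightarrow> bool" where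
  "budget u v \<longleftrightarrow> lin 8 u \<and> lin 8 v \<and> (\<forall>\<sigma>. Dom \<sigma> \<longrightarrow> nat (u \<sigma>) * nat (v \<sigma>) \<le> area \<sigma>)"

definition qpb :: "int \<Rightarrow> int \<Rightarrow> int \<Rightarrow> int \<Rightarrow> int \<Rightarrow> int \<Rightarrow> int \<Rightarrow> int \<Rightarrow> int \<Rightarrow> int \<Rightarrow> (int \<times> int) list" where
  "qpb u v px py dx dy w h i j = (if w \<le> u \<and> h \<le> v then qp px py dx dy w h i j else [])"

lemma computable_qpb:
  assumes b: "budget u v" and e: "lin 8 e1" "lin 8 e2" "lin 8 e3" "lin 8 e4" "lin 8 e5" "lin 8 e6" "lin 8 e7" "lin 8 e8"
  shows "computable (\<lambda>\<sigma>. qpb (u \<sigma>) (v \<sigma>) (e1 \<sigma>) (e2 \<sigma>) (e3 \<sigma>) (e4 \<sigma>) (e5 \<sigma>) (e6 \<sigma>) (e7 \<sigma>) (e8 \<sigma>))"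
    (is "computable ?f")
proof (rule computableI[where L = 1 and D = 0])
  let ?g = "\<lambda>\<sigma>. qp (e1 \<sigma>) (e2 \<sigma>) (e3 \<sigma>) (e4 \<sigma>) (e5 \<sigma>) (e6 \<sigma>) (e7 \<sigma>) (e8 \<sigma>)"
  let ?c = "\<lambda>\<sigma>. e5 \<sigma> \<le> u \<sigma> \<and> e6 \<sigma> \<le> v \<sigma>"
  have uv: "lin 8 u" "lin 8 v" using b by (auto simp: budget_def)
  have le: "nat (e5 \<sigma>) * nat (e6 \<sigma>) \<le> area \<sigma>" if "Dom \<sigma>" "?c \<sigma>" for \<sigma>
  proof -
    have "nat (e5 \<sigma>) * nat (e6 \<sigma>) \<le> nat (u \<sigma>) * nat (v \<sigma>)" using that by (intro mult_le_mono) auto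
    then show ?thesis using b that unfolding budget_def by (meson order_trans)
  qed
  have loc: "?g \<sigma> = ?g \<tau> \<and> ?c \<sigma> = ?c \<tau>" if "inputs_eq \<sigma> \<tau>" for \<sigma> \<tau>
    using e[THEN lin_inputs, OF that] uv[THEN lin_inputs, OF that] by simp
  show "local ?f" unfolding local_def qpb_def using loc by auto
  show "length (?f \<sigma>) \<le> 1 * area \<sigma>" if "Dom \<sigma>" for \<sigma>
    using le[OF that] length_qp[of "e1 \<sigma>" "e2 \<sigma>" "e3 \<sigma>" "e4 \<sigma>" "e5 \<sigma>" "e6 \<sigma>" "e7 \<sigma>" "e8 \<sigma>"]
    unfolding qpb_def by (auto intro: order_trans)
  fix N d :: nat assume d: "d + 0 < N"
  let ?as = "[(8, e1), (9, e2), (10, e3), (11, e4), (12, e5), (13, e6), (14, e7), (15, e8)]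
     :: (nat \<times> ((nat \<Rightarrow> int) \<Rightarrow> int)) list"
  have l: "\<forall>(v, e) \<in> set ?as. v < 40 \<and> lin 40 e" using e by (auto intro: lin_mono)
  have up: "lin 8 a \<Longrightarrow> 8 \<le> v \<Longrightarrow> a (\<sigma>(v := x)) = a \<sigma>" for a \<sigma> x and v :: nat
    by (erule lin_inputs) simp
  have fa: "fold (\<lambda>(v, e) \<sigma>. \<sigma>(v := e \<sigma>)) ?as \<sigma> = \<sigma>(8 := e1 \<sigma>, 9 := e2 \<sigma>, 10 := e3 \<sigma>, 11 := e4 \<sigma>, 12 := e5 \<sigma>,
     13 := e6 \<sigma>, 14 := e7 \<sigma>, 15 := e8 \<sigma>)" for \<sigma>
    using e by (simp add: up)
  obtain K1 where K1: "rz N (\<lambda>s. pre N d s \<and> ?c (fst s))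
      (\<lambda>s s'. s' = (fold (\<lambda>(v, e) \<sigma>. \<sigma>(v := e \<sigma>)) ?as (fst s), snd s)) (\<lambda>_. K1)"
    using rz_asgs[OF l, of N "\<lambda>s. pre N d s \<and> ?c (fst s)"] by blast
  obtain K2 where K2: "rz N (\<lambda>s. True) (\<lambda>s s'. inputs_eq (fst s) (fst s') \<and> snd s' = (snd s)(d := snd s d @ qv (fst s)))
    (\<lambda>s. K2 * (nat (fst s 12) * nat (fst s 13) + 1))" using rz_qp[of d N] d by auto
  let ?Q = "\<lambda>s s' :: state. inputs_eq (fst s) (fst s') \<and> snd s' = (snd s)(d := snd s d @ ?f (fst s))"
  have A: "rz N (\<lambda>s. pre N d s \<and> ?c (fst s)) ?Q (\<lambda>s. (K1 + 2 * K2) * area (fst s))"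
  proof (rule rz_seq[OF K1 K2])
    fix s s' :: state assume s: "pre N d s \<and> ?c (fst s)"
      and s': "s' = (fold (\<lambda>(v, e) \<sigma>. \<sigma>(v := e \<sigma>)) ?as (fst s), snd s)"
    have D: "Dom (fst s)" using s by (simp add: pre_def)
    have "K1 * 1 \<le> K1 * area (fst s)" using area_pos[OF D] by (intro mult_le_mono2) simp
    moreover have "nat (fst s' 12) * nat (fst s' 13) + 1 \<le> 2 * area (fst s)"
      using le[OF D] s area_pos[OF D] unfolding s' fa by simp
    then have "K2 * (nat (fst s' 12) * nat (fst s' 13) + 1) \<le> K2 * (2 * area (fst s))"
      by (rule mult_le_mono2)
    ultimately show "True \<and> K1 + K2 * (nat (fst s' 12) * nat (fst s' 13) + 1) \<le> (K1 + 2 * K2) * area (fst s)"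
      unfolding add_mult_distrib by (intro conjI TrueI) linarith
  next
    fix s s' s'' :: state assume s: "pre N d s \<and> ?c (fst s)"
      and s': "s' = (fold (\<lambda>(v, e) \<sigma>. \<sigma>(v := e \<sigma>)) ?as (fst s), snd s)"
      and s'': "inputs_eq (fst s') (fst s'') \<and> snd s'' = (snd s')(d := snd s' d @ qv (fst s'))"
    show "?Q s s''" using s s'' unfolding s' fa by (simp add: qv_def qpb_def)
  qed
  have B: "rz N (\<lambda>s. pre N d s \<and> \<not> ?c (fst s)) ?Q (\<lambda>s. (K1 + 2 * K2) * area (fst s))"
    by (rule rz_conseq[OF rz_skip]) (auto simp: qpb_def)
  have T: "test N (\<lambda>s. ?c (fst s))"
    using e uv by (intro test_and test_le) (auto intro: lin_mono)
  obtain K where "rz N (pre N d) ?Q (\<lambda>s. K + (K1 + 2 * K2) * area (fst s))"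
    using rz_if[OF T A B] by blast
  then have "rz N (pre N d) ?Q (\<lambda>s. (K + (K1 + 2 * K2)) * area (fst s))"
  proof (rule rz_conseq)
    fix s assume "pre N d s"
    then have "K * 1 \<le> K * area (fst s)" using area_pos by (intro mult_le_mono2) (simp add: pre_def)
    then show "K + (K1 + 2 * K2) * area (fst s) \<le> (K + (K1 + 2 * K2)) * area (fst s)"
      unfolding add_mult_distrib by linarith
  qed auto
  then show "\<exists>K. computes N d ?f K" unfolding computes_def by blast
qed

section \<open>Writing the result to the output cells\<close>

abbreviation ex :: "instr \<Rightarrow> (nat \<Rightarrow> int) \<Rightarrow> nat \<Rightarrow> int" where
  "ex i M \<equiv> snd (exec i (0, M))"

lemma sem_code: "list_all straight is \<Longrightarrow> length is = n \<Longrightarrow> sem (\<lambda>p. is) M n (fold ex is M)"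
  using sem_list[OF _ refl] by blast

text \<open>Counted loops for the final copying, where the stack layout is given up and the
  invariants speak of single cells instead of \<open>Rel\<close>.\<close>

lemma sem_for:
  assumes step: "\<And>i M. i < n \<Longrightarrow> Inv i M \<Longrightarrow> \<exists>M1 M2. sem E M te M1 \<and> M1 r > 0 \<and> sem B M1 tb M2 \<and> Inv (Suc i) (M2(41 := 0))"
    and exit: "\<And>M. Inv n M \<Longrightarrow> \<exists>M1. sem E M te M1 \<and> \<not> M1 r > 0 \<and> Q (M1(41 := 0))"
    and Inv: "Inv 0 M"
  shows "\<exists>t M'. sem (bwhile r E B) M t M' \<and> t \<le> (n + 1) * (te + tb + 3) \<and> Q M'"
proof -
  have "\<exists>t M'. sem (bwhile r E B) M t M' \<and> t \<le> (k + 1) * (te + tb + 3) \<and> Q M'"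
    if "Inv (n - k) M" "k \<le> n" for k M
    using that
  proof (induction k arbitrary: M)
    case 0
    then obtain M1 where "sem E M te M1" "\<not> M1 r > 0" "Q (M1(41 := 0))" using exit by auto
    then show ?case using sem_while_exit[of E M te M1 r B] by (intro exI[of _ "te + 3"] exI[of _ "M1(41 := 0)"]) (simp del: fun_upd_apply)
  next
    case (Suc k)
    have "n - Suc k < n" "Suc (n - Suc k) = n - k" using Suc.prems by auto
    with step[of "n - Suc k" M] Suc.prems obtain M1 M2 where
      1: "sem E M te M1" "M1 r > 0" "sem B M1 tb M2" "Inv (n - k) (M2(41 := 0))" by auto
    have "k \<le> n" using Suc.prems by simp
    from Suc.IH[OF 1(4) this] obtain t M' where
      2: "sem (bwhile r E B) (M2(41 := 0)) t M'" "t \<le> (k + 1) * (te + tb + 3)" "Q M'" by blast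
    have "sem (bwhile r E B) M (te + tb + t + 3) M'" by (rule sem_while_step[OF 1(1-3) 2(1)])
    then show ?case using 2 by (intro exI[of _ "te + tb + t + 3"] exI[of _ M']) simp
  qed
  from this[of n M] Inv show ?thesis by simp
qed

text \<open>Preparation of the last copy: each cell becomes a pointer to its own future content,
  with the base address in cell 0.\<close>

lemma fold_pointers:
  assumes "1 \<le> k"
  shows "fold ex (concat (map (\<lambda>d. [Const d (int d), Add d d 0]) [1..<k])) M
     = (\<lambda>a. if 1 \<le> a \<and> a < k then int a + M 0 else M a)"
  using assms
proof (induction k rule: dec_induct)
  case (step k)
  then show ?case by (auto simp: fun_eq_iff)
qed (auto simp: fun_eq_iff)

text \<open>A cell serves as its own pointer and is replaced by the value it points to. So the 64
  lowest cells can be filled although none of them is left for counters or temporaries; because of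
  \<open>64 \<le> e\<close> no source is overwritten.\<close>

lemma fold_loads:
  assumes "\<And>a. a < 64 \<Longrightarrow> M a = int (e + a)" "64 \<le> e" "k \<le> 64"
  shows "fold ex (map (\<lambda>d. Load d d) [0..<k]) M = (\<lambda>a. if a < k then M (e + a) else M a)"
  using assms(3)
proof (induction k)
  case (Suc k)
  then have "M k = int (e + k)" using assms(1) by simp
  moreover have "nat (int e + int k) = e + k" by simp
  ultimately show ?case using Suc assms(2) by (auto simp: fun_eq_iff)
qed simp

lemma sem_finish:
  assumes "M 43 = int e" "64 \<le> e"
  shows "sem (\<lambda>p. [Const 0 0, Add 0 0 43] @ concat (map (\<lambda>d. [Const d (int d), Add d d 0]) [1..<64]) @
      map (\<lambda>d. Load d d) [0..<64]) M
    (length ([Const 0 0, Add 0 0 43] @ concat (map (\<lambda>d. [Const d (int d), Add d d 0]) [1..<64]) @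
      map (\<lambda>d. Load d d) [0..<64]))
    (\<lambda>a. if a < 64 then M (e + a) else M a)"
proof (rule sem_list)
  let ?M1 = "M(0 := int e)"
  have 1: "fold ex [Const 0 0, Add 0 0 43] M = ?M1" using assms(1) by (simp add: fun_eq_iff)
  let ?M2 = "\<lambda>a. if 1 \<le> a \<and> a < 64 then int a + ?M1 0 else ?M1 a"
  have 2: "fold ex (concat (map (\<lambda>d. [Const d (int d), Add d d 0]) [1..<64])) ?M1 = ?M2"
    by (rule fold_pointers) simp
  have 3: "fold ex (map (\<lambda>d. Load d d) [0..<64]) ?M2 = (\<lambda>a. if a < 64 then ?M2 (e + a) else ?M2 a)"
    by (rule fold_loads) (use assms(2) in auto)
  show "(\<lambda>a. if a < 64 then M (e + a) else M a) = fold ex ([Const 0 0, Add 0 0 43] @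
      concat (map (\<lambda>d. [Const d (int d), Add d d 0]) [1..<64]) @ map (\<lambda>d. Load d d) [0..<64]) M"
    unfolding fold_append comp_def 1 2 3 using assms(2) by (auto simp: fun_eq_iff)
  show "list_all straight ([Const 0 0, Add 0 0 43] @
      concat (map (\<lambda>d. [Const d (int d), Add d d 0]) [1..<64]) @ map (\<lambda>d. Load d d) [0..<64])"
    by (auto simp: list_all_iff)
qed

text \<open>The result has to end up in the cells from 0 to twice its length, in place of the
  variables and pointers that the copying itself uses. So the points, preceded by their number, are
  packed into a block above stack 0; a loop then copies the cells from 64 on, and straight-line code
  the 64 lowest ones.\<close>

lemma sem_output:
  assumes N: "0 < N"
  shows "\<exists>B K. \<forall>M s. Rel N M s \<longrightarrow> (\<exists>t M'. sem B M t M' \<and> t \<le> K * (length (snd s 0) + 1) \<and>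
     output_path M' = snd s 0)"
proof -
  let ?i1 = "[Const 42 (int (slot N 0 0)), Const 45 1, Const 46 (int (2 * N)), Const 50 64, Add 43 64 50,
     Add 44 43 45, Const 47 0]"
  let ?c1 = "[Sub 40 64 42]"
  let ?b1 = "[Load 50 42, Store 44 50, Add 44 44 45, Add 51 42 45, Load 50 51, Store 44 50, Add 44 44 45,
     Add 42 42 46, Add 47 47 45]"
  let ?i2 = "[Store 43 47, Const 48 64, Add 49 47 47]"
  let ?c2 = "[Sub 40 49 48, Add 40 40 45]"
  let ?b2 = "[Add 50 43 48, Load 51 50, Store 48 51, Add 48 48 45]"
  let ?i3 = "[Const 0 0, Add 0 0 43] @ concat (map (\<lambda>d. [Const d (int d), Add d d 0]) [1..<64]) @
      map (\<lambda>d. Load d d) [0..<64]"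
  let ?w1 = "bwhile 40 (\<lambda>p. ?c1) (\<lambda>p. ?b1)"
  let ?w2 = "bwhile 40 (\<lambda>p. ?c2) (\<lambda>p. ?b2)"
  let ?B = "bseq (bseq (bseq (bseq (\<lambda>p. ?i1) ?w1) (\<lambda>p. ?i2)) ?w2) (\<lambda>p. ?i3)"
  let ?K = "7 + (1 + 9 + 3) + 3 + 2 * (2 + 4 + 3) + length ?i3"
  have "\<exists>t M'. sem ?B M t M' \<and> t \<le> ?K * (length (snd s 0) + 1) \<and> output_path M' = snd s 0"
    if R: "Rel N M s" for M s
  proof -
    define xs where "xs = snd s 0"
    define L where "L = length xs"
    \<comment> \<open>Beyond all points of stack 0. The extra 64 gives
      \<open>2 * L + 128 < E\<close>, so the block lies clear of the scratch cells, of the pointer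
      of stack 0 and of the target cells.\<close>
    define E where "E = slot N 0 L + 64"
    have M64: "M 64 = int (slot N 0 L)" and data: "\<And>i. i < L \<Longrightarrow> (M (slot N 0 i), M (Suc (slot N 0 i))) = xs ! i"
      using R N unfolding Rel_def xs_def L_def by auto
    have EL: "2 * L + 128 < E"
    proof -
      have "1 * L \<le> N * L" using N by (intro mult_le_mono1) simp
      then have "2 * L + 128 < 64 + N + 2 * (N * L) + 64" using N by linarith
      then show ?thesis by (simp only: E_def slot_def add_0_right)
    qed
    have sl: "slot N 0 i + 1 < E" "64 < slot N 0 i" if "i < L" for i
    proof -
      have "N * i \<le> N * L" using that by (intro mult_le_mono2) simp
      then have "64 + N + 2 * (N * i) + 1 < 64 + N + 2 * (N * L) + 64" by linarith
      then show "slot N 0 i + 1 < E" by (simp only: E_def slot_def add_0_right)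
      show "64 < slot N 0 i" using N by (simp add: slot_def)
    qed
    have ns: "(slot N 0 i = c) = False" if "c \<le> 64" for i c
      using that N by (simp add: slot_def)
    define Inv1 where "Inv1 = (\<lambda>i (M :: nat \<Rightarrow> int). M 42 = int (slot N 0 i) \<and> M 43 = int E \<and> M 44 = int (E + 1 + 2 * i) \<and>
       M 45 = 1 \<and> M 46 = int (2 * N) \<and> M 47 = int i \<and> M 64 = int (slot N 0 L) \<and>
       (\<forall>i<L. (M (slot N 0 i), M (Suc (slot N 0 i))) = xs ! i) \<and>
       (\<forall>j<i. (M (E + 1 + 2 * j), M (E + 2 + 2 * j)) = xs ! j))"
    let ?M1 = "fold ex ?i1 M"
    have s1: "sem (\<lambda>p. ?i1) M 7 ?M1" by (rule sem_code) simp_all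
    have I1: "Inv1 0 ?M1"
      using M64 data EL unfolding Inv1_def by (auto simp: E_def ns)
    have "\<exists>t M'. sem ?w1 ?M1 t M' \<and> t \<le> (L + 1) * (1 + 9 + 3) \<and> Inv1 L M'"
    proof (rule sem_for[where Inv = Inv1, OF _ _ I1])
      fix i M assume i: "i < L" and I: "Inv1 i M"
      let ?M' = "fold ex ?c1 M" and ?M'' = "fold ex ?b1 (fold ex ?c1 M)"
      have "sem (\<lambda>p. ?c1) M 1 ?M'" by (rule sem_code) simp_all
      moreover have "?M' 40 > 0" using I i N by (simp add: Inv1_def slot_def)
      moreover have "sem (\<lambda>p. ?b1) ?M' 9 ?M''" by (rule sem_code) simp_all
      moreover have "Inv1 (Suc i) (?M''(41 := 0))"
      proof -
        let ?a = "slot N 0 i" and ?e = "E + 1 + 2 * i"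
        have x: "(M ?a, M (Suc ?a)) = xs ! i" using I i by (simp add: Inv1_def)
        have n: "nat (int ?a) = ?a" "nat (int ?a + 1) = Suc ?a" "nat (1 + int ?a) = Suc ?a"
          "nat (int ?e) = ?e" "nat (int ?e + 1) = Suc ?e" by simp_all
        have ne: "?a \<noteq> ?e" "Suc ?a \<noteq> ?e" "?e > 128" "?a > 64" using sl[OF i] EL by auto
        have f: "?M'' = M(40 := M 64 - int ?a, 50 := M (Suc ?a), ?e := M ?a, Suc ?e := M (Suc ?a), 44 := int ?e + 2, 51 := int ?a + 1,
            42 := int ?a + int (2 * N), 47 := int i + 1)"
          using I n ne unfolding Inv1_def by (simp add: fun_eq_iff ns)
        have s: "int ?a + int (2 * N) = int (slot N 0 (Suc i))" by (simp add: slot_def)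
        show ?thesis unfolding f s Inv1_def
        proof (intro conjI allI impI)
          fix j assume "j < L"
          then show "((M(40 := M 64 - int ?a, 50 := M (Suc ?a), ?e := M ?a, Suc ?e := M (Suc ?a), 44 := int ?e + 2, 51 := int ?a + 1,
            42 := int (slot N 0 (Suc i)), 47 := int i + 1, 41 := 0)) (slot N 0 j), (M(40 := M 64 - int ?a, 50 := M (Suc ?a), ?e := M ?a, Suc ?e := M (Suc ?a), 44 := int ?e + 2, 51 := int ?a + 1,
            42 := int (slot N 0 (Suc i)), 47 := int i + 1, 41 := 0)) (Suc (slot N 0 j))) = xs ! j"
            using sl[of j] I EL unfolding Inv1_def by (auto simp: ns)
        next
          fix j assume "j < Suc i"
          then have "j = i \<or> j < i \<and> (M (E + 1 + 2 * j), M (E + 2 + 2 * j)) = xs ! j" using I unfolding Inv1_def by auto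
          then show "((M(40 := M 64 - int ?a, 50 := M (Suc ?a), ?e := M ?a, Suc ?e := M (Suc ?a), 44 := int ?e + 2, 51 := int ?a + 1,
            42 := int (slot N 0 (Suc i)), 47 := int i + 1, 41 := 0)) (E + 1 + 2 * j), (M(40 := M 64 - int ?a, 50 := M (Suc ?a), ?e := M ?a, Suc ?e := M (Suc ?a), 44 := int ?e + 2, 51 := int ?a + 1,
            42 := int (slot N 0 (Suc i)), 47 := int i + 1, 41 := 0)) (E + 2 + 2 * j)) = xs ! j"
            using x EL by auto
        qed (use I EL ne in \<open>auto simp: Inv1_def ns\<close>)
      qed
      ultimately show "\<exists>M1 M2. sem (\<lambda>p. ?c1) M 1 M1 \<and> M1 40 > 0 \<and> sem (\<lambda>p. ?b1) M1 9 M2 \<and> Inv1 (Suc i) (M2(41 := 0))"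
        by blast
    next
      fix M assume I: "Inv1 L M"
      let ?M' = "fold ex ?c1 M"
      have "sem (\<lambda>p. ?c1) M 1 ?M'" by (rule sem_code) simp_all
      moreover have "\<not> ?M' 40 > 0" using I by (simp add: Inv1_def)
      moreover have "Inv1 L (?M'(41 := 0))" using I EL unfolding Inv1_def by (auto simp: ns)
      ultimately show "\<exists>M1. sem (\<lambda>p. ?c1) M 1 M1 \<and> \<not> M1 40 > 0 \<and> Inv1 L (M1(41 := 0))" by blast
    qed
    then obtain t1 M2 where s2: "sem ?w1 ?M1 t1 M2" "t1 \<le> (L + 1) * (1 + 9 + 3)" and I2: "Inv1 L M2" by blast
    define Inv2 where "Inv2 = (\<lambda>i (M :: nat \<Rightarrow> int). M 43 = int E \<and> M 45 = 1 \<and> M 48 = int (64 + i) \<and> M 49 = int (2 * L) \<and>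
       M E = int L \<and> (\<forall>j<L. (M (E + 1 + 2 * j), M (E + 2 + 2 * j)) = xs ! j) \<and>
       (\<forall>a. 64 \<le> a \<and> a < 64 + i \<longrightarrow> M a = M (E + a)))"
    let ?M3 = "fold ex ?i2 M2"
    have s3: "sem (\<lambda>p. ?i2) M2 3 ?M3" by (rule sem_code) simp_all
    have I3: "Inv2 0 ?M3" using I2 EL unfolding Inv1_def Inv2_def by auto
    \<comment> \<open>The number of result cells from 64 on, out of \<open>2 * L + 1\<close>;
      truncated subtraction yields no round if all of them lie below 64.\<close>
    define n where "n = 2 * L + 1 - 64"
    have "\<exists>t M'. sem ?w2 ?M3 t M' \<and> t \<le> (n + 1) * (2 + 4 + 3) \<and> Inv2 n M'"
    proof (rule sem_for[where Inv = Inv2, OF _ _ I3])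
      fix i M assume i: "i < n" and I: "Inv2 i M"
      let ?M' = "fold ex ?c2 M" and ?M'' = "fold ex ?b2 (fold ex ?c2 M)"
      have "sem (\<lambda>p. ?c2) M 2 ?M'" by (rule sem_code) simp_all
      moreover have "?M' 40 > 0" using I i by (simp add: Inv2_def n_def)
      moreover have "sem (\<lambda>p. ?b2) ?M' 4 ?M''" by (rule sem_code) simp_all
      moreover have "Inv2 (Suc i) (?M''(41 := 0))"
      proof -
        have lt: "64 + i < E" using i EL by (simp add: n_def)
        have n: "nat (int E + (64 + int i)) = E + (64 + i)" "nat (64 + int i) = 64 + i" by simp_all
        have f: "?M'' = M(40 := int (2 * L) - int (64 + i) + 1, 50 := int E + int (64 + i), 51 := M (E + (64 + i)),
           64 + i := M (E + (64 + i)), 48 := int (64 + i) + 1)"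
          using I n lt unfolding Inv2_def by (auto simp: fun_eq_iff)
        show ?thesis unfolding f Inv2_def
        proof (intro conjI allI impI)
          fix j assume "j < L"
          then show "((M(40 := int (2 * L) - int (64 + i) + 1, 50 := int E + int (64 + i), 51 := M (E + (64 + i)),
           64 + i := M (E + (64 + i)), 48 := int (64 + i) + 1, 41 := 0)) (E + 1 + 2 * j), (M(40 := int (2 * L) - int (64 + i) + 1, 50 := int E + int (64 + i), 51 := M (E + (64 + i)),
           64 + i := M (E + (64 + i)), 48 := int (64 + i) + 1, 41 := 0)) (E + 2 + 2 * j)) = xs ! j"
            using I EL lt unfolding Inv2_def by auto
        next
          fix a assume a: "64 \<le> a \<and> a < 64 + Suc i"
          then have "a = 64 + i \<or> a < 64 + i \<and> M a = M (E + a)" using I unfolding Inv2_def by auto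
          then show "(M(40 := int (2 * L) - int (64 + i) + 1, 50 := int E + int (64 + i), 51 := M (E + (64 + i)),
           64 + i := M (E + (64 + i)), 48 := int (64 + i) + 1, 41 := 0)) a = (M(40 := int (2 * L) - int (64 + i) + 1, 50 := int E + int (64 + i), 51 := M (E + (64 + i)),
           64 + i := M (E + (64 + i)), 48 := int (64 + i) + 1, 41 := 0)) (E + a)"
            using a EL lt by auto
        qed (use I EL lt in \<open>auto simp: Inv2_def\<close>)
      qed
      ultimately show "\<exists>M1 M2. sem (\<lambda>p. ?c2) M 2 M1 \<and> M1 40 > 0 \<and> sem (\<lambda>p. ?b2) M1 4 M2 \<and> Inv2 (Suc i) (M2(41 := 0))"
        by blast
    next
      fix M assume I: "Inv2 n M"
      let ?M' = "fold ex ?c2 M"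
      have "sem (\<lambda>p. ?c2) M 2 ?M'" by (rule sem_code) simp_all
      moreover have "\<not> ?M' 40 > 0" using I by (simp add: Inv2_def n_def)
      moreover have "Inv2 n (?M'(41 := 0))" using I EL unfolding Inv2_def by auto
      ultimately show "\<exists>M1. sem (\<lambda>p. ?c2) M 2 M1 \<and> \<not> M1 40 > 0 \<and> Inv2 n (M1(41 := 0))" by blast
    qed
    then obtain t2 M4 where s4: "sem ?w2 ?M3 t2 M4" "t2 \<le> (n + 1) * (2 + 4 + 3)" and I4: "Inv2 n M4" by blast
    let ?M5 = "\<lambda>a. if a < 64 then M4 (E + a) else M4 a"
    have s5: "sem (\<lambda>p. ?i3) M4 (length ?i3) ?M5"
      by (rule sem_finish) (use I4 EL in \<open>auto simp: Inv2_def\<close>)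
    have "sem ?B M (7 + t1 + 3 + t2 + length ?i3) ?M5"
      by (intro sem_seq[OF sem_seq[OF sem_seq[OF sem_seq[OF s1 s2(1)] s3] s4(1)] s5])
    moreover have "7 + t1 + 3 + t2 + length ?i3 \<le> ?K * (L + 1)"
    proof -
      have "n + 1 \<le> 2 * (L + 1)" by (simp add: n_def)
      then have "(n + 1) * (2 + 4 + 3) \<le> 2 * (L + 1) * (2 + 4 + 3)" by (rule mult_le_mono1)
      then show ?thesis using s2(2) s4(2) by (simp add: algebra_simps)
    qed
    moreover have "output_path ?M5 = xs"
    proof -
      have 5: "?M5 a = M4 (E + a)" if "a \<le> 2 * L" for a
        using I4 that unfolding Inv2_def n_def by auto
      have a: "?M5 0 = int L" using I4 by (simp add: Inv2_def)
      have b: "(?M5 (2 * i + 1), ?M5 (2 * i + 2)) = xs ! i" if "i < L" for i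
        using 5[of "2 * i + 1"] 5[of "2 * i + 2"] that I4 unfolding Inv2_def by (simp add: algebra_simps)
      have "output_path m = xs" if "m 0 = int L" "\<And>i. i < L \<Longrightarrow> (m (2 * i + 1), m (2 * i + 2)) = xs ! i" for m
        unfolding output_path_def using that by (intro nth_equalityI) (simp_all add: L_def)
      from this[of ?M5, OF a b] show ?thesis .
    qed
    ultimately show ?thesis unfolding L_def xs_def by blast
  qed
  then show ?thesis by blast
qed

lemma sem_run: "sem B M T M' \<Longrightarrow> run (B 0) T (0, M) = (length (B 0), M')"
  unfolding sem_def by (drule spec[of _ "[]"], drule spec[of _ "[]"]) simp

text \<open>One program serves all inputs, since the number of stacks depends on \<open>f\<close>
  only. The inputs already are where the variables live, and setting the stack pointers makes any
  memory represent a state with empty stacks.\<close>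

theorem computable_program:
  assumes "computable f"
  shows "\<exists>P C. \<forall>\<sigma>. Dom \<sigma> \<longrightarrow> (\<exists>T \<le> C * area \<sigma>. halted P (run P T (0, \<sigma>)) \<and>
     output_path (snd (run P T (0, \<sigma>))) = f \<sigma>)"
proof -
  obtain L D where f: "local f" "\<And>\<sigma>. Dom \<sigma> \<Longrightarrow> length (f \<sigma>) \<le> L * area \<sigma>"
    "\<And>N d. d + D < N \<Longrightarrow> \<exists>K. computes N d f K" using assms unfolding computable_def by blast
  define N where "N = Suc D"
  obtain Kf where "computes N 0 f Kf" using f(3)[of 0 N] by (auto simp: N_def)
  then obtain Bf where Bf: "\<And>M s. Rel N M s \<Longrightarrow> pre N 0 s \<Longrightarrow>
     \<exists>t M' s'. sem Bf M t M' \<and> t \<le> Kf * area (fst s) \<and> Rel N M' s' \<and> inputs_eq (fst s) (fst s') \<and>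
       snd s' = (snd s)(0 := snd s 0 @ f (fst s))"
    unfolding computes_def rz_def by blast
  obtain Bo Ko where Bo: "\<And>M s. Rel N M s \<Longrightarrow> \<exists>t M'. sem Bo M t M' \<and> t \<le> Ko * (length (snd s 0) + 1) \<and>
     output_path M' = snd s 0" using sem_output[of N] unfolding N_def by blast
  let ?i = "map (\<lambda>j. Const (64 + j) (int (slot N j 0))) [0..<N]"
  have fi: "fold ex (map (\<lambda>j. Const (64 + j) (int (slot N j 0))) [0..<k]) M
     = (\<lambda>a. if 64 \<le> a \<and> a < 64 + k then int (slot N (a - 64) 0) else M a)" for M k
    by (induction k) (auto simp: fun_eq_iff)
  let ?B = "bseq (bseq (\<lambda>p. ?i) Bf) Bo"
  let ?C = "N + Kf + Ko * (L + 1)"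
  show ?thesis
  proof (rule exI[of _ "?B 0"], rule exI[of _ ?C], intro allI impI)
    fix \<sigma> :: "nat \<Rightarrow> int" assume D: "Dom \<sigma>"
    let ?M1 = "fold ex ?i \<sigma>"
    let ?s = "(\<sigma>, \<lambda>_. []) :: state"
    have "sem (\<lambda>p. ?i) \<sigma> (length ?i) ?M1" by (rule sem_list) (auto simp: list_all_iff)
    then have 1: "sem (\<lambda>p. ?i) \<sigma> N ?M1" by simp
    have "Rel N ?M1 ?s" unfolding fi Rel_def by simp
    then obtain t2 M2 s2 where 2: "sem Bf ?M1 t2 M2" "t2 \<le> Kf * area \<sigma>" "Rel N M2 s2" "snd s2 0 = f \<sigma>"
      using Bf[of ?M1 ?s] D by (auto simp: pre_def)
    obtain t3 M3 where 3: "sem Bo M2 t3 M3" "t3 \<le> Ko * (length (f \<sigma>) + 1)" "output_path M3 = f \<sigma>"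
      using Bo[OF 2(3)] 2(4) by auto
    have "sem ?B \<sigma> (N + t2 + t3) M3" by (intro sem_seq[OF sem_seq[OF 1 2(1)] 3(1)])
    then have run: "run (?B 0) (N + t2 + t3) (0, \<sigma>) = (length (?B 0), M3)" by (rule sem_run)
    have A: "1 \<le> area \<sigma>" using area_pos[OF D] .
    have "Ko * (length (f \<sigma>) + 1) \<le> Ko * ((L + 1) * area \<sigma>)"
      using f(2)[OF D] A by (intro mult_le_mono2) simp
    moreover have "N * 1 \<le> N * area \<sigma>" using A by (intro mult_le_mono2)
    ultimately have "N + t2 + t3 \<le> ?C * area \<sigma>"
      using 2(2) 3(2) unfolding add_mult_distrib mult.assoc by linarith
    then show "\<exists>T \<le> ?C * area \<sigma>. halted (?B 0) (run (?B 0) T (0, \<sigma>)) \<and>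
       output_path (snd (run (?B 0) T (0, \<sigma>))) = f \<sigma>"
      using run 3(3) by (intro exI[of _ "N + t2 + t3"]) (simp add: halted_def)
  qed
qed

section \<open>Rectangles, between arbitrary vertices\<close>

abbreviation box :: "int \<Rightarrow> int \<Rightarrow> int \<Rightarrow> int \<Rightarrow> (int \<times> int) set" where
  "box x1 x2 y1 y2 \<equiv> {x1..x2} \<times> {y1..y2}"

text \<open>\<open>qp\<close> in absolute coordinates. The flags choose the corner to start from:
  \<open>rx\<close> the side with the larger first coordinate, \<open>ry\<close> the one with the
  larger second coordinate.\<close>

definition qbox :: "int \<Rightarrow> int \<Rightarrow> int \<Rightarrow> int \<Rightarrow> int \<Rightarrow> int \<Rightarrow> bool \<Rightarrow> bool \<Rightarrow> int \<Rightarrow> int \<Rightarrow> (int \<times> int) list" where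
  "qbox u v x1 x2 y1 y2 rx ry tx ty = qpb u v (if rx then x2 else x1) (if ry then y2 else y1)
     (if rx then - 1 else 1) (if ry then - 1 else 1) (x2 - x1 + 1) (y2 - y1 + 1)
     (if rx then x2 - tx else tx - x1) (if ry then y2 - ty else ty - y1)"

lemma hamp_qbox:
  assumes "x2 - x1 + 1 \<le> u" "y2 - y1 + 1 \<le> v" "x1 \<le> tx" "tx \<le> x2" "y1 \<le> ty" "ty \<le> y2"
    and "cx = (if rx then x2 else x1)" "cy = (if ry then y2 else y1)"
    and "x1 = x2 \<and> ty = y1 + y2 - cy \<or> x1 < x2 \<and> y1 = y2 \<and> tx = x1 + x2 - cx \<or>
      x1 < x2 \<and> y1 < y2 \<and> (tx \<noteq> cx \<or> ty \<noteq> cy)"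
  shows "hamp (box x1 x2 y1 y2) (cx, cy) (tx, ty) (qbox u v x1 x2 y1 y2 rx ry tx ty)"
proof -
  let ?dx = "if rx then - 1 else 1 :: int" and ?dy = "if ry then - 1 else 1 :: int"
  let ?i = "if rx then x2 - tx else tx - x1" and ?j = "if ry then y2 - ty else ty - y1"
  have "qvalid (x2 - x1 + 1) (y2 - y1 + 1) ?i ?j"
    using assms unfolding qvalid_def by (auto split: if_splits)
  then have "hamp (iv cx ?dx (x2 - x1 + 1) \<times> iv cy ?dy (y2 - y1 + 1)) (cx, cy) (cx + ?dx * ?i, cy + ?dy * ?j)
     (qp cx cy ?dx ?dy (x2 - x1 + 1) (y2 - y1 + 1) ?i ?j)"
    by (rule hamp_qp) auto
  moreover have "iv cx ?dx (x2 - x1 + 1) = {x1..x2}" "iv cy ?dy (y2 - y1 + 1) = {y1..y2}"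
    using assms by (auto simp: iv_def)
  moreover have "cx + ?dx * ?i = tx" "cy + ?dy * ?j = ty" using assms by auto
  moreover have "qbox u v x1 x2 y1 y2 rx ry tx ty = qp cx cy ?dx ?dy (x2 - x1 + 1) (y2 - y1 + 1) ?i ?j"
    using assms by (simp add: qbox_def qpb_def)
  ultimately show ?thesis by simp
qed

lemmas lin_intros = lin_const lin_add lin_minus lin_uminus

lemma computable_qbox:
  assumes "budget u v" "lin 8 x1" "lin 8 x2" "lin 8 y1" "lin 8 y2" "lin 8 tx" "lin 8 ty"
  shows "computable (\<lambda>\<sigma>. qbox (u \<sigma>) (v \<sigma>) (x1 \<sigma>) (x2 \<sigma>) (y1 \<sigma>) (y2 \<sigma>) rx ry (tx \<sigma>) (ty \<sigma>))"
  unfolding qbox_def by (cases rx; cases ry; simp) (intro computable_qpb lin_intros assms)+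

lemma hamp_append': "hamp X s u p \<Longrightarrow> hamp Y v t q \<Longrightarrow> sg_adj u v \<Longrightarrow> X \<inter> Y = {} \<Longrightarrow> hamp (X \<union> Y) s t (p @ q)"
  by (rule hamp_append) auto

lemma hamp_eq: "hamp X s t p \<Longrightarrow> X = Y \<Longrightarrow> hamp Y s t p"
  by simp

text \<open>A cut between rows \<open>c\<close> and \<open>c + 1\<close> separates the end points,
  and both parts have at least two rows. The two partial paths meet at \<open>(1, c)\<close> and
  \<open>(1, c + 1)\<close>, which therefore must not be end points.\<close>

definition csplit :: "int \<Rightarrow> int \<Rightarrow> int \<Rightarrow> int \<Rightarrow> int \<Rightarrow> int \<Rightarrow> int \<Rightarrow> bool" where
  "csplit c m n sx sy tx ty \<longleftrightarrow> sy \<le> c \<and> 2 \<le> c \<and> c < ty \<and> c \<le> n - 2 \<and> (sx \<noteq> 1 \<or> sy \<noteq> c) \<and> (tx \<noteq> 1 \<or> ty \<noteq> c + 1)"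

text \<open>Adjacent end points in one row at the border: the path visits the first two columns on
  one side of them, crosses over through all the other columns, and returns through the first two
  columns on the other side.\<close>

definition cpair :: "int \<Rightarrow> int \<Rightarrow> int \<Rightarrow> int \<Rightarrow> int \<Rightarrow> int \<Rightarrow> bool" where
  "cpair m n sx sy tx ty \<longleftrightarrow> sx = 1 \<and> tx = 2 \<and> sy = ty \<and> 1 < sy \<and> sy < n \<and> 3 \<le> m"

text \<open>The end points enclose a single vertex of an inner row, and this vertex is the passage
  between the rows on the two sides.\<close>

definition cacross :: "int \<Rightarrow> int \<Rightarrow> int \<Rightarrow> int \<Rightarrow> int \<Rightarrow> int \<Rightarrow> bool" where
  "cacross m n sx sy tx ty \<longleftrightarrow> m = 3 \<and> sx = 1 \<and> tx = 3 \<and> sy = ty \<and> 1 < sy \<and> sy < n"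

text \<open>The path leaves the lower rows at the right, runs back along the rest of row
  \<open>sy\<close> and then of row \<open>sy + 1\<close>, and continues with the upper rows.
  \<open>m \<le> 3\<close> makes \<open>(2, sy)\<close> and \<open>(m - 1, sy + 1)\<close>
  adjacent.\<close>

definition cdiag :: "int \<Rightarrow> int \<Rightarrow> int \<Rightarrow> int \<Rightarrow> int \<Rightarrow> int \<Rightarrow> bool" where
  "cdiag m n sx sy tx ty \<longleftrightarrow> m \<le> 3 \<and> sx = 1 \<and> tx = m \<and> ty = sy + 1 \<and> 1 < sy \<and> ty < n"

text \<open>The end points are two of the three neighbours of the corner \<open>(1, 1)\<close>. The
  corner is visited last but one, coming from its third neighbour \<open>(2, 2)\<close>.\<close>

definition cknight :: "int \<Rightarrow> int \<Rightarrow> int \<Rightarrow> int \<Rightarrow> int \<Rightarrow> int \<Rightarrow> bool" where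
  "cknight m n sx sy tx ty \<longleftrightarrow> sx = 1 \<and> sy = 2 \<and> tx = 2 \<and> ty = 1 \<and> 3 \<le> m \<and> 3 \<le> n"

text \<open>Up to the symmetries of the rectangle and exchange of the end points, these cases are exhaustive, see
  \<open>rcond_complete\<close>.\<close>

definition rcond :: "int \<Rightarrow> int \<Rightarrow> int \<Rightarrow> int \<Rightarrow> int \<Rightarrow> int \<Rightarrow> bool" where
  "rcond m n sx sy tx ty \<longleftrightarrow> sx = 1 \<and> sy = 1 \<or> csplit sy m n sx sy tx ty \<or> csplit 2 m n sx sy tx ty \<or>
    cpair m n sx sy tx ty \<or> cacross m n sx sy tx ty \<or> cdiag m n sx sy tx ty \<or> cknight m n sx sy tx ty"

definition rsplit :: "int \<Rightarrow> int \<Rightarrow> int \<Rightarrow> int \<Rightarrow> int \<Rightarrow> int \<Rightarrow> int \<Rightarrow> int \<Rightarrow> int \<Rightarrow> (int \<times> int) list" where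
  "rsplit c u v m n sx sy tx ty = rev (qbox u v 1 m 1 c False True sx sy) @ qbox u v 1 m (c + 1) n False False tx ty"

definition rh :: "int \<Rightarrow> int \<Rightarrow> int \<Rightarrow> int \<Rightarrow> int \<Rightarrow> int \<Rightarrow> int \<Rightarrow> int \<Rightarrow> (int \<times> int) list" where
  "rh u v m n sx sy tx ty =
    (if sx = 1 \<and> sy = 1 then qbox u v 1 m 1 n False False tx ty
     else if csplit sy m n sx sy tx ty then rsplit sy u v m n sx sy tx ty
     else if csplit 2 m n sx sy tx ty then rsplit 2 u v m n sx sy tx ty
     else if cpair m n sx sy tx ty then
       [(1, sy)] @ qbox u v 1 2 1 (sy - 1) False True 2 1 @ qbox u v 3 m 1 n False False 3 n @
       qbox u v 1 2 (sy + 1) n True True 1 (sy + 1) @ [(2, sy)]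
     else if cacross m n sx sy tx ty then
       [(1, sy)] @ qbox u v 1 3 1 (sy - 1) False True 3 (sy - 1) @ [(2, sy)] @
       qbox u v 1 3 (sy + 1) n False False 3 (sy + 1) @ [(3, sy)]
     else if cdiag m n sx sy tx ty then
       [(1, sy)] @ qbox u v 1 m 1 (sy - 1) False True m (sy - 1) @ qbox u v 2 m sy sy True False 2 sy @
       qbox u v 1 (m - 1) (sy + 1) (sy + 1) True False 1 (sy + 1) @
       qbox u v 1 m (sy + 2) n False False m (sy + 2) @ [(m, sy + 1)]
     else if cknight m n sx sy tx ty then
       [(1, 2)] @ qbox u v 1 m 3 n False False m 3 @ qbox u v 3 m 1 2 True True 3 1 @ [(2, 2), (1, 1), (2, 1)]
     else [])"

definition inst :: "int \<Rightarrow> int \<Rightarrow> int \<Rightarrow> int \<Rightarrow> int \<Rightarrow> int \<Rightarrow> int \<Rightarrow> int \<Rightarrow> bool" where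
  "inst u v m n sx sy tx ty \<longleftrightarrow> 2 \<le> m \<and> 2 \<le> n \<and> m \<le> u \<and> n \<le> v \<and> 1 \<le> sx \<and> sx \<le> m \<and> 1 \<le> sy \<and> sy \<le> n \<and>
     1 \<le> tx \<and> tx \<le> m \<and> 1 \<le> ty \<and> ty \<le> n \<and> (sx \<noteq> tx \<or> sy \<noteq> ty)"

lemma rsplit_sound:
  assumes "inst u v m n sx sy tx ty" "csplit c m n sx sy tx ty"
  shows "hamp (box 1 m 1 n) (sx, sy) (tx, ty) (rsplit c u v m n sx sy tx ty)"
proof -
  have 1: "hamp (box 1 m 1 c) (1, c) (sx, sy) (qbox u v 1 m 1 c False True sx sy)"
    using assms by (intro hamp_qbox) (auto simp: inst_def csplit_def)
  have 2: "hamp (box 1 m (c + 1) n) (1, c + 1) (tx, ty) (qbox u v 1 m (c + 1) n False False tx ty)"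
    using assms by (intro hamp_qbox) (auto simp: inst_def csplit_def)
  show ?thesis unfolding rsplit_def
    by (rule hamp_append[OF hamp_rev[OF 1] 2]) (use assms in \<open>auto simp: inst_def csplit_def\<close>)
qed

lemma rh_sound:
  assumes I: "inst u v m n sx sy tx ty" and C: "rcond m n sx sy tx ty"
  shows "hamp (box 1 m 1 n) (sx, sy) (tx, ty) (rh u v m n sx sy tx ty)"
proof -
  let ?g = "sx = 1 \<and> sy = 1 \<or> csplit sy m n sx sy tx ty \<or> csplit 2 m n sx sy tx ty"
  consider (corner) "sx = 1 \<and> sy = 1" | (split) "\<not> (sx = 1 \<and> sy = 1)" "csplit sy m n sx sy tx ty"
    | (split2) "\<not> (sx = 1 \<and> sy = 1)" "\<not> csplit sy m n sx sy tx ty" "csplit 2 m n sx sy tx ty"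
    | (pair) "\<not> ?g" "cpair m n sx sy tx ty"
    | (across) "\<not> ?g" "\<not> cpair m n sx sy tx ty" "cacross m n sx sy tx ty"
    | (diag) "\<not> ?g" "\<not> cpair m n sx sy tx ty" "\<not> cacross m n sx sy tx ty" "cdiag m n sx sy tx ty"
    | (knight) "\<not> ?g" "\<not> cpair m n sx sy tx ty" "\<not> cacross m n sx sy tx ty" "\<not> cdiag m n sx sy tx ty"
        "cknight m n sx sy tx ty"
    using C unfolding rcond_def by blast
  then show ?thesis
  proof cases
    case corner
    have "hamp (box 1 m 1 n) (1, 1) (tx, ty) (qbox u v 1 m 1 n False False tx ty)"
      using I corner by (intro hamp_qbox) (auto simp: inst_def)
    then show ?thesis using corner by (simp add: rh_def)
  next
    case split
    then show ?thesis using rsplit_sound[OF I] by (auto simp: rh_def)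
  next
    case split2
    then show ?thesis using rsplit_sound[OF I] by (auto simp: rh_def)
  next
    case pair
    note P = pair(2)[unfolded cpair_def] and I' = I[unfolded inst_def]
    have 1: "hamp (box 1 2 1 (sy - 1)) (1, sy - 1) (2, 1) (qbox u v 1 2 1 (sy - 1) False True 2 1)"
      using P I' by (intro hamp_qbox) auto
    have 2: "hamp (box 3 m 1 n) (3, 1) (3, n) (qbox u v 3 m 1 n False False 3 n)"
      using P I' by (intro hamp_qbox) auto
    have 3: "hamp (box 1 2 (sy + 1) n) (2, n) (1, sy + 1) (qbox u v 1 2 (sy + 1) n True True 1 (sy + 1))"
      using P I' by (intro hamp_qbox) auto
    have 4: "hamp (box 1 m 1 n) (1, sy) (2, sy) ([(1, sy)] @ qbox u v 1 2 1 (sy - 1) False True 2 1 @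
       qbox u v 3 m 1 n False False 3 n @ qbox u v 1 2 (sy + 1) n True True 1 (sy + 1) @ [(2, sy)])"
      by (rule hamp_eq[OF hamp_append'[OF hamp_single hamp_append'[OF 1 hamp_append'[OF 2
           hamp_append'[OF 3 hamp_single]]]]]) (use P I' in auto)
    show ?thesis using pair 4 P by (auto simp: rh_def)
  next
    case across
    note P = across(3)[unfolded cacross_def] and I' = I[unfolded inst_def]
    have 1: "hamp (box 1 3 1 (sy - 1)) (1, sy - 1) (3, sy - 1) (qbox u v 1 3 1 (sy - 1) False True 3 (sy - 1))"
      using P I' by (intro hamp_qbox) auto
    have 2: "hamp (box 1 3 (sy + 1) n) (1, sy + 1) (3, sy + 1) (qbox u v 1 3 (sy + 1) n False False 3 (sy + 1))"
      using P I' by (intro hamp_qbox) auto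
    have 4: "hamp (box 1 m 1 n) (1, sy) (3, sy) ([(1, sy)] @ qbox u v 1 3 1 (sy - 1) False True 3 (sy - 1) @
       [(2, sy)] @ qbox u v 1 3 (sy + 1) n False False 3 (sy + 1) @ [(3, sy)])"
      by (rule hamp_eq[OF hamp_append'[OF hamp_single hamp_append'[OF 1 hamp_append'[OF hamp_single
           hamp_append'[OF 2 hamp_single]]]]]) (use P I' in auto)
    show ?thesis using across 4 P by (auto simp: rh_def)
  next
    case diag
    note P = diag(4)[unfolded cdiag_def] and I' = I[unfolded inst_def]
    have 1: "hamp (box 1 m 1 (sy - 1)) (1, sy - 1) (m, sy - 1) (qbox u v 1 m 1 (sy - 1) False True m (sy - 1))"
      using P I' by (intro hamp_qbox) auto
    have 2: "hamp (box 2 m sy sy) (m, sy) (2, sy) (qbox u v 2 m sy sy True False 2 sy)"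
      using P I' by (intro hamp_qbox) auto
    have 3: "hamp (box 1 (m - 1) (sy + 1) (sy + 1)) (m - 1, sy + 1) (1, sy + 1)
       (qbox u v 1 (m - 1) (sy + 1) (sy + 1) True False 1 (sy + 1))"
      using P I' by (intro hamp_qbox) auto
    have 4: "hamp (box 1 m (sy + 2) n) (1, sy + 2) (m, sy + 2) (qbox u v 1 m (sy + 2) n False False m (sy + 2))"
      using P I' by (intro hamp_qbox) auto
    have 5: "hamp (box 1 m 1 n) (1, sy) (m, sy + 1) ([(1, sy)] @ qbox u v 1 m 1 (sy - 1) False True m (sy - 1) @
       qbox u v 2 m sy sy True False 2 sy @
       qbox u v 1 (m - 1) (sy + 1) (sy + 1) True False 1 (sy + 1) @
       qbox u v 1 m (sy + 2) n False False m (sy + 2) @ [(m, sy + 1)])"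
      by (rule hamp_eq[OF hamp_append'[OF hamp_single hamp_append'[OF 1 hamp_append'[OF 2 hamp_append'[OF 3
           hamp_append'[OF 4 hamp_single]]]]]]) (use P I' in auto)
    show ?thesis using diag 5 P by (auto simp: rh_def)
  next
    case knight
    note P = knight(5)[unfolded cknight_def] and I' = I[unfolded inst_def]
    have 1: "hamp (box 1 m 3 n) (1, 3) (m, 3) (qbox u v 1 m 3 n False False m 3)"
      using P I' by (intro hamp_qbox) auto
    have 2: "hamp (box 3 m 1 2) (m, 2) (3, 1) (qbox u v 3 m 1 2 True True 3 1)"
      using P I' by (intro hamp_qbox) auto
    have 3: "hamp {(2, 2), (1, 1), (2, 1)} (2, 2) (2, 1) [(2, 2), (1, 1), (2, 1)]"
      by (auto simp: hamp_def)
    have 4: "hamp (box 1 m 1 n) (1, 2) (2, 1) ([(1, 2)] @ qbox u v 1 m 3 n False False m 3 @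
       qbox u v 3 m 1 2 True True 3 1 @ [(2, 2), (1, 1), (2, 1)])"
      by (rule hamp_eq[OF hamp_append'[OF hamp_single hamp_append'[OF 1 hamp_append'[OF 2 3]]]]) (use P I' in auto)
    show ?thesis using knight 4 P by (auto simp: rh_def)
  qed
qed

lemma rh_Nil: "\<not> rcond m n sx sy tx ty \<Longrightarrow> rh u v m n sx sy tx ty = []"
  unfolding rcond_def rh_def by auto

section \<open>Closing the list of cases under the symmetries of the rectangle\<close>

type_synonym solver = "int \<Rightarrow> int \<Rightarrow> int \<Rightarrow> int \<Rightarrow> int \<Rightarrow> int \<Rightarrow> int \<Rightarrow> int \<Rightarrow> (int \<times> int) list"

text \<open>Each of the four combinators adds one image of every instance solved so far, so that
  nesting them covers the symmetries of the rectangle and the exchange of end points. The empty list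
  stands for failure, which is unambiguous as a path is never empty.\<close>

definition sym_x :: "solver \<Rightarrow> solver" where
  "sym_x f u v m n sx sy tx ty = (if f u v m n sx sy tx ty \<noteq> [] then f u v m n sx sy tx ty
     else map (\<lambda>(x, y). (m + 1 - x, y)) (f u v m n (m + 1 - sx) sy (m + 1 - tx) ty))"

definition sym_y :: "solver \<Rightarrow> solver" where
  "sym_y f u v m n sx sy tx ty = (if f u v m n sx sy tx ty \<noteq> [] then f u v m n sx sy tx ty
     else map (\<lambda>(x, y). (x, n + 1 - y)) (f u v m n sx (n + 1 - sy) tx (n + 1 - ty)))"

text \<open>The bounds \<open>u\<close> and \<open>v\<close> are exchanged together with the sides,
  so that the transposed rectangle still fits into them.\<close>

definition sym_t :: "solver \<Rightarrow> solver" where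
  "sym_t f u v m n sx sy tx ty = (if f u v m n sx sy tx ty \<noteq> [] then f u v m n sx sy tx ty
     else map prod.swap (f v u n m sy sx ty tx))"

definition sym_r :: "solver \<Rightarrow> solver" where
  "sym_r f u v m n sx sy tx ty = (if f u v m n sx sy tx ty \<noteq> [] then f u v m n sx sy tx ty
     else rev (f u v m n tx ty sx sy))"

text \<open>The second conjunct matters as much as the first: emptiness is what makes the
  combinators try the next image of the instance.\<close>

definition solves :: "solver \<Rightarrow> (int \<Rightarrow> int \<Rightarrow> int \<Rightarrow> int \<Rightarrow> int \<Rightarrow> int \<Rightarrow> bool) \<Rightarrow> bool" where
  "solves f C \<longleftrightarrow> (\<forall>u v m n sx sy tx ty. inst u v m n sx sy tx ty \<longrightarrow>
     (C m n sx sy tx ty \<longrightarrow> hamp (box 1 m 1 n) (sx, sy) (tx, ty) (f u v m n sx sy tx ty)) \<and>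
     (\<not> C m n sx sy tx ty \<longrightarrow> f u v m n sx sy tx ty = []))"

lemma solves_rh: "solves rh rcond"
  unfolding solves_def using rh_sound rh_Nil by blast

lemma solves_orelse:
  assumes "solves f C" "inst u v m n sx sy tx ty"
    "C' \<Longrightarrow> hamp (box 1 m 1 n) (sx, sy) (tx, ty) g" "\<not> C' \<Longrightarrow> g = []"
  shows "(C m n sx sy tx ty \<or> C' \<longrightarrow> hamp (box 1 m 1 n) (sx, sy) (tx, ty)
        (if f u v m n sx sy tx ty \<noteq> [] then f u v m n sx sy tx ty else g)) \<and>
     (\<not> (C m n sx sy tx ty \<or> C') \<longrightarrow> (if f u v m n sx sy tx ty \<noteq> [] then f u v m n sx sy tx ty else g) = [])"
proof (cases "C m n sx sy tx ty")
  case True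
  then have "hamp (box 1 m 1 n) (sx, sy) (tx, ty) (f u v m n sx sy tx ty)"
    using assms(1,2) unfolding solves_def by blast
  then show ?thesis using True hampD(3) by auto
next
  case False
  then have "f u v m n sx sy tx ty = []" using assms(1,2) unfolding solves_def by blast
  then show ?thesis using False assms(3,4) by auto
qed

lemma hamp_reflect_x:
  assumes "hamp (box 1 m 1 n) (a, b) (c, d) p"
  shows "hamp (box 1 m 1 n) (m + 1 - a, b) (m + 1 - c, d) (map (\<lambda>(x, y). (m + 1 - x, y)) p)"
proof -
  let ?g = "\<lambda>(x, y). (m + 1 - x, y)"
  have "hamp (?g ` box 1 m 1 n) (?g (a, b)) (?g (c, d)) (map ?g p)"
    by (rule hamp_map[OF assms]) (auto simp: sg_adj_def inj_def)
  moreover have "(x, y) \<in> ?g ` box 1 m 1 n" if "(x, y) \<in> box 1 m 1 n" for x y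
    using that by (intro image_eqI[of _ _ "(m + 1 - x, y)"]) auto
  then have "?g ` box 1 m 1 n = box 1 m 1 n" by auto
  ultimately show ?thesis by simp
qed

lemma hamp_reflect_y:
  assumes "hamp (box 1 m 1 n) (a, b) (c, d) p"
  shows "hamp (box 1 m 1 n) (a, n + 1 - b) (c, n + 1 - d) (map (\<lambda>(x, y). (x, n + 1 - y)) p)"
proof -
  let ?g = "\<lambda>(x, y). (x, n + 1 - y)"
  have "hamp (?g ` box 1 m 1 n) (?g (a, b)) (?g (c, d)) (map ?g p)"
    by (rule hamp_map[OF assms]) (auto simp: sg_adj_def inj_def)
  moreover have "(x, y) \<in> ?g ` box 1 m 1 n" if "(x, y) \<in> box 1 m 1 n" for x y
    using that by (intro image_eqI[of _ _ "(x, n + 1 - y)"]) auto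
  then have "?g ` box 1 m 1 n = box 1 m 1 n" by auto
  ultimately show ?thesis by simp
qed

lemma solves_sym_x:
  assumes "solves f C"
  shows "solves (sym_x f) (\<lambda>m n sx sy tx ty. C m n sx sy tx ty \<or> C m n (m + 1 - sx) sy (m + 1 - tx) ty)"
  unfolding solves_def sym_x_def
proof (intro allI impI)
  fix u v m n sx sy tx ty assume I: "inst u v m n sx sy tx ty"
  have I': "inst u v m n (m + 1 - sx) sy (m + 1 - tx) ty" using I by (auto simp: inst_def)
  let ?g = "\<lambda>(x, y). (m + 1 - x, y)"
  show "(C m n sx sy tx ty \<or> C m n (m + 1 - sx) sy (m + 1 - tx) ty \<longrightarrow> hamp (box 1 m 1 n) (sx, sy) (tx, ty)
        (if f u v m n sx sy tx ty \<noteq> [] then f u v m n sx sy tx ty else map ?g (f u v m n (m + 1 - sx) sy (m + 1 - tx) ty))) \<and>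
     (\<not> (C m n sx sy tx ty \<or> C m n (m + 1 - sx) sy (m + 1 - tx) ty) \<longrightarrow>
       (if f u v m n sx sy tx ty \<noteq> [] then f u v m n sx sy tx ty else map ?g (f u v m n (m + 1 - sx) sy (m + 1 - tx) ty)) = [])"
  proof (rule solves_orelse[OF assms I])
    assume "C m n (m + 1 - sx) sy (m + 1 - tx) ty"
    then have "hamp (box 1 m 1 n) (m + 1 - sx, sy) (m + 1 - tx, ty) (f u v m n (m + 1 - sx) sy (m + 1 - tx) ty)"
      using assms I' unfolding solves_def by blast
    from hamp_reflect_x[OF this]
    show "hamp (box 1 m 1 n) (sx, sy) (tx, ty) (map ?g (f u v m n (m + 1 - sx) sy (m + 1 - tx) ty))" by simp
  next
    assume "\<not> C m n (m + 1 - sx) sy (m + 1 - tx) ty"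
    then show "map ?g (f u v m n (m + 1 - sx) sy (m + 1 - tx) ty) = []"
      using assms I' unfolding solves_def by simp
  qed
qed

lemma solves_sym_y:
  assumes "solves f C"
  shows "solves (sym_y f) (\<lambda>m n sx sy tx ty. C m n sx sy tx ty \<or> C m n sx (n + 1 - sy) tx (n + 1 - ty))"
  unfolding solves_def sym_y_def
proof (intro allI impI)
  fix u v m n sx sy tx ty assume I: "inst u v m n sx sy tx ty"
  have I': "inst u v m n sx (n + 1 - sy) tx (n + 1 - ty)" using I by (auto simp: inst_def)
  let ?g = "\<lambda>(x, y). (x, n + 1 - y)"
  show "(C m n sx sy tx ty \<or> C m n sx (n + 1 - sy) tx (n + 1 - ty) \<longrightarrow> hamp (box 1 m 1 n) (sx, sy) (tx, ty)
        (if f u v m n sx sy tx ty \<noteq> [] then f u v m n sx sy tx ty else map ?g (f u v m n sx (n + 1 - sy) tx (n + 1 - ty)))) \<and>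
     (\<not> (C m n sx sy tx ty \<or> C m n sx (n + 1 - sy) tx (n + 1 - ty)) \<longrightarrow>
       (if f u v m n sx sy tx ty \<noteq> [] then f u v m n sx sy tx ty else map ?g (f u v m n sx (n + 1 - sy) tx (n + 1 - ty))) = [])"
  proof (rule solves_orelse[OF assms I])
    assume "C m n sx (n + 1 - sy) tx (n + 1 - ty)"
    then have "hamp (box 1 m 1 n) (sx, n + 1 - sy) (tx, n + 1 - ty) (f u v m n sx (n + 1 - sy) tx (n + 1 - ty))"
      using assms I' unfolding solves_def by blast
    from hamp_reflect_y[OF this]
    show "hamp (box 1 m 1 n) (sx, sy) (tx, ty) (map ?g (f u v m n sx (n + 1 - sy) tx (n + 1 - ty)))" by simp
  next
    assume "\<not> C m n sx (n + 1 - sy) tx (n + 1 - ty)"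
    then show "map ?g (f u v m n sx (n + 1 - sy) tx (n + 1 - ty)) = []"
      using assms I' unfolding solves_def by simp
  qed
qed

lemma solves_sym_t:
  assumes "solves f C"
  shows "solves (sym_t f) (\<lambda>m n sx sy tx ty. C m n sx sy tx ty \<or> C n m sy sx ty tx)"
  unfolding solves_def sym_t_def
proof (intro allI impI)
  fix u v m n sx sy tx ty assume I: "inst u v m n sx sy tx ty"
  have I': "inst v u n m sy sx ty tx" using I by (auto simp: inst_def)
  show "(C m n sx sy tx ty \<or> C n m sy sx ty tx \<longrightarrow> hamp (box 1 m 1 n) (sx, sy) (tx, ty)
        (if f u v m n sx sy tx ty \<noteq> [] then f u v m n sx sy tx ty else map prod.swap (f v u n m sy sx ty tx))) \<and>
     (\<not> (C m n sx sy tx ty \<or> C n m sy sx ty tx) \<longrightarrow>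
       (if f u v m n sx sy tx ty \<noteq> [] then f u v m n sx sy tx ty else map prod.swap (f v u n m sy sx ty tx)) = [])"
  proof (rule solves_orelse[OF assms I])
    assume "C n m sy sx ty tx"
    then have "hamp (box 1 n 1 m) (sy, sx) (ty, tx) (f v u n m sy sx ty tx)"
      using assms I' unfolding solves_def by blast
    from hamp_swap[OF this]
    show "hamp (box 1 m 1 n) (sx, sy) (tx, ty) (map prod.swap (f v u n m sy sx ty tx))"
      by (simp add: product_swap)
  next
    assume "\<not> C n m sy sx ty tx"
    then show "map prod.swap (f v u n m sy sx ty tx) = []"
      using assms I' unfolding solves_def by simp
  qed
qed

lemma solves_sym_r:
  assumes "solves f C"
  shows "solves (sym_r f) (\<lambda>m n sx sy tx ty. C m n sx sy tx ty \<or> C m n tx ty sx sy)"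
  unfolding solves_def sym_r_def
proof (intro allI impI)
  fix u v m n sx sy tx ty assume I: "inst u v m n sx sy tx ty"
  have I': "inst u v m n tx ty sx sy" using I by (auto simp: inst_def)
  show "(C m n sx sy tx ty \<or> C m n tx ty sx sy \<longrightarrow> hamp (box 1 m 1 n) (sx, sy) (tx, ty)
        (if f u v m n sx sy tx ty \<noteq> [] then f u v m n sx sy tx ty else rev (f u v m n tx ty sx sy))) \<and>
     (\<not> (C m n sx sy tx ty \<or> C m n tx ty sx sy) \<longrightarrow>
       (if f u v m n sx sy tx ty \<noteq> [] then f u v m n sx sy tx ty else rev (f u v m n tx ty sx sy)) = [])"
  proof (rule solves_orelse[OF assms I])
    assume "C m n tx ty sx sy"
    then show "hamp (box 1 m 1 n) (sx, sy) (tx, ty) (rev (f u v m n tx ty sx sy))"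
      using assms I' hamp_rev unfolding solves_def by blast
  next
    assume "\<not> C m n tx ty sx sy"
    then show "rev (f u v m n tx ty sx sy) = []"
      using assms I' unfolding solves_def by simp
  qed
qed

definition rpath :: solver where
  "rpath = sym_r (sym_t (sym_x (sym_y rh)))"

definition noncut :: "int \<Rightarrow> int \<Rightarrow> int \<Rightarrow> int \<Rightarrow> int \<Rightarrow> int \<Rightarrow> bool" where
  "noncut m n sx sy tx ty \<longleftrightarrow> \<not> (n = 2 \<and> sx = tx \<and> 1 < sx \<and> sx < m) \<and> \<not> (m = 2 \<and> sy = ty \<and> 1 < sy \<and> sy < n)"

text \<open>The sixteen images of \<open>rcond\<close> are spelled out. That they cover all
  instances other than the cut pairs is then a statement about linear inequalities, decided by the
  solver.\<close>

lemma rcond_complete: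
  assumes "inst u v m n sx sy tx ty" "noncut m n sx sy tx ty"
  defines "C4 \<equiv> \<lambda>m n sx sy tx ty. rcond m n sx sy tx ty \<or> rcond m n sx (n + 1 - sy) tx (n + 1 - ty) \<or>
      rcond m n (m + 1 - sx) sy (m + 1 - tx) ty \<or> rcond m n (m + 1 - sx) (n + 1 - sy) (m + 1 - tx) (n + 1 - ty)"
  shows "C4 m n sx sy tx ty \<or> C4 n m sy sx ty tx \<or> C4 m n tx ty sx sy \<or> C4 n m ty tx sy sx"
  using assms unfolding C4_def inst_def noncut_def rcond_def csplit_def cpair_def cacross_def cdiag_def cknight_def
  by (smt (z3))

lemma hamp_rpath:
  assumes "inst u v m n sx sy tx ty" "noncut m n sx sy tx ty"
  shows "hamp (box 1 m 1 n) (sx, sy) (tx, ty) (rpath u v m n sx sy tx ty)"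
proof -
  note S = solves_sym_r[OF solves_sym_t[OF solves_sym_x[OF solves_sym_y[OF solves_rh]]]]
  show ?thesis
    using S[unfolded solves_def, rule_format, OF assms(1)] rcond_complete[OF assms]
    unfolding rpath_def by blast
qed

section \<open>Rectangles in arbitrary position, including single rows and columns\<close>

definition gp :: "int \<Rightarrow> int \<Rightarrow> int \<Rightarrow> int \<Rightarrow> int \<Rightarrow> int \<Rightarrow> int \<Rightarrow> int \<Rightarrow> int \<Rightarrow> int \<Rightarrow> (int \<times> int) list" where
  "gp u v x1 x2 y1 y2 sx sy tx ty =
    (if x1 = x2 \<or> y1 = y2 then
       if sx = x1 \<and> sy = y1 then qbox u v x1 x2 y1 y2 False False tx ty else qbox u v x1 x2 y1 y2 True True tx ty
     else map (\<lambda>(x, y). (x1 - 1 + x, y1 - 1 + y))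
       (rpath u v (x2 - x1 + 1) (y2 - y1 + 1) (sx - x1 + 1) (sy - y1 + 1) (tx - x1 + 1) (ty - y1 + 1)))"

definition gok :: "int \<Rightarrow> int \<Rightarrow> int \<Rightarrow> int \<Rightarrow> int \<Rightarrow> int \<Rightarrow> int \<Rightarrow> int \<Rightarrow> bool" where
  "gok x1 x2 y1 y2 sx sy tx ty \<longleftrightarrow> x1 \<le> sx \<and> sx \<le> x2 \<and> y1 \<le> sy \<and> sy \<le> y2 \<and>
     x1 \<le> tx \<and> tx \<le> x2 \<and> y1 \<le> ty \<and> ty \<le> y2 \<and>
     (x1 = x2 \<and> (sy = y1 \<and> ty = y2 \<or> sy = y2 \<and> ty = y1) \<or>
      x1 < x2 \<and> y1 = y2 \<and> (sx = x1 \<and> tx = x2 \<or> sx = x2 \<and> tx = x1) \<or>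
      x1 < x2 \<and> y1 < y2 \<and> (sx \<noteq> tx \<or> sy \<noteq> ty) \<and> \<not> (y2 = y1 + 1 \<and> sx = tx \<and> x1 < sx \<and> sx < x2) \<and>
        \<not> (x2 = x1 + 1 \<and> sy = ty \<and> y1 < sy \<and> sy < y2))"

lemma hamp_gp:
  assumes "gok x1 x2 y1 y2 sx sy tx ty" "x2 - x1 + 1 \<le> u" "y2 - y1 + 1 \<le> v"
  shows "hamp (box x1 x2 y1 y2) (sx, sy) (tx, ty) (gp u v x1 x2 y1 y2 sx sy tx ty)"
proof (cases "x1 = x2 \<or> y1 = y2")
  case True
  show ?thesis
  proof (cases "sx = x1 \<and> sy = y1")
    case c: True
    have "hamp (box x1 x2 y1 y2) (x1, y1) (tx, ty) (qbox u v x1 x2 y1 y2 False False tx ty)"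
      using assms True c unfolding gok_def by (intro hamp_qbox) auto
    then show ?thesis using c True by (simp add: gp_def)
  next
    case c: False
    then have e: "sx = x2" "sy = y2" using assms(1) True unfolding gok_def by auto
    have "hamp (box x1 x2 y1 y2) (x2, y2) (tx, ty) (qbox u v x1 x2 y1 y2 True True tx ty)"
      using assms True c e unfolding gok_def by (intro hamp_qbox) auto
    then show ?thesis using c True e by (auto simp: gp_def)
  qed
next
  case False
  let ?r = "rpath u v (x2 - x1 + 1) (y2 - y1 + 1) (sx - x1 + 1) (sy - y1 + 1) (tx - x1 + 1) (ty - y1 + 1)"
  let ?g = "\<lambda>(x, y). (x1 - 1 + x, y1 - 1 + y)"
  have "hamp (box 1 (x2 - x1 + 1) 1 (y2 - y1 + 1)) (sx - x1 + 1, sy - y1 + 1) (tx - x1 + 1, ty - y1 + 1) ?r"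
  proof (rule hamp_rpath)
    have F: "x1 \<le> sx \<and> sx \<le> x2 \<and> y1 \<le> sy \<and> sy \<le> y2 \<and> x1 \<le> tx \<and> tx \<le> x2 \<and> y1 \<le> ty \<and> ty \<le> y2 \<and>
      x1 < x2 \<and> y1 < y2" "sx \<noteq> tx \<or> sy \<noteq> ty" "\<not> (y2 = y1 + 1 \<and> sx = tx \<and> x1 < sx \<and> sx < x2)"
      "\<not> (x2 = x1 + 1 \<and> sy = ty \<and> y1 < sy \<and> sy < y2)"
      using assms(1) False unfolding gok_def by blast+
    show "inst u v (x2 - x1 + 1) (y2 - y1 + 1) (sx - x1 + 1) (sy - y1 + 1) (tx - x1 + 1) (ty - y1 + 1)"
      using F(1,2) assms(2,3) unfolding inst_def by linarith
    show "noncut (x2 - x1 + 1) (y2 - y1 + 1) (sx - x1 + 1) (sy - y1 + 1) (tx - x1 + 1) (ty - y1 + 1)"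
      using F(3,4) unfolding noncut_def by (smt (verit))
  qed
  then have "hamp (?g ` box 1 (x2 - x1 + 1) 1 (y2 - y1 + 1)) (?g (sx - x1 + 1, sy - y1 + 1)) (?g (tx - x1 + 1, ty - y1 + 1)) (map ?g ?r)"
    by (rule hamp_map) (auto simp: sg_adj_def inj_def)
  moreover have "(x, y) \<in> ?g ` box 1 (x2 - x1 + 1) 1 (y2 - y1 + 1)" if "(x, y) \<in> box x1 x2 y1 y2" for x y
    using that by (intro image_eqI[of _ _ "(x - x1 + 1, y - y1 + 1)"]) auto
  then have "?g ` box 1 (x2 - x1 + 1) 1 (y2 - y1 + 1) = box x1 x2 y1 y2" by auto
  ultimately show ?thesis using False by (simp add: gp_def)
qed

subsection \<open>Computability\<close>

lemma computable_Cons: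
  assumes "lin 8 e" "lin 8 f" "computable g"
  shows "computable (\<lambda>\<sigma>. (e \<sigma>, f \<sigma>) # g \<sigma>)"
  using computable_append[OF computable_point[OF assms(1,2)] assms(3)] by simp

lemmas computable_intros = computable_if computable_nonempty computable_append computable_rev computable_Cons
  computable_Nil computable_qbox cond_and cond_or cond_not cond_eq cond_le cond_less

lemmas lin_simple = lin_const lin_add lin_minus

definition csolver :: "solver \<Rightarrow> bool" where
  "csolver f \<longleftrightarrow> (\<forall>u v m n sx sy tx ty. budget u v \<longrightarrow> lin 8 m \<longrightarrow> lin 8 n \<longrightarrow> lin 8 sx \<longrightarrow> lin 8 sy \<longrightarrow>
     lin 8 tx \<longrightarrow> lin 8 ty \<longrightarrow>
     computable (\<lambda>\<sigma>. f (u \<sigma>) (v \<sigma>) (m \<sigma>) (n \<sigma>) (sx \<sigma>) (sy \<sigma>) (tx \<sigma>) (ty \<sigma>)))"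

lemma budget_swap: "budget u v \<Longrightarrow> budget v u"
  by (simp add: budget_def mult.commute)

lemma csolver_rh: "csolver rh"
proof -
  have "computable (\<lambda>\<sigma>. rh (u \<sigma>) (v \<sigma>) (m \<sigma>) (n \<sigma>) (sx \<sigma>) (sy \<sigma>) (tx \<sigma>) (ty \<sigma>))"
    if A: "budget u v" "lin 8 m" "lin 8 n" "lin 8 sx" "lin 8 sy" "lin 8 tx" "lin 8 ty" for u v m n sx sy tx ty
    unfolding rh_def rsplit_def csplit_def cpair_def cacross_def cdiag_def cknight_def
    by (intro computable_intros A; intro lin_simple A)
  then show ?thesis by (simp add: csolver_def)
qed

lemma csolverD:
  "csolver f \<Longrightarrow> budget u v \<Longrightarrow> lin 8 m \<Longrightarrow> lin 8 n \<Longrightarrow> lin 8 sx \<Longrightarrow> lin 8 sy \<Longrightarrow> lin 8 tx \<Longrightarrow> lin 8 ty \<Longrightarrow>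
   computable (\<lambda>\<sigma>. f (u \<sigma>) (v \<sigma>) (m \<sigma>) (n \<sigma>) (sx \<sigma>) (sy \<sigma>) (tx \<sigma>) (ty \<sigma>))"
  by (simp add: csolver_def)

lemma csolver_sym_x: "csolver f \<Longrightarrow> csolver (sym_x f)"
  unfolding csolver_def[of "sym_x f"] sym_x_def
  by (intro allI impI computable_nonempty computable_reflect_x csolverD[of f] lin_const lin_add lin_minus)

lemma csolver_sym_y: "csolver f \<Longrightarrow> csolver (sym_y f)"
  unfolding csolver_def[of "sym_y f"] sym_y_def
  by (intro allI impI computable_nonempty computable_reflect_y csolverD[of f] lin_const lin_add lin_minus)

lemma csolver_sym_t: "csolver f \<Longrightarrow> csolver (sym_t f)"
  unfolding csolver_def[of "sym_t f"] sym_t_def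
  by (intro allI impI computable_nonempty computable_swap csolverD[of f]; (assumption | erule budget_swap))

lemma csolver_sym_r: "csolver f \<Longrightarrow> csolver (sym_r f)"
  unfolding csolver_def[of "sym_r f"] sym_r_def
  by (intro allI impI computable_nonempty computable_rev csolverD[of f])

lemma csolver_rpath: "csolver rpath"
  unfolding rpath_def by (intro csolver_sym_r csolver_sym_t csolver_sym_x csolver_sym_y csolver_rh)

lemma computable_gp:
  assumes "budget u v" "lin 8 x1" "lin 8 x2" "lin 8 y1" "lin 8 y2" "lin 8 sx" "lin 8 sy" "lin 8 tx" "lin 8 ty"
  shows "computable (\<lambda>\<sigma>. gp (u \<sigma>) (v \<sigma>) (x1 \<sigma>) (x2 \<sigma>) (y1 \<sigma>) (y2 \<sigma>) (sx \<sigma>) (sy \<sigma>) (tx \<sigma>) (ty \<sigma>))"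
proof -
  have "computable (\<lambda>\<sigma>. map (\<lambda>(x, y). (x1 \<sigma> - 1 + x, y1 \<sigma> - 1 + y)) (rpath (u \<sigma>) (v \<sigma>) (x2 \<sigma> - x1 \<sigma> + 1)
     (y2 \<sigma> - y1 \<sigma> + 1) (sx \<sigma> - x1 \<sigma> + 1) (sy \<sigma> - y1 \<sigma> + 1) (tx \<sigma> - x1 \<sigma> + 1) (ty \<sigma> - y1 \<sigma> + 1)))"
    by (rule computable_shift[OF csolverD[OF csolver_rpath]]; intro lin_simple assms)
  then show ?thesis unfolding gp_def by (intro computable_intros assms)
qed

section \<open>Deleting a corner and inserting a path at a corner\<close>

lemma before_append: "v \<notin> set A \<Longrightarrow> before v (A @ v # B) = A"
  by (induction A) auto

lemma after_append: "v \<notin> set A \<Longrightarrow> after v (A @ v # B) = B"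
  by (induction A) auto

definition del :: "'a \<Rightarrow> 'a list \<Rightarrow> 'a list" where
  "del c p = before c p @ after c p"

text \<open>If the neighbours of \<open>c\<close> are pairwise adjacent, as for a corner of a
  rectangle, the predecessor and the successor of \<open>c\<close> on the path can be joined
  directly.\<close>

lemma hamp_del:
  assumes h: "hamp X s t p" and c: "c \<in> X" "c \<noteq> s" "c \<noteq> t"
    and clique: "\<And>u v. u \<in> X \<Longrightarrow> v \<in> X \<Longrightarrow> sg_adj u c \<Longrightarrow> sg_adj v c \<Longrightarrow> u \<noteq> v \<Longrightarrow> sg_adj u v"
  shows "hamp (X - {c}) s t (del c p)"
proof -
  have "c \<in> set p" using h c by (simp add: hamp_def)
  then obtain A B where p: "p = A @ c # B" by (meson split_list)
  have d: "distinct (A @ c # B)" using h p by (simp add: hamp_def)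
  have A: "A \<noteq> []" and B: "B \<noteq> []" using h c p by (auto simp: hamp_def)
  have e: "del c p = A @ B" using d by (simp add: del_def p before_append after_append)
  have s: "successively sg_adj A" "successively sg_adj B" "sg_adj (last A) c" "sg_adj c (hd B)"
    using h A B by (auto simp: hamp_def p successively_append_iff successively_Cons)
  have "last A \<in> set A" "hd B \<in> set B" using A B by auto
  then have "last A \<in> X" "hd B \<in> X" "last A \<noteq> hd B" using h d by (auto simp: hamp_def p)
  then have "sg_adj (last A) (hd B)" using clique s sg_adj_sym by blast
  then show ?thesis using h d A B s e by (auto simp: hamp_def p successively_append_iff)
qed

text \<open>For \<open>P\<close> of the form A, \<open>p\<close>, C, \<open>q\<close>, E the cases
  are: C is empty, C has at least two elements, C has exactly one. They are phrased as comparisons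
  with the one-element list \<open>[p]\<close>, the form accepted by \<open>computable_less\<close>.
  A single vertex C is moved in front of \<open>p\<close>; otherwise \<open>q\<close> is moved next
  to \<open>p\<close>.\<close>

definition ins1 :: "'a \<Rightarrow> 'a \<Rightarrow> 'a list \<Rightarrow> 'a list \<Rightarrow> 'a list" where
  "ins1 p q W P =
    (if length (before q (after p P)) < length [p] then before p P @ [p] @ W @ [q] @ before q (after p P) @ after q (after p P)
     else if length [p] < length (before q (after p P))
     then before p P @ [p] @ W @ [q] @ before q (after p P) @ after q (after p P)
     else before p P @ before q (after p P) @ [p] @ W @ [q] @ after q (after p P))"

text \<open>The test holds iff \<open>q\<close> comes before \<open>p\<close>. In that case the
  reversed path is treated; \<open>W\<close> keeps its direction there, as it still leads from
  \<open>p\<close> to \<open>q\<close>.\<close>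

definition ins :: "'a \<Rightarrow> 'a \<Rightarrow> 'a list \<Rightarrow> 'a list \<Rightarrow> 'a list" where
  "ins p q W P = (if length (before q (before p P)) < length (before p P) then rev (ins1 p q W (rev P)) else ins1 p q W P)"

text \<open>The vertex \<open>p\<close> is a corner, with neighbours \<open>q\<close>, \<open>u\<close>, \<open>v\<close>. If \<open>p\<close> and \<open>q\<close> are not consecutive
  on the path, then \<open>p\<close> lies between \<open>u\<close> and \<open>v\<close>; as these are adjacent to each other and
  to \<open>q\<close>, \<open>q\<close> can be moved next to \<open>p\<close>.\<close>

lemma hamp_ins1:
  assumes h: "hamp X s t (A @ p # C @ q # E)" and st: "p \<noteq> s" "q \<noteq> t"
    and Np: "\<And>z. z \<in> X \<Longrightarrow> sg_adj p z \<Longrightarrow> z \<in> {q, u, v}" and uv: "sg_adj u v" "sg_adj q u" "sg_adj q v"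
    and Nq: "\<And>z z'. z \<in> X \<Longrightarrow> z' \<in> X \<Longrightarrow> sg_adj q z \<Longrightarrow> sg_adj q z' \<Longrightarrow> z \<noteq> z' \<Longrightarrow>
       {z, z'} \<inter> {p, u, v} = {} \<Longrightarrow> sg_adj z z'"
    and W: "hamp Y w1 w2 W" "X \<inter> Y = {}" "sg_adj p w1" "sg_adj w2 q"
  shows "hamp (X \<union> Y) s t (ins1 p q W (A @ p # C @ q # E))"
proof -
  have d: "distinct (A @ p # C @ q # E)" "set (A @ p # C @ q # E) = X" using h by (auto simp: hamp_def)
  have A: "A \<noteq> []" and E: "E \<noteq> []" using h st by (auto simp: hamp_def)
  have i: "ins1 p q W (A @ p # C @ q # E) = (if length C = 1 then A @ C @ [p] @ W @ [q] @ E else A @ [p] @ W @ [q] @ C @ E)"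
  proof -
    have b: "before p (A @ p # C @ q # E) = A" "after p (A @ p # C @ q # E) = C @ q # E"
      "before q (C @ q # E) = C" "after q (C @ q # E) = E"
      using d(1) by (simp_all add: before_append after_append)
    show ?thesis unfolding ins1_def b by (cases C; cases "tl C") simp_all
  qed
  have su: "successively sg_adj A" "successively sg_adj C" "successively sg_adj E" "sg_adj (last A) p" "sg_adj q (hd E)"
    "C = [] \<Longrightarrow> sg_adj p q" "C \<noteq> [] \<Longrightarrow> sg_adj p (hd C) \<and> sg_adj (last C) q"
    using h A E by (auto simp: hamp_def successively_append_iff successively_Cons)
  have hd: "hd A = s" "last E = t" using h A E by (auto simp: hamp_def)
  have lA: "last A \<in> set A" and hE: "hd E \<in> set E" using A E by auto
  have Wd: "W \<noteq> []" "hd W = w1" "last W = w2" "distinct W" "set W = Y" "successively sg_adj W"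
    using W(1) by (auto simp: hamp_def)
  have lA2: "last A \<in> {u, v}"
  proof -
    have "last A \<in> X" "last A \<noteq> q" using lA d by auto
    then show ?thesis using Np[of "last A"] su(4) sg_adj_sym by blast
  qed
  show ?thesis
  proof (cases "C = []")
    case True
    then show ?thesis unfolding i using d A E W Wd su hd
      by (auto simp: hamp_def successively_append_iff successively_Cons)
  next
    case False
    have hC: "hd C \<in> set C" "last C \<in> set C" using False by auto
    have hC2: "hd C \<in> {u, v}"
    proof -
      have "hd C \<in> X" "hd C \<noteq> q" using hC d by auto
      then show ?thesis using Np[of "hd C"] su(7)[OF False] by blast
    qed
    have ne: "hd C \<noteq> last A" using hC lA d by auto
    show ?thesis
    proof (cases "length C = 1")
      case True
      then obtain z where z: "C = [z]" by (metis One_nat_def length_0_conv length_Suc_conv)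
      have "sg_adj (last A) z" using lA2 hC2 ne uv(1) sg_adj_sym[of u v] z by auto
      moreover have "sg_adj z p" using su(7)[OF False] sg_adj_sym[of p z] z by auto
      ultimately show ?thesis unfolding i using d A E W Wd su hd z
        by (auto simp: hamp_def successively_append_iff successively_Cons)
    next
      case l: False
      have "last C \<noteq> hd C"
      proof
        assume e: "last C = hd C"
        obtain z C' where "C = z # C'" using False by (cases C) auto
        moreover then have "C' \<noteq> []" using l by auto
        ultimately show False using e d(1) by auto
      qed
      \<comment> \<open>\<open>last A\<close> and \<open>hd C\<close> are \<open>u\<close> and
        \<open>v\<close> in some order. So the other neighbours \<open>last C\<close> and
        \<open>hd E\<close> of \<open>q\<close> are none of \<open>p\<close>, \<open>u\<close>,
        \<open>v\<close>, as \<open>Nq\<close> requires.\<close>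
      then have c1: "last C \<notin> {p, u, v}" using hC2 lA2 ne hC lA d(1) by auto
      have c2: "hd E \<notin> {p, u, v}" using hC2 lA2 ne hC lA hE d(1) by auto
      have "last C \<noteq> hd E" using hC hE d(1) by auto
      then have "sg_adj (last C) (hd E)"
        using Nq[of "last C" "hd E"] c1 c2 su(5) su(7)[OF False] sg_adj_sym[of "last C" q] hC hE d(2) by auto
      moreover have "sg_adj q (hd C)" using hC2 uv by auto
      ultimately show ?thesis unfolding i using d A E W Wd su hd False l
        by (auto simp: hamp_def successively_append_iff successively_Cons)
    qed
  qed
qed

lemma hamp_ins:
  assumes h: "hamp X s t P" and st: "p \<in> X" "q \<in> X" "p \<noteq> q" "p \<noteq> s" "q \<noteq> s" "p \<noteq> t" "q \<noteq> t"
    and Np: "\<And>z. z \<in> X \<Longrightarrow> sg_adj p z \<Longrightarrow> z \<in> {q, u, v}" and uv: "sg_adj u v" "sg_adj q u" "sg_adj q v"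
    and Nq: "\<And>z z'. z \<in> X \<Longrightarrow> z' \<in> X \<Longrightarrow> sg_adj q z \<Longrightarrow> sg_adj q z' \<Longrightarrow> z \<noteq> z' \<Longrightarrow>
       {z, z'} \<inter> {p, u, v} = {} \<Longrightarrow> sg_adj z z'"
    and W: "hamp Y w1 w2 W" "X \<inter> Y = {}" "sg_adj p w1" "sg_adj w2 q"
  shows "hamp (X \<union> Y) s t (ins p q W P)"
proof -
  have "p \<in> set P" "q \<in> set P" using h st by (auto simp: hamp_def)
  then obtain A B where P: "P = A @ p # B" by (meson split_list)
  have d: "distinct P" using h by (simp add: hamp_def)
  show ?thesis
  proof (cases "q \<in> set A")
    case True
    then obtain A1 C where A: "A = A1 @ q # C" by (meson split_list)
    have b: "before p P = A" using d P by (simp add: before_append)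
    have "before q A = A1" using d P A by (simp add: before_append)
    then have i: "ins p q W P = rev (ins1 p q W (rev P))" using b A by (simp add: ins_def)
    have r: "rev P = rev B @ p # rev C @ q # rev A1" by (simp add: P A)
    have "hamp X t s (rev B @ p # rev C @ q # rev A1)" using hamp_rev[OF h] r by simp
    then have "hamp (X \<union> Y) t s (ins1 p q W (rev B @ p # rev C @ q # rev A1))"
      by (rule hamp_ins1[where u = u and v = v]) (use st Np uv Nq W in blast)+
    then show ?thesis unfolding i r by (rule hamp_rev)
  next
    case False
    then have "q \<in> set B" using \<open>q \<in> set P\<close> P st(3) by auto
    then obtain C E where B: "B = C @ q # E" by (meson split_list)
    have b: "before p P = A" using d P by (simp add: before_append)
    have "before q A = A" using False by (auto simp: takeWhile_eq_all_conv)
    then have i: "ins p q W P = ins1 p q W P" unfolding ins_def b by (simp only: less_irrefl if_False)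
    have "hamp X s t (A @ p # C @ q # E)" using h P B by simp
    then have "hamp (X \<union> Y) s t (ins1 p q W (A @ p # C @ q # E))"
      by (rule hamp_ins1[where u = u and v = v]) (use st Np uv Nq W in blast)+
    moreover have "P = A @ p # C @ q # E" using P B by simp
    ultimately show ?thesis using i by (simp only:)
  qed
qed

lemma computable_del:
  assumes "computable f" "lin 8 a" "lin 8 b"
  shows "computable (\<lambda>\<sigma>. del (a \<sigma>, b \<sigma>) (f \<sigma>))"
  unfolding del_def using assms by (intro computable_append computable_before computable_after)

lemma computable_ins:
  assumes "computable f" "computable g" "lin 8 a" "lin 8 b" "lin 8 c" "lin 8 d"
  shows "computable (\<lambda>\<sigma>. ins (a \<sigma>, b \<sigma>) (c \<sigma>, d \<sigma>) (g \<sigma>) (f \<sigma>))"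
proof -
  have 1: "computable (\<lambda>\<sigma>. ins1 (a \<sigma>, b \<sigma>) (c \<sigma>, d \<sigma>) (g \<sigma>) (h \<sigma>))" if "computable h" for h
    unfolding ins1_def using assms that
    by (intro computable_less computable_append computable_before computable_after computable_Cons computable_Nil)
  show ?thesis
    unfolding ins_def using assms by (intro computable_less 1 computable_before computable_rev)
qed

section \<open>A rectangle with a path attached at its top left corner\<close>

text \<open>The path \<open>W\<close> outside of the rectangle is visited between \<open>(1, b)\<close> and \<open>(2, b)\<close>, which are adjacent to its ends.\<close>

definition attach :: "int \<Rightarrow> int \<Rightarrow> int \<Rightarrow> int \<Rightarrow> (int \<times> int) list \<Rightarrow> int \<Rightarrow> int \<Rightarrow> int \<Rightarrow> int \<Rightarrow> (int \<times> int) list" where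
  "attach u v m b W sx sy tx ty =
    (if sx = 1 \<and> sy = b then [(1, b)] @ W @ del (1, b) (gp u v 1 m 1 b 2 b tx ty)
     else if sx = 2 \<and> sy = b then
       if m = 2 then
         if tx = 1 \<and> ty = b - 1 then [(2, b)] @ rev W @ [(1, b)] @ gp u v 1 2 1 (b - 1) 2 (b - 1) tx ty
         else [(2, b)] @ rev W @ [(1, b)] @ gp u v 1 2 1 (b - 1) 1 (b - 1) tx ty
       else if tx = 1 then
         if ty = b - 1 then [(2, b)] @ rev W @ gp u v 1 1 b b 1 b 1 b @
           del (2, b) (gp u v 2 m 1 b 2 ty 2 1) @ gp u v 1 1 1 ty 1 1 1 ty
         else [(2, b)] @ rev W @ gp u v 1 1 (ty + 1) b 1 b 1 (ty + 1) @
           del (2, b) (gp u v 2 m 1 b 2 (ty + 1) 2 1) @ gp u v 1 1 1 ty 1 1 1 ty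
       else if tx = 2 \<and> ty = 1 then [(2, b)] @ rev W @ gp u v 1 1 1 b 1 b 1 1 @ del (2, b) (gp u v 2 m 1 b 2 2 2 1)
       else [(2, b)] @ rev W @ gp u v 1 1 1 b 1 b 1 1 @ del (2, b) (gp u v 2 m 1 b 2 1 tx ty)
     else ins (1, b) (2, b) W (gp u v 1 m 1 b sx sy tx ty))"

text \<open>Apart from the end points \<open>(1, b)\<close> and \<open>(2, b)\<close> together and
  from cut pairs, the excluded positions have \<open>b = 2\<close> and \<open>3 \<le> m\<close>:
  column 2 then has only two vertices, too few to visit \<open>W\<close> and the columns on both
  sides. The last line leaves a \<open>t\<close> at \<open>(1, b)\<close> or \<open>(2, b)\<close>
  to the exchange of end points.\<close>

definition att_ok :: "int \<Rightarrow> int \<Rightarrow> int \<Rightarrow> int \<Rightarrow> int \<Rightarrow> int \<Rightarrow> bool" where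
  "att_ok m b sx sy tx ty \<longleftrightarrow>
     (if sx = 1 \<and> sy = b then \<not> (tx = 2 \<and> ty = b) \<and> \<not> (b = 2 \<and> tx = 2 \<and> 3 \<le> m)
      else if sx = 2 \<and> sy = b then \<not> (tx = 1 \<and> ty = b) \<and> (b = 2 \<longrightarrow> m = 2 \<or> \<not> (ty = 1 \<and> tx \<le> 2))
      else \<not> (ty = b \<and> tx \<le> 2) \<and> noncut m b sx sy tx ty)"

text \<open>If neither end point is \<open>(1, b)\<close> or \<open>(2, b)\<close>, \<open>W\<close>
  is inserted into a Hamiltonian path of the rectangle. If \<open>s\<close> is one of them, the path
  starts with \<open>s\<close> and \<open>W\<close>. What then remains is a rectangle, or is
  obtained by deleting an already visited corner from a path of a rectangle, possibly with pieces of
  the first column split off.\<close>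

lemma hamp_attach:
  assumes mb: "2 \<le> m" "2 \<le> b" "m \<le> u" "b \<le> v"
    and s: "1 \<le> sx" "sx \<le> m" "1 \<le> sy" "sy \<le> b" and t: "1 \<le> tx" "tx \<le> m" "1 \<le> ty" "ty \<le> b"
    and ne: "sx \<noteq> tx \<or> sy \<noteq> ty" and ok: "att_ok m b sx sy tx ty"
    and W: "hamp Y w1 w2 W" "box 1 m 1 b \<inter> Y = {}" "sg_adj (1, b) w1" "sg_adj w2 (2, b)"
  shows "hamp (box 1 m 1 b \<union> Y) (sx, sy) (tx, ty) (attach u v m b W sx sy tx ty)"
proof -
  have corner: "hamp (box x1 m 1 b - {(x1, b)}) c d (del (x1, b) p)"
    if "hamp (box x1 m 1 b) c d p" "(x1, b) \<noteq> c" "(x1, b) \<noteq> d" "x1 \<le> m" for x1 c d p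
    using that mb by (intro hamp_del) auto
  have W2: "(x, y) \<notin> Y" if "1 \<le> x" "x \<le> m" "1 \<le> y" "y \<le> b" for x y
  proof -
    have "(x, y) \<in> box 1 m 1 b" using that by simp
    then show ?thesis using W(2) by blast
  qed
  consider (P) "sx = 1" "sy = b" | (Q) "sx = 2" "sy = b" | (I) "\<not> (sx = 1 \<and> sy = b)" "\<not> (sx = 2 \<and> sy = b)" by blast
  then show ?thesis
  proof cases
    case P
    have "hamp (box 1 m 1 b) (2, b) (tx, ty) (gp u v 1 m 1 b 2 b tx ty)"
      using ok P mb t ne by (intro hamp_gp) (auto simp: gok_def att_ok_def)
    then have 1: "hamp (box 1 m 1 b - {(1, b)}) (2, b) (tx, ty) (del (1, b) (gp u v 1 m 1 b 2 b tx ty))"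
      using P ne mb by (intro corner) auto
    have "hamp (box 1 m 1 b \<union> Y) (1, b) (tx, ty) ([(1, b)] @ W @ del (1, b) (gp u v 1 m 1 b 2 b tx ty))"
      by (rule hamp_eq[OF hamp_append'[OF hamp_single hamp_append'[OF W(1) 1 W(4)] W(3)]]) (use mb in \<open>auto simp: W2\<close>)
    then show ?thesis using P by (simp add: attach_def)
  next
    case Q
    have ok': "\<not> (tx = 1 \<and> ty = b)" "b = 2 \<longrightarrow> m = 2 \<or> \<not> (ty = 1 \<and> tx \<le> 2)" using ok Q by (auto simp: att_ok_def)
    note R = hamp_rev[OF W(1)]
    have a: "sg_adj (2, b) w2" "sg_adj w1 (1, b)" using W(3,4) sg_adj_sym by blast+
    show ?thesis
    proof (cases "m = 2")
      case True
      \<comment> \<open>Both vertices of row \<open>b - 1\<close> are adjacent to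
        \<open>(1, b)\<close>; the one that is not \<open>t\<close> is entered. For
        \<open>b = 2\<close> this makes \<open>t\<close> the far end of the single row, as
        required.\<close>
      let ?z = "if tx = 1 \<and> ty = b - 1 then 2 else 1 :: int"
      have 1: "hamp (box 1 2 1 (b - 1)) (?z, b - 1) (tx, ty) (gp u v 1 2 1 (b - 1) ?z (b - 1) tx ty)"
        using ok' Q mb t ne True by (intro hamp_gp) (auto simp: gok_def)
      have "hamp (box 1 m 1 b \<union> Y) (2, b) (tx, ty) ([(2, b)] @ rev W @ [(1, b)] @ gp u v 1 2 1 (b - 1) ?z (b - 1) tx ty)"
        by (rule hamp_eq[OF hamp_append'[OF hamp_single hamp_append'[OF R hamp_append'[OF hamp_single 1] a(2)] a(1)]])
           (use mb True in \<open>auto simp: W2\<close>)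
      then show ?thesis using Q True by (auto simp: attach_def)
    next
      case m: False
      then have m3: "3 \<le> m" using mb by simp
      show ?thesis
      proof (cases "tx = 1")
        case True
        have b3: "3 \<le> b" "ty < b" using ok' True m mb t by auto
        \<comment> \<open>The part of column 1 beyond \<open>t\<close> is visited first, and column
          2 is entered next to its end \<open>(1, ty + 1)\<close>. For \<open>ty = b - 1\<close> the
          vertex \<open>(2, ty + 1)\<close> is \<open>s\<close>, so the diagonal neighbour is taken
          instead.\<close>
        let ?y = "if ty = b - 1 then ty else ty + 1"
        have 1: "hamp (box 1 1 (ty + 1) b) (1, b) (1, ty + 1) (gp u v 1 1 (ty + 1) b 1 b 1 (ty + 1))"
          using mb b3 t by (intro hamp_gp) (auto simp: gok_def)
        have "hamp (box 2 m 1 b) (2, ?y) (2, 1) (gp u v 2 m 1 b 2 ?y 2 1)"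
          using mb b3 t m3 by (intro hamp_gp) (auto simp: gok_def)
        then have 2: "hamp (box 2 m 1 b - {(2, b)}) (2, ?y) (2, 1) (del (2, b) (gp u v 2 m 1 b 2 ?y 2 1))"
          using b3 m3 by (intro corner) auto
        have 3: "hamp (box 1 1 1 ty) (1, 1) (1, ty) (gp u v 1 1 1 ty 1 1 1 ty)"
          using mb b3 t by (intro hamp_gp) (auto simp: gok_def)
        have "hamp (box 1 m 1 b \<union> Y) (2, b) (1, ty) ([(2, b)] @ rev W @ gp u v 1 1 (ty + 1) b 1 b 1 (ty + 1) @
           del (2, b) (gp u v 2 m 1 b 2 ?y 2 1) @ gp u v 1 1 1 ty 1 1 1 ty)"
          by (rule hamp_eq[OF hamp_append'[OF hamp_single hamp_append'[OF R hamp_append'[OF 1 hamp_append'[OF 2 3]] a(2)] a(1)]])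
            (use mb m3 b3 t in \<open>auto simp: W2\<close>)
        then show ?thesis using Q True m by (auto simp: attach_def split: if_splits)
      next
        case x: False
        have 1: "hamp (box 1 1 1 b) (1, b) (1, 1) (gp u v 1 1 1 b 1 b 1 1)"
          using mb by (intro hamp_gp) (auto simp: gok_def)
        \<comment> \<open>Column 1 ends in \<open>(1, 1)\<close>, which is adjacent to both
          \<open>(2, 1)\<close> and \<open>(2, 2)\<close>; the latter is entered if the former is
          \<open>t\<close>.\<close>
        let ?y = "if tx = 2 \<and> ty = 1 then 2 else 1 :: int"
        have b3: "tx = 2 \<Longrightarrow> ty = 1 \<Longrightarrow> 3 \<le> b" using ok' m mb by auto
        have "hamp (box 2 m 1 b) (2, ?y) (tx, ty) (gp u v 2 m 1 b 2 ?y tx ty)"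
          using mb t m3 x b3 by (intro hamp_gp) (auto simp: gok_def)
        then have 2: "hamp (box 2 m 1 b - {(2, b)}) (2, ?y) (tx, ty) (del (2, b) (gp u v 2 m 1 b 2 ?y tx ty))"
          using mb m3 ne Q b3 by (intro corner) auto
        have "hamp (box 1 m 1 b \<union> Y) (2, b) (tx, ty) ([(2, b)] @ rev W @ gp u v 1 1 1 b 1 b 1 1 @
           del (2, b) (gp u v 2 m 1 b 2 ?y tx ty))"
          by (rule hamp_eq[OF hamp_append'[OF hamp_single hamp_append'[OF R hamp_append'[OF 1 2] a(2)] a(1)]])
            (use mb m3 t in \<open>auto simp: W2\<close>)
        then show ?thesis using Q x m by (auto simp: attach_def)
      qed
    qed
  next
    case I
    have ok': "\<not> (ty = b \<and> tx \<le> 2)" "noncut m b sx sy tx ty" using ok I unfolding att_ok_def by auto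
    have g: "hamp (box 1 m 1 b) (sx, sy) (tx, ty) (gp u v 1 m 1 b sx sy tx ty)"
      using ok'(2) mb s t ne by (intro hamp_gp) (auto simp: gok_def noncut_def)
    have "hamp (box 1 m 1 b \<union> Y) (sx, sy) (tx, ty) (ins (1, b) (2, b) W (gp u v 1 m 1 b sx sy tx ty))"
    proof (rule hamp_ins[OF g _ _ _ _ _ _ _ _ _ _ _ _ W, where u = "(1, b - 1)" and v = "(2, b - 1)"])
      fix z assume "z \<in> box 1 m 1 b" "sg_adj (1, b) z"
      then show "z \<in> {(2, b), (1, b - 1), (2, b - 1)}" by (cases z) auto
    next
      fix z z' assume z: "z \<in> box 1 m 1 b" "z' \<in> box 1 m 1 b" "sg_adj (2, b) z" "sg_adj (2, b) z'" "z \<noteq> z'"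
        "{z, z'} \<inter> {(1, b), (1, b - 1), (2, b - 1)} = {}"
      obtain x y x' y' where e: "z = (x, y)" "z' = (x', y')" by force
      note z' = z[unfolded e, simplified]
      have "x = 3" "x' = 3" using z' by (smt (verit))+
      then show "sg_adj z z'" unfolding e sg_adj_Pair using z' by (smt (verit))
    next
      show "(1, b) \<noteq> (sx, sy)" "(2, b) \<noteq> (sx, sy)" using I by blast+
      show "(1, b) \<noteq> (tx, ty)" "(2, b) \<noteq> (tx, ty)" using ok'(1) by auto
    qed (use mb in simp_all)
    then show ?thesis unfolding attach_def if_not_P[OF I(1)] if_not_P[OF I(2)] .
  qed
qed

lemma computable_attach:
  assumes "computable w" "budget u v" "lin 8 m" "lin 8 b" "lin 8 sx" "lin 8 sy" "lin 8 tx" "lin 8 ty"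
  shows "computable (\<lambda>\<sigma>. attach (u \<sigma>) (v \<sigma>) (m \<sigma>) (b \<sigma>) (w \<sigma>) (sx \<sigma>) (sy \<sigma>) (tx \<sigma>) (ty \<sigma>))"
  unfolding attach_def
  by (intro computable_intros computable_gp computable_del computable_ins assms; intro lin_simple assms)

section \<open>Hamiltonian paths of L-shaped graphs with thick arms\<close>

text \<open>The graph is drawn with the notch in the upper right corner and the second coordinate pointing
  upwards: \<open>a\<close> and \<open>b\<close> are the widths of the upward and of the rightward arm, and \<open>l\<close> and \<open>k\<close>
  the lengths by which the arms stick out of the corner block.\<close>

definition LV :: "int \<Rightarrow> int \<Rightarrow> int \<Rightarrow> int \<Rightarrow> (int \<times> int) set" where
  "LV a b k l = box 1 a 1 (b + l) \<union> box 1 (a + k) 1 b"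

definition linst :: "int \<Rightarrow> int \<Rightarrow> int \<Rightarrow> int \<Rightarrow> int \<Rightarrow> int \<Rightarrow> int \<Rightarrow> int \<Rightarrow> bool" where
  "linst a b k l sx sy tx ty \<longleftrightarrow> 1 \<le> a \<and> 1 \<le> b \<and> 1 \<le> k \<and> 1 \<le> l \<and>
     1 \<le> sx \<and> 1 \<le> sy \<and> (sx \<le> a \<and> sy \<le> b + l \<or> sx \<le> a + k \<and> sy \<le> b) \<and>
     1 \<le> tx \<and> 1 \<le> ty \<and> (tx \<le> a \<and> ty \<le> b + l \<or> tx \<le> a + k \<and> ty \<le> b) \<and> (sx \<noteq> tx \<or> sy \<noteq> ty)"

type_synonym lsolver = "int \<Rightarrow> int \<Rightarrow> int \<Rightarrow> int \<Rightarrow> int \<Rightarrow> int \<Rightarrow> int \<Rightarrow> int \<Rightarrow> (int \<times> int) list"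
type_synonym lcond = "int \<Rightarrow> int \<Rightarrow> int \<Rightarrow> int \<Rightarrow> int \<Rightarrow> int \<Rightarrow> int \<Rightarrow> int \<Rightarrow> bool"

definition c_corner :: lcond where
  "c_corner a b k l sx sy tx ty \<longleftrightarrow> 2 \<le> a \<and> 2 \<le> b \<and> k = 1 \<and> l = 1"

definition p_corner :: lsolver where
  "p_corner a b k l sx sy tx ty = del (a + k, b + l) (gp (a + k) (b + l) 1 (a + k) 1 (b + l) sx sy tx ty)"

text \<open>The graph is a rectangle with both sides at least 3 that lacks one corner, and that
  corner can be deleted from a path.\<close>

lemma hamp_corner:
  assumes "linst a b k l sx sy tx ty" "c_corner a b k l sx sy tx ty"
  shows "hamp (LV a b k l) (sx, sy) (tx, ty) (p_corner a b k l sx sy tx ty)"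
proof -
  note A = assms[unfolded linst_def c_corner_def]
  have B: "2 \<le> a" "2 \<le> b" "k = 1" "l = 1" using A by auto
  have S: "1 \<le> sx" "sx \<le> a + k" "1 \<le> sy" "sy \<le> b + l" "1 \<le> tx" "tx \<le> a + k" "1 \<le> ty" "ty \<le> b + l"
    using A by (smt (verit))+
  have ne: "(sx, sy) \<noteq> (a + k, b + l)" "(tx, ty) \<noteq> (a + k, b + l)" unfolding prod.inject using A by (smt (verit))+
  have st: "sx \<noteq> tx \<or> sy \<noteq> ty" using A by blast
  have 1: "hamp (box 1 (a + k) 1 (b + l)) (sx, sy) (tx, ty) (gp (a + k) (b + l) 1 (a + k) 1 (b + l) sx sy tx ty)"
    using B S st by (intro hamp_gp) (auto simp: gok_def)
  have 2: "hamp (box 1 (a + k) 1 (b + l) - {(a + k, b + l)}) (sx, sy) (tx, ty) (p_corner a b k l sx sy tx ty)"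
    unfolding p_corner_def by (rule hamp_del[OF 1]) (use B ne in auto)
  show ?thesis by (rule hamp_eq[OF 2]) (use B in \<open>auto simp: LV_def\<close>)
qed

definition c_split :: lcond where
  "c_split a b k l sx sy tx ty \<longleftrightarrow> 2 \<le> a \<and> 2 \<le> b \<and> 2 \<le> l \<and> b < sy \<and> ty \<le> b \<and> (sx \<noteq> 1 \<or> sy \<noteq> b + 1)"

definition p_split :: lsolver where
  "p_split a b k l sx sy tx ty = gp (a + k) (b + l) 1 a (b + 1) (b + l) sx sy 1 (b + 1) @
     (if tx = 1 \<and> ty = b then gp (a + k) (b + l) 1 (a + k) 1 b 2 b tx ty
      else gp (a + k) (b + l) 1 (a + k) 1 b 1 b tx ty)"

text \<open>\<open>(1, b + 1)\<close> is a corner of the upward arm, which has both sides at least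
  2, so a path from any other \<open>s\<close> can be made to end there. It continues at
  \<open>(1, b)\<close>, or at \<open>(2, b)\<close> if \<open>(1, b)\<close> is
  \<open>t\<close>.\<close>

lemma hamp_split:
  assumes "linst a b k l sx sy tx ty" "c_split a b k l sx sy tx ty"
  shows "hamp (LV a b k l) (sx, sy) (tx, ty) (p_split a b k l sx sy tx ty)"
proof -
  note A = assms[unfolded linst_def c_split_def]
  have B: "2 \<le> a" "2 \<le> b" "1 \<le> k" "2 \<le> l" using A by auto
  have S: "1 \<le> sx" "sx \<le> a" "b < sy" "sy \<le> b + l" "1 \<le> tx" "tx \<le> a + k" "1 \<le> ty" "ty \<le> b" "sx \<noteq> 1 \<or> sy \<noteq> b + 1"
    using A by (linarith | blast)+
  let ?z = "if tx = 1 \<and> ty = b then 2 else 1 :: int"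
  have 1: "hamp (box 1 a (b + 1) (b + l)) (sx, sy) (1, b + 1) (gp (a + k) (b + l) 1 a (b + 1) (b + l) sx sy 1 (b + 1))"
    using B S by (intro hamp_gp) (auto simp: gok_def)
  have 2: "hamp (box 1 (a + k) 1 b) (?z, b) (tx, ty) (gp (a + k) (b + l) 1 (a + k) 1 b ?z b tx ty)"
    using B S by (intro hamp_gp) (auto simp: gok_def)
  have "hamp (LV a b k l) (sx, sy) (tx, ty) (gp (a + k) (b + l) 1 a (b + 1) (b + l) sx sy 1 (b + 1) @
     gp (a + k) (b + l) 1 (a + k) 1 b ?z b tx ty)"
    by (rule hamp_append[OF 1 2]) (use B S in \<open>auto simp: LV_def\<close>)
  then show ?thesis unfolding p_split_def by (auto split: if_splits)
qed

definition c_split' :: lcond where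
  "c_split' a b k l sx sy tx ty \<longleftrightarrow> 2 \<le> a \<and> 2 \<le> b \<and> 2 \<le> l \<and> sx = 1 \<and> sy = b + 1 \<and> ty \<le> b"

definition p_split' :: lsolver where
  "p_split' a b k l sx sy tx ty = gp (a + k) (b + l) 1 a (b + 1) (b + l) 1 (b + 1) a (b + 1) @
     (if tx = a + 1 then gp (a + k) (b + l) 1 (a + k) 1 b a b tx ty
      else gp (a + k) (b + l) 1 (a + k) 1 b (a + 1) b tx ty)"

text \<open>Here \<open>s\<close> occupies the corner used as the exit of the arm above, so the arm
  is left at its other lower corner \<open>(a, b + 1)\<close>.\<close>

lemma hamp_split':
  assumes "linst a b k l sx sy tx ty" "c_split' a b k l sx sy tx ty"
  shows "hamp (LV a b k l) (sx, sy) (tx, ty) (p_split' a b k l sx sy tx ty)"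
proof -
  note A = assms[unfolded linst_def c_split'_def]
  have B: "2 \<le> a" "2 \<le> b" "1 \<le> k" "2 \<le> l" using A by auto
  have S: "1 \<le> sx" "sx \<le> a" "b < sy" "sy \<le> b + l" "1 \<le> tx" "tx \<le> a + k" "1 \<le> ty" "ty \<le> b"
    "sx = 1" "sy = b + 1" using A by linarith+
  \<comment> \<open>The whole column \<open>a + 1\<close> is tested rather than the vertex
    \<open>(a + 1, b)\<close>. For \<open>b = 2\<close> this keeps the entry and \<open>t\<close>
    from forming an inner column.\<close>
  let ?z = "if tx = a + 1 then a else a + 1"
  have 1: "hamp (box 1 a (b + 1) (b + l)) (1, b + 1) (a, b + 1) (gp (a + k) (b + l) 1 a (b + 1) (b + l) 1 (b + 1) a (b + 1))"
    using B S by (intro hamp_gp) (auto simp: gok_def)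
  have 2: "hamp (box 1 (a + k) 1 b) (?z, b) (tx, ty) (gp (a + k) (b + l) 1 (a + k) 1 b ?z b tx ty)"
    using B S by (intro hamp_gp) (auto simp: gok_def)
  have "hamp (LV a b k l) (1, b + 1) (tx, ty) (gp (a + k) (b + l) 1 a (b + 1) (b + l) 1 (b + 1) a (b + 1) @
     gp (a + k) (b + l) 1 (a + k) 1 b ?z b tx ty)"
    by (rule hamp_append[OF 1 2]) (use B S in \<open>auto simp: LV_def\<close>)
  then show ?thesis using S unfolding p_split'_def by (auto split: if_splits)
qed

definition c_attach :: lcond where
  "c_attach a b k l sx sy tx ty \<longleftrightarrow> 2 \<le> a \<and> 2 \<le> b \<and> (2 \<le> l \<or> a \<le> 3) \<and> sy \<le> b \<and> ty \<le> b \<and> att_ok (a + k) b sx sy tx ty"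

definition p_attach :: lsolver where
  "p_attach a b k l sx sy tx ty = attach (a + k) (b + l) (a + k) b
     (if 2 \<le> l then gp (a + k) (b + l) 1 a (b + 1) (b + l) 1 (b + 1) 2 (b + 1)
      else gp (a + k) (b + l) 1 a (b + 1) (b + l) 1 (b + 1) a (b + 1)) sx sy tx ty"

lemma hamp_attach_arm:
  assumes "linst a b k l sx sy tx ty" "c_attach a b k l sx sy tx ty"
  shows "hamp (LV a b k l) (sx, sy) (tx, ty) (p_attach a b k l sx sy tx ty)"
proof -
  note A = assms[unfolded linst_def c_attach_def]
  have B: "2 \<le> a" "2 \<le> b" "1 \<le> k" "1 \<le> l" "2 \<le> l \<or> a \<le> 3" using A by auto
  have S: "1 \<le> sx" "sx \<le> a + k" "1 \<le> sy" "sy \<le> b" "1 \<le> tx" "tx \<le> a + k" "1 \<le> ty" "ty \<le> b"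
    using A by linarith+
  have st: "sx \<noteq> tx \<or> sy \<noteq> ty" "att_ok (a + k) b sx sy tx ty" using A by blast+
  \<comment> \<open>An arm of one row has to be traversed from end to end, and its end
    \<open>(a, b + 1)\<close> is adjacent to \<open>(2, b)\<close> only for
    \<open>a \<le> 3\<close>; hence the condition in \<open>c_attach\<close>.\<close>
  let ?z = "if 2 \<le> l then 2 else a"
  have 1: "hamp (box 1 a (b + 1) (b + l)) (1, b + 1) (?z, b + 1) (gp (a + k) (b + l) 1 a (b + 1) (b + l) 1 (b + 1) ?z (b + 1))"
    using B by (intro hamp_gp) (auto simp: gok_def)
  have "hamp (box 1 (a + k) 1 b \<union> box 1 a (b + 1) (b + l)) (sx, sy) (tx, ty)
    (attach (a + k) (b + l) (a + k) b (gp (a + k) (b + l) 1 a (b + 1) (b + l) 1 (b + 1) ?z (b + 1)) sx sy tx ty)"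
    by (rule hamp_attach[OF _ _ _ _ S st 1]) (use B in auto)
  moreover have "box 1 (a + k) 1 b \<union> box 1 a (b + 1) (b + l) = LV a b k l"
    using B by (auto simp: LV_def)
  ultimately show ?thesis unfolding p_attach_def by (auto split: if_splits)
qed

definition c_pair :: lcond where
  "c_pair a b k l sx sy tx ty \<longleftrightarrow> 2 \<le> a \<and> 2 \<le> b \<and> (2 \<le> l \<or> a = 2) \<and> sx = 1 \<and> sy = b \<and> tx = 2 \<and> ty = b"

definition p_pair :: lsolver where
  "p_pair a b k l sx sy tx ty = [(1, b)] @ gp (a + k) (b + l) 1 (a + k) 1 (b - 1) 1 (b - 1) (a + k) (b - 1) @
     gp (a + k) (b + l) 3 (a + k) b b (a + k) b 3 b @
     gp (a + k) (b + l) 1 a (b + 1) (b + l) 2 (b + 1) 1 (b + 1) @ [(2, b)]"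

text \<open>The end points are the two vertices between which the arm would be inserted. The path
  goes around instead: through the rows below to the right, back along row \<open>b\<close> to
  \<open>(3, b)\<close>, and from there diagonally into the arm.\<close>

lemma hamp_pair:
  assumes "linst a b k l sx sy tx ty" "c_pair a b k l sx sy tx ty"
  shows "hamp (LV a b k l) (sx, sy) (tx, ty) (p_pair a b k l sx sy tx ty)"
proof -
  note A = assms[unfolded linst_def c_pair_def]
  have B: "2 \<le> a" "2 \<le> b" "1 \<le> k" "1 \<le> l" "2 \<le> l \<or> a = 2" using A by auto
  have 1: "hamp (box 1 (a + k) 1 (b - 1)) (1, b - 1) (a + k, b - 1)
      (gp (a + k) (b + l) 1 (a + k) 1 (b - 1) 1 (b - 1) (a + k) (b - 1))"
    using B by (intro hamp_gp) (auto simp: gok_def)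
  have 2: "hamp (box 3 (a + k) b b) (a + k, b) (3, b) (gp (a + k) (b + l) 3 (a + k) b b (a + k) b 3 b)"
    using B by (intro hamp_gp) (auto simp: gok_def)
  have 3: "hamp (box 1 a (b + 1) (b + l)) (2, b + 1) (1, b + 1) (gp (a + k) (b + l) 1 a (b + 1) (b + l) 2 (b + 1) 1 (b + 1))"
    using B by (intro hamp_gp) (auto simp: gok_def)
  have "hamp (LV a b k l) (1, b) (2, b) (p_pair a b k l sx sy tx ty)" unfolding p_pair_def
    by (rule hamp_eq[OF hamp_append'[OF hamp_single hamp_append'[OF 1 hamp_append'[OF 2 hamp_append'[OF 3 hamp_single]]]]])
      (use B in \<open>auto simp: LV_def\<close>)
  then show ?thesis using A by simp
qed

text \<open>This fills a gap of \<open>c_attach\<close> with the axes exchanged: the right arm is a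
  single column of at least four vertices, too long to lead from one of two adjacent vertices back
  to the other.\<close>

definition c_double :: lcond where
  "c_double a b k l sx sy tx ty \<longleftrightarrow> 2 \<le> a \<and> 4 \<le> b \<and> k = 1 \<and> b < sy \<and> b < ty \<and> \<not> (a = 2 \<and> sy = ty \<and> sy < b + l)"

text \<open>The lowest \<open>b - 2\<close> rows are inserted at the left end of row \<open>b - 1\<close>, and the two remaining
  vertices of the last column at its right end.\<close>

definition p_double :: lsolver where
  "p_double a b k l sx sy tx ty = ins (1, b - 1) (2, b - 1)
     (gp (a + k) (b + l) 1 (a + k) 1 (b - 2) 1 (b - 2) 2 (b - 2))
     (ins (a, b - 1) (a, b) [(a + 1, b - 1), (a + 1, b)] (gp (a + k) (b + l) 1 a (b - 1) (b + l) sx sy tx ty))"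

lemma hamp_double:
  assumes "linst a b k l sx sy tx ty" "c_double a b k l sx sy tx ty"
  shows "hamp (LV a b k l) (sx, sy) (tx, ty) (p_double a b k l sx sy tx ty)"
proof -
  note A = assms[unfolded linst_def c_double_def]
  have B: "2 \<le> a" "4 \<le> b" "k = 1" "1 \<le> l" using A by auto
  have S: "1 \<le> sx" "sx \<le> a" "b < sy" "sy \<le> b + l" "1 \<le> tx" "tx \<le> a" "b < ty" "ty \<le> b + l"
    using A by linarith+
  have st: "sx \<noteq> tx \<or> sy \<noteq> ty" "\<not> (a = 2 \<and> sy = ty \<and> sy < b + l)" using A by blast+
  have 1: "hamp (box 1 a (b - 1) (b + l)) (sx, sy) (tx, ty) (gp (a + k) (b + l) 1 a (b - 1) (b + l) sx sy tx ty)"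
    using B S st by (intro hamp_gp) (auto simp: gok_def)
  let ?W = "[(a + 1, b - 1), (a + 1, b)]"
  have W: "hamp {(a + 1, b - 1), (a + 1, b)} (a + 1, b - 1) (a + 1, b) ?W" by (auto simp: hamp_def)
  have 2: "hamp (box 1 a (b - 1) (b + l) \<union> {(a + 1, b - 1), (a + 1, b)}) (sx, sy) (tx, ty)
     (ins (a, b - 1) (a, b) ?W (gp (a + k) (b + l) 1 a (b - 1) (b + l) sx sy tx ty))"
  proof (rule hamp_ins[OF 1 _ _ _ _ _ _ _ _ _ _ _ _ W, where u = "(a - 1, b - 1)" and v = "(a - 1, b)"])
    fix z assume "z \<in> box 1 a (b - 1) (b + l)" "sg_adj (a, b - 1) z"
    then show "z \<in> {(a, b), (a - 1, b - 1), (a - 1, b)}" by (cases z) auto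
  next
    fix z z' assume z: "z \<in> box 1 a (b - 1) (b + l)" "z' \<in> box 1 a (b - 1) (b + l)" "sg_adj (a, b) z" "sg_adj (a, b) z'" "z \<noteq> z'"
      "{z, z'} \<inter> {(a, b - 1), (a - 1, b - 1), (a - 1, b)} = {}"
    obtain x y x' y' where e: "z = (x, y)" "z' = (x', y')" by force
    note z' = z[unfolded e, simplified]
    have "y = b + 1" "y' = b + 1" using z' by (smt (verit))+
    then show "sg_adj z z'" unfolding e sg_adj_Pair using z' by (smt (verit))
  qed (use B S in auto)
  let ?B = "gp (a + k) (b + l) 1 (a + k) 1 (b - 2) 1 (b - 2) 2 (b - 2)"
  have HB: "hamp (box 1 (a + k) 1 (b - 2)) (1, b - 2) (2, b - 2) ?B"
    using B by (intro hamp_gp) (auto simp: gok_def)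
  have 3: "hamp ((box 1 a (b - 1) (b + l) \<union> {(a + 1, b - 1), (a + 1, b)}) \<union> box 1 (a + k) 1 (b - 2)) (sx, sy) (tx, ty)
     (p_double a b k l sx sy tx ty)" unfolding p_double_def
  proof (rule hamp_ins[OF 2 _ _ _ _ _ _ _ _ _ _ _ _ HB, where u = "(1, b)" and v = "(2, b)"])
    fix z assume "z \<in> box 1 a (b - 1) (b + l) \<union> {(a + 1, b - 1), (a + 1, b)}" "sg_adj (1, b - 1) z"
    then show "z \<in> {(2, b - 1), (1, b), (2, b)}" using B by (cases z) auto
  next
    fix z z' assume z: "z \<in> box 1 a (b - 1) (b + l) \<union> {(a + 1, b - 1), (a + 1, b)}"
      "z' \<in> box 1 a (b - 1) (b + l) \<union> {(a + 1, b - 1), (a + 1, b)}" "sg_adj (2, b - 1) z" "sg_adj (2, b - 1) z'" "z \<noteq> z'"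
      "{z, z'} \<inter> {(1, b - 1), (1, b), (2, b)} = {}"
    obtain x y x' y' where e: "z = (x, y)" "z' = (x', y')" by force
    note z' = z[unfolded e, simplified]
    \<comment> \<open>The rows below \<open>b - 1\<close> are not yet in the set, so the remaining
      neighbours of \<open>(2, b - 1)\<close> lie in column 3. For \<open>a = 2\<close> these are
      the two vertices inserted before.\<close>
    have "x = 3" "x' = 3" using z' B by (smt (verit))+
    then show "sg_adj z z'" unfolding e sg_adj_Pair using z' B by (smt (verit))
  qed (use B S in auto)
  show ?thesis by (rule hamp_eq[OF 3]) (use B in \<open>auto simp: LV_def\<close>)
qed

text \<open>Opposite vertices of a corner block of size 2 by 2, which \<open>att_ok\<close>
  excludes. Both arms are visited in one go, by the diagonal step from \<open>(2, 3)\<close> to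
  \<open>(3, 2)\<close>.\<close>

definition c_small :: lcond where
  "c_small a b k l sx sy tx ty \<longleftrightarrow> a = 2 \<and> b = 2 \<and> sx = 1 \<and> tx = 2 \<and> (sy = 2 \<and> ty = 1 \<or> sy = 1 \<and> ty = 2)"

definition p_small :: lsolver where
  "p_small a b k l sx sy tx ty =
    (if sy = 2 then [(1, 2), (1, 1), (2, 2)] @ gp (a + k) (b + l) 1 2 3 (b + l) 1 3 2 3 @
       gp (a + k) (b + l) 3 (a + k) 1 2 3 2 3 1 @ [(2, 1)]
     else [(1, 1), (1, 2)] @ gp (a + k) (b + l) 1 2 3 (b + l) 1 3 2 3 @
       gp (a + k) (b + l) 3 (a + k) 1 2 3 2 3 1 @ [(2, 1), (2, 2)])"

lemma hamp_small:
  assumes "linst a b k l sx sy tx ty" "c_small a b k l sx sy tx ty"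
  shows "hamp (LV a b k l) (sx, sy) (tx, ty) (p_small a b k l sx sy tx ty)"
proof -
  note A = assms[unfolded linst_def c_small_def]
  have B: "a = 2" "b = 2" "1 \<le> k" "1 \<le> l" using A by auto
  have U: "hamp (box 1 2 3 (b + l)) (1, 3) (2, 3) (gp (a + k) (b + l) 1 2 3 (b + l) 1 3 2 3)"
    using B by (intro hamp_gp) (auto simp: gok_def)
  have R: "hamp (box 3 (a + k) 1 2) (3, 2) (3, 1) (gp (a + k) (b + l) 3 (a + k) 1 2 3 2 3 1)"
    using B by (intro hamp_gp) (auto simp: gok_def)
  show ?thesis
  proof (cases "sy = 2")
    case True
    have 1: "hamp {(1, 2), (1, 1), (2, 2)} (1, 2) (2, 2) [(1, 2), (1, 1), (2, 2)]" by (auto simp: hamp_def)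
    have "hamp (LV a b k l) (1, 2) (2, 1) (p_small a b k l sx sy tx ty)" unfolding p_small_def if_P[OF True]
      by (rule hamp_eq[OF hamp_append'[OF 1 hamp_append'[OF U hamp_append'[OF R hamp_single]]]])
        (use B in \<open>auto simp: LV_def\<close>)
    then show ?thesis using A True by simp
  next
    case False
    have 1: "hamp {(1, 1), (1, 2)} (1, 1) (1, 2) [(1, 1), (1, 2)]" by (auto simp: hamp_def)
    have 2: "hamp {(2, 1), (2, 2)} (2, 1) (2, 2) [(2, 1), (2, 2)]" by (auto simp: hamp_def)
    have "hamp (LV a b k l) (1, 1) (2, 2) (p_small a b k l sx sy tx ty)" unfolding p_small_def if_not_P[OF False]
      by (rule hamp_eq[OF hamp_append'[OF 1 hamp_append'[OF U hamp_append'[OF R 2]]]])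
        (use B in \<open>auto simp: LV_def\<close>)
    then show ?thesis using A False by simp
  qed
qed

section \<open>Separating sets\<close>

lemma longest_of_bound:
  assumes "hamp X s t p" "X \<subseteq> V"
    and "\<And>q. hamp (set q) s t q \<Longrightarrow> set q \<subseteq> V \<Longrightarrow> length q \<le> length p"
  shows "is_longest_st_path V s t p"
  using assms(2,3) hamp_st_path[OF assms(1,2)]
  by (auto simp: is_longest_st_path_def is_st_path_def hamp_def successively_conv_nth)

text \<open>The path visits everything that any competitor can visit.\<close>

lemma longest_of_subset:
  assumes h: "hamp X s t p" and V: "X \<subseteq> V"
    and sub: "\<And>q. hamp (set q) s t q \<Longrightarrow> set q \<subseteq> V \<Longrightarrow> set q \<subseteq> X"
  shows "is_longest_st_path V s t p"
proof (rule longest_of_bound[OF h V])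
  fix q assume q: "hamp (set q) s t q" "set q \<subseteq> V"
  have "finite X" using h by (auto simp: hamp_def)
  then show "length q \<le> length p"
    using sub[OF q] length_hamp[OF q(1)] length_hamp[OF h] by (simp add: card_mono)
qed

text \<open>For end points forming a cut pair: a competitor stays on one side, and which side is
  larger depends on the instance.\<close>

lemma longest_of_subset2:
  assumes h: "hamp X s t p" "hamp Y s t p'" and V: "X \<subseteq> V" "Y \<subseteq> V"
    and sub: "\<And>q. hamp (set q) s t q \<Longrightarrow> set q \<subseteq> V \<Longrightarrow> set q \<subseteq> X \<or> set q \<subseteq> Y"
  shows "is_longest_st_path V s t (if length p < length p' then p' else p)"
proof (rule longest_of_bound[of "if length p < length p' then Y else X"])
  fix q assume q: "hamp (set q) s t q" "set q \<subseteq> V"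
  have "finite X" "finite Y" using h by (auto simp: hamp_def)
  then have "card (set q) \<le> card X \<or> card (set q) \<le> card Y" using sub[OF q] by (meson card_mono)
  then show "length q \<le> length (if length p < length p' then p' else p)"
    using length_hamp[OF q(1)] length_hamp[OF h(1)] length_hamp[OF h(2)] by auto
qed (use h V in auto)

text \<open>A path entering and leaving \<open>C\<close> would have to pass twice through the cut vertex \<open>z\<close>.\<close>

lemma path_avoids_beyond_cut_vertex:
  assumes h: "hamp X s t q" and V: "X \<subseteq> V" and C: "s \<notin> C" "t \<notin> C"
    and N: "\<And>x y x' y'. (x, y) \<in> C \<Longrightarrow> (x, y) \<in> V \<Longrightarrow> (x', y') \<in> V \<Longrightarrow> sg_adj (x, y) (x', y') \<Longrightarrow>
      (x', y') \<notin> C \<Longrightarrow> (x', y') = z"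
  shows "X \<inter> C = {}"
proof (rule ccontr)
  assume "X \<inter> C \<noteq> {}"
  then have ex: "\<exists>c\<in>set q. c \<in> C" using h by (auto simp: hamp_def)
  have N': "d = z" if "c \<in> C" "c \<in> V" "d \<in> V" "sg_adj c d" "d \<notin> C" for c d
    using N[of "fst c" "snd c" "fst d" "snd d"] that by simp
  obtain A c B where q: "q = A @ c # B" and c: "c \<in> C" "\<forall>a\<in>set A. a \<notin> C"
    using split_list_first_prop[OF ex] by blast
  have A: "A \<noteq> []" using q c h C by (auto simp: hamp_def)
  have z1: "last A = z"
  proof (rule N')
    show "sg_adj c (last A)" using h A unfolding q hamp_def
      by (simp add: successively_append_iff sg_adj_sym)
  qed (use A c h V q in \<open>auto simp: hamp_def\<close>)
  have "\<exists>c\<in>set (c # B). c \<in> C" using c by simp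
  then obtain A' c' B' where q': "c # B = A' @ c' # B'" and c': "c' \<in> C" "\<forall>a\<in>set B'. a \<notin> C"
    using split_list_last_prop[of "c # B" "\<lambda>c. c \<in> C"] by blast
  have e: "q = (A @ A') @ c' # B'" using q q' by simp
  have B: "B' \<noteq> []" using e c' h C by (auto simp: hamp_def)
  have z2: "hd B' = z"
  proof (rule N')
    show "sg_adj c' (hd B')" using h B unfolding e hamp_def
      by (simp add: successively_append_iff successively_Cons)
  qed (use B c' h V e in \<open>auto simp: hamp_def\<close>)
  have "distinct (A @ A' @ c' # B')" using h e by (simp add: hamp_def)
  moreover have "last A \<in> set A" "hd B' \<in> set B'" using A B by simp_all
  ultimately show False using z1 z2 by auto
qed

text \<open>The vertex before the first one in \<open>C\<close> is \<open>s\<close> or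
  \<open>t\<close>. It cannot be \<open>t\<close>, where the path ends, so it is \<open>s\<close>,
  where the path starts. The first vertex outside \<open>C\<close> after that is again
  \<open>s\<close> or \<open>t\<close>, now necessarily \<open>t\<close>; so all inner vertices lie
  in \<open>C\<close>.\<close>

lemma path_through_endpoint_cut:
  assumes h: "hamp X s t q" and V: "X \<subseteq> V" and C: "s \<notin> C" "t \<notin> C"
    and N: "\<And>x y x' y'. (x, y) \<in> C \<Longrightarrow> (x, y) \<in> V \<Longrightarrow> (x', y') \<in> V \<Longrightarrow> sg_adj (x, y) (x', y') \<Longrightarrow>
      (x', y') \<notin> C \<Longrightarrow> (x', y') = s \<or> (x', y') = t"
  shows "X \<subseteq> C \<union> {s, t} \<or> X \<inter> C = {}"
proof (rule disjCI)
  assume "X \<inter> C \<noteq> {}"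
  then have ex: "\<exists>c\<in>set q. c \<in> C" using h by (auto simp: hamp_def)
  have N': "d = s \<or> d = t" if "c \<in> C" "c \<in> V" "d \<in> V" "sg_adj c d" "d \<notin> C" for c d
    using N[of "fst c" "snd c" "fst d" "snd d"] that by simp
  obtain A c B where q: "q = A @ c # B" and c: "c \<in> C" "\<forall>a\<in>set A. a \<notin> C"
    using split_list_first_prop[OF ex] by blast
  have d: "distinct (A @ c # B)" using h q by (simp add: hamp_def)
  have A: "A \<noteq> []" using q c h C by (auto simp: hamp_def)
  have B: "B \<noteq> []" using q c h C by (auto simp: hamp_def)
  have tB: "last B = t" using h q B by (simp add: hamp_def)
  have sA: "hd A = s" using h q A by (simp add: hamp_def)
  have "last A = s \<or> last A = t"
  proof (rule N')
    show "sg_adj c (last A)" using h A unfolding q hamp_def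
      by (simp add: successively_append_iff sg_adj_sym)
  qed (use A c h V q in \<open>auto simp: hamp_def\<close>)
  moreover have "last A \<noteq> t"
    using d tB B A by (metis IntI distinct_append empty_iff last_in_set list.set_intros(2))
  ultimately have lA: "last A = s" by simp
  have A1: "A = [s]"
  proof (cases A)
    case (Cons x A')
    then have "A' = []" using lA sA d by (cases A' rule: rev_cases) auto
    then show ?thesis using Cons sA by simp
  qed (use A in simp)
  have "\<exists>x\<in>set (c # B). x \<notin> C" using tB B C by (metis last_in_set list.set_intros(2))
  then obtain D e E where e: "c # B = D @ e # E" "e \<notin> C" "\<forall>x\<in>set D. x \<in> C"
    using split_list_first_prop[of "c # B" "\<lambda>x. x \<notin> C"] by auto
  have D: "D \<noteq> []" using e c by (cases D) auto
  have q2: "q = (A @ D) @ e # E" using q e by simp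
  have "e = s \<or> e = t"
  proof (rule N')
    show "sg_adj (last D) e" using h D unfolding q2 hamp_def
      by (simp add: successively_append_iff)
  qed (use D e h V q2 in \<open>auto simp: hamp_def\<close>)
  moreover have "e \<noteq> s" using h A1 unfolding q2 by (auto simp: hamp_def)
  ultimately have "e = t" by simp
  have "E = []"
  proof (rule ccontr)
    assume "E \<noteq> []"
    then have "last E = t" "last E \<in> set E" using h q2 by (auto simp: hamp_def)
    then show False using h q2 \<open>e = t\<close> by (auto simp: hamp_def)
  qed
  then have "set q = {s} \<union> set D \<union> {t}" using q2 A1 \<open>e = t\<close> by auto
  then show "X \<subseteq> C \<union> {s, t}" using h e by (auto simp: hamp_def)
qed

section \<open>Longest paths of L-shaped graphs with a thin arm, or with a pair of cut vertices\<close>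

definition c_arm :: lcond where
  "c_arm a b k l sx sy tx ty \<longleftrightarrow> a = 1 \<and> b < sy \<and> sy < ty"

definition p_arm :: lsolver where
  "p_arm a b k l sx sy tx ty = gp (a + k) (b + l) 1 1 sy ty 1 sy 1 ty"

text \<open>Each end point is itself a cut vertex towards what lies beyond it, so only the segment
  between them can be visited.\<close>

lemma longest_arm:
  assumes "linst a b k l sx sy tx ty" "c_arm a b k l sx sy tx ty"
  shows "is_longest_st_path (LV a b k l) (sx, sy) (tx, ty) (p_arm a b k l sx sy tx ty)"
proof -
  note A = assms[unfolded linst_def c_arm_def]
  have B: "a = 1" "1 \<le> b" "1 \<le> k" "1 \<le> l" "b < sy" "sy < ty" "ty \<le> b + l" using A by (smt (verit))+
  have S: "sx = 1" "tx = 1" using A by (smt (verit))+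
  have "hamp (box 1 1 sy ty) (1, sy) (1, ty) (p_arm a b k l sx sy tx ty)"
    unfolding p_arm_def using B by (intro hamp_gp) (auto simp: gok_def)
  then show ?thesis unfolding S
  proof (rule longest_of_subset)
    show "box 1 1 sy ty \<subseteq> LV a b k l" using B by (auto simp: LV_def)
  next
    fix q assume q: "hamp (set q) (1, sy) (1, ty) q" "set q \<subseteq> LV a b k l"
    have 1: "set q \<inter> {(x, y). y < sy} = {}"
      by (rule path_avoids_beyond_cut_vertex[OF q, where z = "(1, sy)"])
        (use B in \<open>auto simp: LV_def\<close>)
    have 2: "set q \<inter> {(x, y). ty < y} = {}"
      by (rule path_avoids_beyond_cut_vertex[OF q, where z = "(1, ty)"])
        (use B in \<open>auto simp: LV_def\<close>)
    show "set q \<subseteq> box 1 1 sy ty" using 1 2 q(2) B by (fastforce simp: LV_def)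
  qed
qed

definition c_bend :: lcond where
  "c_bend a b k l sx sy tx ty \<longleftrightarrow> a = 1 \<and> b = 1 \<and> 1 < sy \<and> tx = 1 \<and> ty = 1"

definition p_bend :: lsolver where
  "p_bend a b k l sx sy tx ty = gp (a + k) (b + l) 1 1 2 sy 1 sy 1 2 @ [(2, 1), (1, 1)]"

text \<open>The diagonal step from \<open>(1, 2)\<close> to \<open>(2, 1)\<close> allows a detour
  over one vertex of the other arm before the corner. Of that arm no more can be visited, as
  \<open>(2, 1)\<close> is a cut vertex.\<close>

lemma longest_bend:
  assumes "linst a b k l sx sy tx ty" "c_bend a b k l sx sy tx ty"
  shows "is_longest_st_path (LV a b k l) (sx, sy) (tx, ty) (p_bend a b k l sx sy tx ty)"
proof -
  note A = assms[unfolded linst_def c_bend_def]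
  have B: "a = 1" "b = 1" "1 \<le> k" "1 \<le> l" "1 < sy" "sy \<le> b + l" using A by (smt (verit))+
  have S: "sx = 1" "tx = 1" "ty = 1" using A by (smt (verit))+
  have 1: "hamp (box 1 1 2 sy) (1, sy) (1, 2) (gp (a + k) (b + l) 1 1 2 sy 1 sy 1 2)"
    using B by (intro hamp_gp) (auto simp: gok_def)
  have 2: "hamp {(2, 1), (1, 1)} (2, 1) (1, 1) [(2, 1), (1, 1)]" by (auto simp: hamp_def)
  have "hamp (box 1 1 2 sy \<union> {(2, 1), (1, 1)}) (1, sy) (1, 1) (p_bend a b k l sx sy tx ty)"
    unfolding p_bend_def by (rule hamp_append'[OF 1 2]) auto
  then show ?thesis unfolding S
  proof (rule longest_of_subset)
    show "box 1 1 2 sy \<union> {(2, 1), (1, 1)} \<subseteq> LV a b k l" using B by (auto simp: LV_def)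
  next
    fix q assume q: "hamp (set q) (1, sy) (1, 1) q" "set q \<subseteq> LV a b k l"
    have 1: "set q \<inter> {(x, y). sy < y} = {}"
      by (rule path_avoids_beyond_cut_vertex[OF q, where z = "(1, sy)"])
        (use B in \<open>auto simp: LV_def\<close>)
    have 2: "set q \<inter> {(x, y). 2 < x} = {}"
      by (rule path_avoids_beyond_cut_vertex[OF q, where z = "(2, 1)"])
        (use B in \<open>auto simp: LV_def\<close>)
    show "set q \<subseteq> box 1 1 2 sy \<union> {(2, 1), (1, 1)}" using 1 2 q(2) B by (fastforce simp: LV_def)
  qed
qed

definition c_turn :: lcond where
  "c_turn a b k l sx sy tx ty \<longleftrightarrow> a = 1 \<and> b = 1 \<and> 1 < sy \<and> 2 \<le> tx \<and> ty = 1"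

definition p_turn :: lsolver where
  "p_turn a b k l sx sy tx ty = gp (a + k) (b + l) 1 1 2 sy 1 sy 1 2 @ gp (a + k) (b + l) 1 tx 1 1 1 1 tx 1"

lemma longest_turn:
  assumes "linst a b k l sx sy tx ty" "c_turn a b k l sx sy tx ty"
  shows "is_longest_st_path (LV a b k l) (sx, sy) (tx, ty) (p_turn a b k l sx sy tx ty)"
proof -
  note A = assms[unfolded linst_def c_turn_def]
  have B: "a = 1" "b = 1" "1 \<le> k" "1 \<le> l" "1 < sy" "sy \<le> b + l" "2 \<le> tx" "tx \<le> a + k" using A by (smt (verit))+
  have S: "sx = 1" "ty = 1" using A by (smt (verit))+
  have 1: "hamp (box 1 1 2 sy) (1, sy) (1, 2) (gp (a + k) (b + l) 1 1 2 sy 1 sy 1 2)"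
    using B by (intro hamp_gp) (auto simp: gok_def)
  have 2: "hamp (box 1 tx 1 1) (1, 1) (tx, 1) (gp (a + k) (b + l) 1 tx 1 1 1 1 tx 1)"
    using B by (intro hamp_gp) (auto simp: gok_def)
  have "hamp (box 1 1 2 sy \<union> box 1 tx 1 1) (1, sy) (tx, 1) (p_turn a b k l sx sy tx ty)"
    unfolding p_turn_def by (rule hamp_append'[OF 1 2]) auto
  then show ?thesis unfolding S
  proof (rule longest_of_subset)
    show "box 1 1 2 sy \<union> box 1 tx 1 1 \<subseteq> LV a b k l" using B by (auto simp: LV_def)
  next
    fix q assume q: "hamp (set q) (1, sy) (tx, 1) q" "set q \<subseteq> LV a b k l"
    have 1: "set q \<inter> {(x, y). sy < y} = {}"
      by (rule path_avoids_beyond_cut_vertex[OF q, where z = "(1, sy)"])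
        (use B in \<open>auto simp: LV_def\<close>)
    have 2: "set q \<inter> {(x, y). tx < x} = {}"
      by (rule path_avoids_beyond_cut_vertex[OF q, where z = "(tx, 1)"])
        (use B in \<open>auto simp: LV_def\<close>)
    show "set q \<subseteq> box 1 1 2 sy \<union> box 1 tx 1 1" using 1 2 q(2) B by (fastforce simp: LV_def)
  qed
qed

definition c_enter :: lcond where
  "c_enter a b k l sx sy tx ty \<longleftrightarrow> a = 1 \<and> 2 \<le> b \<and> b < sy \<and> ty \<le> b"

definition p_enter :: lsolver where
  "p_enter a b k l sx sy tx ty = gp (a + k) (b + l) 1 1 (b + 1) sy 1 sy 1 (b + 1) @
     (if tx = 1 \<and> ty = b then gp (a + k) (b + l) 1 (a + k) 1 b 2 b tx ty
      else gp (a + k) (b + l) 1 (a + k) 1 b 1 b tx ty)"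

text \<open>\<open>s\<close> is a cut vertex towards the upper part of the arm; everything else is
  visited.\<close>

lemma longest_enter:
  assumes "linst a b k l sx sy tx ty" "c_enter a b k l sx sy tx ty"
  shows "is_longest_st_path (LV a b k l) (sx, sy) (tx, ty) (p_enter a b k l sx sy tx ty)"
proof -
  note A = assms[unfolded linst_def c_enter_def]
  have B: "a = 1" "2 \<le> b" "1 \<le> k" "1 \<le> l" "b < sy" "sy \<le> b + l" "1 \<le> tx" "tx \<le> a + k" "1 \<le> ty" "ty \<le> b"
    using A by (smt (verit))+
  have S: "sx = 1" using A by (smt (verit))+
  let ?z = "if tx = 1 \<and> ty = b then 2 else 1 :: int"
  have 1: "hamp (box 1 1 (b + 1) sy) (1, sy) (1, b + 1) (gp (a + k) (b + l) 1 1 (b + 1) sy 1 sy 1 (b + 1))"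
    using B by (intro hamp_gp) (auto simp: gok_def)
  have 2: "hamp (box 1 (a + k) 1 b) (?z, b) (tx, ty) (gp (a + k) (b + l) 1 (a + k) 1 b ?z b tx ty)"
    using B by (intro hamp_gp) (auto simp: gok_def)
  have "hamp (box 1 1 (b + 1) sy \<union> box 1 (a + k) 1 b) (1, sy) (tx, ty)
      (gp (a + k) (b + l) 1 1 (b + 1) sy 1 sy 1 (b + 1) @ gp (a + k) (b + l) 1 (a + k) 1 b ?z b tx ty)"
    by (rule hamp_append'[OF 1 2]) auto
  then have "hamp (box 1 1 (b + 1) sy \<union> box 1 (a + k) 1 b) (1, sy) (tx, ty) (p_enter a b k l sx sy tx ty)"
    unfolding p_enter_def by (auto split: if_splits)
  then show ?thesis unfolding S
  proof (rule longest_of_subset)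
    show "box 1 1 (b + 1) sy \<union> box 1 (a + k) 1 b \<subseteq> LV a b k l" using B by (auto simp: LV_def)
  next
    fix q assume q: "hamp (set q) (1, sy) (tx, ty) q" "set q \<subseteq> LV a b k l"
    have 1: "set q \<inter> {(x, y). sy < y} = {}"
      by (rule path_avoids_beyond_cut_vertex[OF q, where z = "(1, sy)"])
        (use B in \<open>auto simp: LV_def\<close>)
    show "set q \<subseteq> box 1 1 (b + 1) sy \<union> box 1 (a + k) 1 b" using 1 q(2) B by (fastforce simp: LV_def)
  qed
qed

text \<open>The first vertex \<open>(1, b + 1)\<close> of the arm is a cut vertex towards the rest
  of it. It may itself be visited, as it has the two neighbours \<open>(1, b)\<close> and
  \<open>(2, b)\<close> in the block.\<close>

lemma thin_arm_unused:
  assumes q: "hamp X s t q" "X \<subseteq> LV 1 b k l" and st: "snd s \<le> b" "snd t \<le> b" and "1 \<le> b" "1 \<le> k"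
  shows "X \<subseteq> box 1 (1 + k) 1 b \<union> {(1, b + 1)}"
proof -
  have "X \<inter> {(x, y). b + 1 < y} = {}"
    by (rule path_avoids_beyond_cut_vertex[OF q, where z = "(1, b + 1)"])
      (use assms in \<open>auto simp: LV_def\<close>)
  then show ?thesis using q(2) assms by (fastforce simp: LV_def)
qed

definition c_cutv :: lcond where
  "c_cutv a b k l sx sy tx ty \<longleftrightarrow> a = 1 \<and> k = 1 \<and> sx = 1 \<and> tx = 2 \<and> ty = sy \<and> 1 < sy \<and> sy < b"

definition p_cutv :: lsolver where
  "p_cutv a b k l sx sy tx ty =
     (let p = gp (a + k) (b + l) 1 1 sy b 1 sy 1 b @ [(1, b + 1)] @ gp (a + k) (b + l) 2 2 sy b 2 b 2 sy;
          p' = gp (a + k) (b + l) 1 2 1 sy 1 sy 2 sy in if length p < length p' then p' else p)"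

text \<open>The block has two columns and the end points fill a row of it. On the upper side
  \<open>(1, b + 1)\<close> is visited while turning from the first column into the second.\<close>

lemma longest_cutv:
  assumes "linst a b k l sx sy tx ty" "c_cutv a b k l sx sy tx ty"
  shows "is_longest_st_path (LV a b k l) (sx, sy) (tx, ty) (p_cutv a b k l sx sy tx ty)"
proof -
  note A = assms[unfolded linst_def c_cutv_def]
  have B: "a = 1" "k = 1" "1 \<le> l" "1 < sy" "sy < b" using A by (smt (verit))+
  have S: "sx = 1" "tx = 2" "ty = sy" using A by (smt (verit))+
  have 1: "hamp (box 1 1 sy b) (1, sy) (1, b) (gp (a + k) (b + l) 1 1 sy b 1 sy 1 b)"
    using B by (intro hamp_gp) (auto simp: gok_def)
  have 2: "hamp (box 2 2 sy b) (2, b) (2, sy) (gp (a + k) (b + l) 2 2 sy b 2 b 2 sy)"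
    using B by (intro hamp_gp) (auto simp: gok_def)
  have 3: "hamp (box 1 1 sy b \<union> ({(1, b + 1)} \<union> box 2 2 sy b)) (1, sy) (2, sy)
     (gp (a + k) (b + l) 1 1 sy b 1 sy 1 b @ [(1, b + 1)] @ gp (a + k) (b + l) 2 2 sy b 2 b 2 sy)"
    by (rule hamp_append'[OF 1 hamp_append'[OF hamp_single 2]]) auto
  have 4: "hamp (box 1 2 1 sy) (1, sy) (2, sy) (gp (a + k) (b + l) 1 2 1 sy 1 sy 2 sy)"
    using B by (intro hamp_gp) (auto simp: gok_def)
  show ?thesis unfolding S p_cutv_def Let_def
  proof (rule longest_of_subset2[OF 3 4])
    fix q assume q: "hamp (set q) (1, sy) (2, sy) q" "set q \<subseteq> LV a b k l"
    have 1: "set q \<subseteq> box 1 (1 + k) 1 b \<union> {(1, b + 1)}"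
      by (rule thin_arm_unused) (use q B in auto)
    have "set q \<subseteq> {(x, y). sy < y} \<union> {(1, sy), (2, sy)} \<or> set q \<inter> {(x, y). sy < y} = {}"
      by (rule path_through_endpoint_cut[OF q])
        (use B in \<open>auto simp: LV_def\<close>)
    then show "set q \<subseteq> box 1 1 sy b \<union> ({(1, b + 1)} \<union> box 2 2 sy b) \<or> set q \<subseteq> box 1 2 1 sy"
    proof (elim disjE)
      assume "set q \<subseteq> {(x, y). sy < y} \<union> {(1, sy), (2, sy)}"
      then show ?thesis using 1 B by (intro disjI1) fastforce
    next
      assume "set q \<inter> {(x, y). sy < y} = {}"
      then show ?thesis using 1 B by (intro disjI2) fastforce
    qed
  qed (use B in \<open>auto simp: LV_def\<close>)
qed

definition c_cuth :: lcond where
  "c_cuth a b k l sx sy tx ty \<longleftrightarrow> a = 1 \<and> b = 2 \<and> sy = 1 \<and> ty = 2 \<and> tx = sx \<and> 1 < sx \<and> sx < a + k"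

definition p_cuth :: lsolver where
  "p_cuth a b k l sx sy tx ty =
     (let p = gp (a + k) (b + l) 1 sx 1 1 sx 1 1 1 @ [(1, 2)] @ [(1, 3)] @ gp (a + k) (b + l) 2 sx 2 2 2 2 sx 2;
          p' = gp (a + k) (b + l) sx (a + k) 1 2 sx 1 sx 2 in if length p < length p' then p' else p)"

text \<open>The block has two rows and the end points fill a column of it. The left side includes
  \<open>(1, 3)\<close>, visited between \<open>(1, 2)\<close> and \<open>(2, 2)\<close>.\<close>

lemma longest_cuth:
  assumes "linst a b k l sx sy tx ty" "c_cuth a b k l sx sy tx ty"
  shows "is_longest_st_path (LV a b k l) (sx, sy) (tx, ty) (p_cuth a b k l sx sy tx ty)"
proof -
  note A = assms[unfolded linst_def c_cuth_def]
  have B: "a = 1" "b = 2" "1 \<le> k" "1 \<le> l" "1 < sx" "sx < a + k" using A by (smt (verit))+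
  have S: "sy = 1" "ty = 2" "tx = sx" using A by (smt (verit))+
  have 1: "hamp (box 1 sx 1 1) (sx, 1) (1, 1) (gp (a + k) (b + l) 1 sx 1 1 sx 1 1 1)"
    using B by (intro hamp_gp) (auto simp: gok_def)
  have 2: "hamp (box 2 sx 2 2) (2, 2) (sx, 2) (gp (a + k) (b + l) 2 sx 2 2 2 2 sx 2)"
    using B by (intro hamp_gp) (auto simp: gok_def)
  have 3: "hamp (box 1 sx 1 1 \<union> ({(1, 2)} \<union> ({(1, 3)} \<union> box 2 sx 2 2))) (sx, 1) (sx, 2)
     (gp (a + k) (b + l) 1 sx 1 1 sx 1 1 1 @ [(1, 2)] @ [(1, 3)] @ gp (a + k) (b + l) 2 sx 2 2 2 2 sx 2)"
    by (rule hamp_append'[OF 1 hamp_append'[OF hamp_single hamp_append'[OF hamp_single 2]]]) auto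
  have 4: "hamp (box sx (a + k) 1 2) (sx, 1) (sx, 2) (gp (a + k) (b + l) sx (a + k) 1 2 sx 1 sx 2)"
    using B by (intro hamp_gp) (auto simp: gok_def)
  show ?thesis unfolding S p_cuth_def Let_def
  proof (rule longest_of_subset2[OF 3 4])
    fix q assume q: "hamp (set q) (sx, 1) (sx, 2) q" "set q \<subseteq> LV a b k l"
    have 1: "set q \<subseteq> box 1 (1 + k) 1 b \<union> {(1, b + 1)}"
      by (rule thin_arm_unused) (use q B in auto)
    have "set q \<subseteq> {(x, y). sx < x} \<union> {(sx, 1), (sx, 2)} \<or> set q \<inter> {(x, y). sx < x} = {}"
      by (rule path_through_endpoint_cut[OF q])
        (use B in \<open>auto simp: LV_def\<close>)
    then show "set q \<subseteq> box 1 sx 1 1 \<union> ({(1, 2)} \<union> ({(1, 3)} \<union> box 2 sx 2 2)) \<or> set q \<subseteq> box sx (a + k) 1 2"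
    proof (elim disjE)
      assume "set q \<subseteq> {(x, y). sx < x} \<union> {(sx, 1), (sx, 2)}"
      then show ?thesis using 1 B by (intro disjI2) fastforce
    next
      assume "set q \<inter> {(x, y). sx < x} = {}"
      then show ?thesis using 1 B by (intro disjI1) fastforce
    qed
  qed (use B in \<open>auto simp: LV_def\<close>)
qed

definition c_cut :: lcond where
  "c_cut a b k l sx sy tx ty \<longleftrightarrow> a = 2 \<and> 2 \<le> b \<and> sx = 1 \<and> tx = 2 \<and> ty = sy \<and> b < sy \<and> sy < b + l"

definition p_cut :: lsolver where
  "p_cut a b k l sx sy tx ty =
     (let p = gp (a + k) (b + l) 1 1 (b + 1) sy 1 sy 1 (b + 1) @ gp (a + k) (b + l) 1 (a + k) 1 b 1 b 2 b @
            gp (a + k) (b + l) 2 2 (b + 1) sy 2 (b + 1) 2 sy;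
          p' = gp (a + k) (b + l) 1 2 sy (b + l) 1 sy 2 sy in if length p < length p' then p' else p)"

text \<open>The end points fill a row of an arm of width 2. One side is the tip of the arm; on the
  other the path runs down one column of the arm, through the whole bottom rectangle, and up the
  other column.\<close>

lemma longest_cut:
  assumes "linst a b k l sx sy tx ty" "c_cut a b k l sx sy tx ty"
  shows "is_longest_st_path (LV a b k l) (sx, sy) (tx, ty) (p_cut a b k l sx sy tx ty)"
proof -
  note A = assms[unfolded linst_def c_cut_def]
  have B: "a = 2" "2 \<le> b" "1 \<le> k" "1 \<le> l" "b < sy" "sy < b + l" using A by (smt (verit))+
  have S: "sx = 1" "tx = 2" "ty = sy" using A by (smt (verit))+
  have 1: "hamp (box 1 1 (b + 1) sy) (1, sy) (1, b + 1) (gp (a + k) (b + l) 1 1 (b + 1) sy 1 sy 1 (b + 1))"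
    using B by (intro hamp_gp) (auto simp: gok_def)
  have 2: "hamp (box 1 (a + k) 1 b) (1, b) (2, b) (gp (a + k) (b + l) 1 (a + k) 1 b 1 b 2 b)"
    using B by (intro hamp_gp) (auto simp: gok_def)
  have 3: "hamp (box 2 2 (b + 1) sy) (2, b + 1) (2, sy) (gp (a + k) (b + l) 2 2 (b + 1) sy 2 (b + 1) 2 sy)"
    using B by (intro hamp_gp) (auto simp: gok_def)
  have 4: "hamp (box 1 1 (b + 1) sy \<union> (box 1 (a + k) 1 b \<union> box 2 2 (b + 1) sy)) (1, sy) (2, sy)
     (gp (a + k) (b + l) 1 1 (b + 1) sy 1 sy 1 (b + 1) @ gp (a + k) (b + l) 1 (a + k) 1 b 1 b 2 b @
            gp (a + k) (b + l) 2 2 (b + 1) sy 2 (b + 1) 2 sy)"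
    by (rule hamp_append'[OF 1 hamp_append'[OF 2 3]]) auto
  have 5: "hamp (box 1 2 sy (b + l)) (1, sy) (2, sy) (gp (a + k) (b + l) 1 2 sy (b + l) 1 sy 2 sy)"
    using B by (intro hamp_gp) (auto simp: gok_def)
  show ?thesis unfolding S p_cut_def Let_def
  proof (rule longest_of_subset2[OF 4 5])
    fix q assume q: "hamp (set q) (1, sy) (2, sy) q" "set q \<subseteq> LV a b k l"
    have "set q \<subseteq> {(x, y). sy < y} \<union> {(1, sy), (2, sy)} \<or> set q \<inter> {(x, y). sy < y} = {}"
      by (rule path_through_endpoint_cut[OF q])
        (use B in \<open>auto simp: LV_def\<close>)
    then show "set q \<subseteq> box 1 1 (b + 1) sy \<union> (box 1 (a + k) 1 b \<union> box 2 2 (b + 1) sy) \<or> set q \<subseteq> box 1 2 sy (b + l)"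
    proof (elim disjE)
      assume "set q \<subseteq> {(x, y). sy < y} \<union> {(1, sy), (2, sy)}"
      then show ?thesis using q(2) B by (intro disjI2) (fastforce simp: LV_def)
    next
      assume "set q \<inter> {(x, y). sy < y} = {}"
      then show ?thesis using q(2) B by (intro disjI1) (fastforce simp: LV_def)
    qed
  qed (use B in \<open>auto simp: LV_def\<close>)
qed

definition c_foot :: lcond where
  "c_foot a b k l sx sy tx ty \<longleftrightarrow> a = 1 \<and> 2 \<le> b \<and> sy \<le> b \<and> ty \<le> b \<and> att_ok (a + k) b sx sy tx ty"

definition p_foot :: lsolver where
  "p_foot a b k l sx sy tx ty = attach (a + k) (b + l) (a + k) b [(1, b + 1)] sx sy tx ty"

text \<open>The only vertex of the arm within reach is attached to the block.\<close>

lemma longest_foot: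
  assumes "linst a b k l sx sy tx ty" "c_foot a b k l sx sy tx ty"
  shows "is_longest_st_path (LV a b k l) (sx, sy) (tx, ty) (p_foot a b k l sx sy tx ty)"
proof -
  note A = assms[unfolded linst_def c_foot_def]
  have B: "a = 1" "2 \<le> b" "1 \<le> k" "1 \<le> l" using A by auto
  have S: "1 \<le> sx" "sx \<le> a + k" "1 \<le> sy" "sy \<le> b" "1 \<le> tx" "tx \<le> a + k" "1 \<le> ty" "ty \<le> b"
    using A by linarith+
  have st: "sx \<noteq> tx \<or> sy \<noteq> ty" "att_ok (a + k) b sx sy tx ty" using A by blast+
  have "hamp (box 1 (a + k) 1 b \<union> {(1, b + 1)}) (sx, sy) (tx, ty) (p_foot a b k l sx sy tx ty)"
    unfolding p_foot_def by (rule hamp_attach[OF _ _ _ _ S st hamp_single]) (use B in auto)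
  then show ?thesis
  proof (rule longest_of_subset)
    show "box 1 (a + k) 1 b \<union> {(1, b + 1)} \<subseteq> LV a b k l" using B by (auto simp: LV_def)
  next
    fix q assume q: "hamp (set q) (sx, sy) (tx, ty) q" "set q \<subseteq> LV a b k l"
    show "set q \<subseteq> box 1 (a + k) 1 b \<union> {(1, b + 1)}"
      unfolding B(1) by (rule thin_arm_unused) (use q B S in auto)
  qed
qed

definition c_top :: lcond where
  "c_top a b k l sx sy tx ty \<longleftrightarrow> a = 1 \<and> 2 \<le> b \<and> sx = 1 \<and> sy = b \<and> tx = 2 \<and> ty = b"

definition p_top :: lsolver where
  "p_top a b k l sx sy tx ty = gp (a + k) (b + l) 1 (a + k) 1 b sx sy tx ty"

text \<open>Both neighbours of \<open>(1, b + 1)\<close> in the block are end points, so a path over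
  this vertex cannot enter the block in between and has just three vertices.\<close>

lemma longest_top:
  assumes "linst a b k l sx sy tx ty" "c_top a b k l sx sy tx ty"
  shows "is_longest_st_path (LV a b k l) (sx, sy) (tx, ty) (p_top a b k l sx sy tx ty)"
proof -
  note A = assms[unfolded linst_def c_top_def]
  have B: "a = 1" "2 \<le> b" "1 \<le> k" "1 \<le> l" using A by auto
  have S: "sx = 1" "sy = b" "tx = 2" "ty = b" using A by (smt (verit))+
  have h: "hamp (box 1 (a + k) 1 b) (1, b) (2, b) (p_top a b k l 1 b 2 b)"
    unfolding p_top_def using B by (intro hamp_gp) (auto simp: gok_def)
  show ?thesis unfolding S
  proof (rule longest_of_bound[OF h])
    show "box 1 (a + k) 1 b \<subseteq> LV a b k l" using B by (auto simp: LV_def)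
  next
    fix q assume q: "hamp (set q) (1, b) (2, b) q" "set q \<subseteq> LV a b k l"
    have 1: "set q \<subseteq> box 1 (1 + k) 1 b \<union> {(1, b + 1)}"
      by (rule thin_arm_unused) (use q B in auto)
    have "set q \<subseteq> {(x, y). b < y} \<union> {(1, b), (2, b)} \<or> set q \<inter> {(x, y). b < y} = {}"
      by (rule path_through_endpoint_cut[OF q])
        (use B in \<open>auto simp: LV_def\<close>)
    then have "set q \<subseteq> {(1, b), (2, b), (1, b + 1)} \<or> set q \<subseteq> box 1 (a + k) 1 b"
    proof (elim disjE)
      assume "set q \<subseteq> {(x, y). b < y} \<union> {(1, b), (2, b)}"
      then show ?thesis using 1 B by (intro disjI1) fastforce
    next
      assume "set q \<inter> {(x, y). b < y} = {}"
      then show ?thesis using 1 B by (intro disjI2) fastforce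
    qed
    then have "card (set q) \<le> card (box 1 (a + k) 1 b)"
    proof (elim disjE)
      assume "set q \<subseteq> {(1, b), (2, b), (1, b + 1)}"
      then have "card (set q) \<le> card {(1 :: int, b), (2, b), (1, b + 1)}" by (intro card_mono) auto
      \<comment> \<open>Three vertices of the block for comparison; they exist because
        \<open>2 \<le> b\<close>.\<close>
      also have "\<dots> = card {(1 :: int, b), (2, b), (1, b - 1)}" by simp
      also have "\<dots> \<le> card (box 1 (a + k) 1 b)" using B by (intro card_mono) auto
      finally show ?thesis .
    qed (rule card_mono, simp)
    then show "length q \<le> length (p_top a b k l 1 b 2 b)"
      unfolding length_hamp[OF q(1)] length_hamp[OF h] .
  qed
qed

definition c_flat :: lcond where
  "c_flat a b k l sx sy tx ty \<longleftrightarrow> a = 1 \<and> b = 2 \<and> 2 \<le> k \<and>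
     (sx = 1 \<and> sy = 2 \<and> tx = 2 \<and> ty = 1 \<or> sx = 2 \<and> sy = 2 \<and> tx = 1 \<and> ty = 1)"

text \<open>In a path longer than the claimed one, the vertex \<open>(1, 3)\<close> is the second vertex, and the path
  can then not return from the columns to the right of the second one.\<close>

lemma longest_flat:
  assumes "linst a b k l sx sy tx ty" "c_flat a b k l sx sy tx ty"
  shows "is_longest_st_path (LV a b k l) (sx, sy) (tx, ty) (p_top a b k l sx sy tx ty)"
proof -
  note A = assms[unfolded linst_def c_flat_def]
  have B: "a = 1" "b = 2" "2 \<le> k" "1 \<le> l" using A by auto
  have S: "(sx, sy) = (1, 2) \<and> (tx, ty) = (2, 1) \<or> (sx, sy) = (2, 2) \<and> (tx, ty) = (1, 1)" using A by simp
  have h: "hamp (box 1 (a + k) 1 b) (sx, sy) (tx, ty) (p_top a b k l sx sy tx ty)"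
    unfolding p_top_def using B S by (intro hamp_gp) (auto simp: gok_def)
  let ?D = "box 1 (1 + k) 1 2"
  show ?thesis
  proof (rule longest_of_bound[OF h])
    show "box 1 (a + k) 1 b \<subseteq> LV a b k l" using B by (auto simp: LV_def)
  next
    fix q assume q: "hamp (set q) (sx, sy) (tx, ty) q" "set q \<subseteq> LV a b k l"
    have "set q \<subseteq> box 1 (1 + k) 1 b \<union> {(1, b + 1)}"
      by (rule thin_arm_unused) (use q B S in auto)
    then have 1: "set q \<subseteq> ?D \<union> {(1, 3)}" by (simp add: B(2))
    have "card (set q) \<le> card ?D"
    proof (rule ccontr)
      assume "\<not> ?thesis"
      moreover have "card (?D \<union> {(1, 3)}) = Suc (card ?D)" by (subst Un_commute) simp
      \<comment> \<open>A path longer than the claimed one would have to visit the block and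
        \<open>(1, 3)\<close> completely.\<close>
      ultimately have "set q = ?D \<union> {(1, 3)}" using 1 by (intro card_seteq) auto
      then have full: "(1, 3) \<in> set q" "(3, 1) \<in> set q" "(1, 1) \<in> set q" "(2, 1) \<in> set q" using B by auto
      define s where "s = (sx, sy)"
      \<comment> \<open>The neighbour of \<open>(1, 3)\<close> in the block other than
        \<open>s\<close>. Once \<open>s\<close> is removed, \<open>(1, 3)\<close> hangs on
        \<open>z\<close> alone, so the path can reach it only directly from \<open>s\<close> and
        must go on to \<open>z\<close>.\<close>
      define z where "z = (if sx = 1 then (2, 2) else (1, 2) :: int \<times> int)"
      obtain q1 where q1: "q = s # q1" using q(1) by (cases q) (auto simp: hamp_def s_def)
      have q1n: "q1 \<noteq> []" using full S q1 by (auto simp: s_def)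
      have h1: "hamp (set q1) (hd q1) (tx, ty) q1" "s \<notin> set q1" using q(1) q1n
        by (auto simp: hamp_def q1 successively_Cons)
      have "hd q1 = (1, 3)"
      proof (rule ccontr)
        assume ne: "hd q1 \<noteq> (1, 3)"
        have "set q1 \<inter> {(1, 3)} = {}"
          by (rule path_avoids_beyond_cut_vertex[OF h1(1), where z = z and V = "?D \<union> {(1, 3)} - {s}"])
            (use ne h1 1 S q1 in \<open>auto simp: z_def s_def\<close>)
        then show False using full S q1 by (auto simp: s_def)
      qed
      then obtain q2 where q2: "q1 = (1, 3) # q2" using q1n by (cases q1) auto
      have q2n: "q2 \<noteq> []" using full S q1 q2 by (auto simp: s_def)
      have h2: "hamp (set q2) (hd q2) (tx, ty) q2" "(1, 3) \<notin> set q2" "sg_adj (1, 3) (hd q2)"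
        using h1(1) q2n by (auto simp: hamp_def q2 successively_Cons)
      have sub: "set q2 \<subseteq> ?D - {s}" using 1 h1(2) h2(2) q1 q2 by auto
      have in2: "(3, 1) \<in> set q2" using full S q1 q2 by (auto simp: s_def)
      have "hd q2 \<in> set q2" using q2n by simp
      then have "hd q2 \<in> ?D - {s}" using sub by blast
      then have hd2: "hd q2 = z" using h2(3) S by (cases "hd q2") (auto simp: s_def z_def)
      show False
      proof (cases "sx = 1")
        case True
        then have e: "s = (1, 2)" "z = (2, 2)" "tx = 2" "ty = 1" using S by (auto simp: s_def z_def)
        \<comment> \<open>Column 2 now consists of the end points of the remaining path, so visiting
          a column to the right of it means missing \<open>(1, 1)\<close>.\<close>
        have "set q2 \<subseteq> {(x, y). 2 < x} \<union> {(2, 2), (2, 1)} \<or> set q2 \<inter> {(x, y). 2 < x} = {}"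
          by (rule path_through_endpoint_cut[OF h2(1)[unfolded hd2 e] sub[unfolded e]]) auto
        moreover have "(1, 1) \<in> set q2" using full q1 q2 e by auto
        ultimately show False using in2 by auto
      next
        case False
        then have e: "s = (2, 2)" "z = (1, 2)" "tx = 1" "ty = 1" using S by (auto simp: s_def z_def)
        \<comment> \<open>With \<open>s\<close> removed, only \<open>(2, 1)\<close> is left of
          column 2, and it is a cut vertex towards the right.\<close>
        have "set q2 \<inter> {(x, y). 2 < x} = {}"
          by (rule path_avoids_beyond_cut_vertex[OF h2(1)[unfolded hd2 e] sub[unfolded e], where z = "(2, 1)"]) auto
        then show False using in2 by auto
      qed
    qed
    then show "length q \<le> length (p_top a b k l sx sy tx ty)"
      using length_hamp[OF q(1)] length_hamp[OF h] B by simp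
  qed
qed

section \<open>The complete algorithm\<close>

definition lcase :: lcond where
  "lcase a b k l sx sy tx ty \<longleftrightarrow>
     c_corner a b k l sx sy tx ty \<or> c_split a b k l sx sy tx ty \<or> c_split' a b k l sx sy tx ty \<or>
     c_attach a b k l sx sy tx ty \<or> c_pair a b k l sx sy tx ty \<or> c_double a b k l sx sy tx ty \<or> c_small a b k l sx sy tx ty \<or>
     c_arm a b k l sx sy tx ty \<or> c_bend a b k l sx sy tx ty \<or> c_turn a b k l sx sy tx ty \<or>
     c_enter a b k l sx sy tx ty \<or> c_cutv a b k l sx sy tx ty \<or> c_cuth a b k l sx sy tx ty \<or>
     c_cut a b k l sx sy tx ty \<or> c_foot a b k l sx sy tx ty \<or> c_top a b k l sx sy tx ty \<or>
     c_flat a b k l sx sy tx ty"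

text \<open>The only symmetries at hand are the exchange of end points and the transposition, which
  exchanges the arms. The split by the widths of the arms keeps the arithmetic manageable, as each
  part unfolds just the cases that can occur in it.\<close>

lemma lcase_complete:
  assumes "linst a b k l sx sy tx ty"
  shows "lcase a b k l sx sy tx ty \<or> lcase a b k l tx ty sx sy \<or>
    lcase b a l k sy sx ty tx \<or> lcase b a l k ty tx sy sx"
proof -
  consider "a = 1" "b = 1" | "a = 1" "b = 2" | "a = 1" "3 \<le> b" | "a = 2" "b = 1" | "3 \<le> a" "b = 1" | "2 \<le> a" "2 \<le> b"
    using assms unfolding linst_def by linarith
  then show ?thesis
  proof cases
    case 1
    then show ?thesis using assms
      unfolding lcase_def linst_def c_arm_def c_bend_def c_turn_def by (smt (z3))
  next
    case 2
    then show ?thesis using assms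
      unfolding lcase_def linst_def c_arm_def c_enter_def c_cutv_def c_cuth_def c_foot_def c_top_def c_flat_def
        att_ok_def noncut_def by (smt (z3))
  next
    case 3
    then show ?thesis using assms
      unfolding lcase_def linst_def c_arm_def c_enter_def c_cutv_def c_cuth_def c_foot_def c_top_def c_flat_def
        att_ok_def noncut_def by (smt (z3))
  next
    case 4
    then show ?thesis using assms
      unfolding lcase_def linst_def c_arm_def c_enter_def c_cutv_def c_cuth_def c_foot_def c_top_def c_flat_def
        att_ok_def noncut_def by (smt (z3))
  next
    case 5
    then show ?thesis using assms
      unfolding lcase_def linst_def c_arm_def c_enter_def c_cutv_def c_cuth_def c_foot_def c_top_def c_flat_def
        att_ok_def noncut_def by (smt (z3))
  next
    case 6
    then show ?thesis using assms
      unfolding lcase_def linst_def c_corner_def c_split_def c_split'_def c_attach_def c_pair_def c_double_def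
        c_small_def c_cut_def att_ok_def noncut_def by (smt (z3))
  qed
qed

text \<open>The default at the end serves \<open>c_top\<close> and \<open>c_flat\<close> alike: in
  both, a Hamiltonian path of the block is optimal.\<close>

definition lsol :: lsolver where
  "lsol a b k l sx sy tx ty =
    (if c_corner a b k l sx sy tx ty then p_corner a b k l sx sy tx ty
     else if c_split a b k l sx sy tx ty then p_split a b k l sx sy tx ty
     else if c_split' a b k l sx sy tx ty then p_split' a b k l sx sy tx ty
     else if c_attach a b k l sx sy tx ty then p_attach a b k l sx sy tx ty
     else if c_pair a b k l sx sy tx ty then p_pair a b k l sx sy tx ty
     else if c_double a b k l sx sy tx ty then p_double a b k l sx sy tx ty
     else if c_small a b k l sx sy tx ty then p_small a b k l sx sy tx ty
     else if c_arm a b k l sx sy tx ty then p_arm a b k l sx sy tx ty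
     else if c_bend a b k l sx sy tx ty then p_bend a b k l sx sy tx ty
     else if c_turn a b k l sx sy tx ty then p_turn a b k l sx sy tx ty
     else if c_enter a b k l sx sy tx ty then p_enter a b k l sx sy tx ty
     else if c_cutv a b k l sx sy tx ty then p_cutv a b k l sx sy tx ty
     else if c_cuth a b k l sx sy tx ty then p_cuth a b k l sx sy tx ty
     else if c_cut a b k l sx sy tx ty then p_cut a b k l sx sy tx ty
     else if c_foot a b k l sx sy tx ty then p_foot a b k l sx sy tx ty
     else p_top a b k l sx sy tx ty)"

lemma longest_of_hamp: "hamp V s t p \<Longrightarrow> is_longest_st_path V s t p"
  by (rule longest_of_subset) auto

lemma longest_lsol:
  assumes i: "linst a b k l sx sy tx ty" and c: "lcase a b k l sx sy tx ty"
  shows "is_longest_st_path (LV a b k l) (sx, sy) (tx, ty) (lsol a b k l sx sy tx ty)"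
  unfolding lsol_def
  using c[unfolded lcase_def]
    longest_of_hamp[OF hamp_corner[OF i]] longest_of_hamp[OF hamp_split[OF i]] longest_of_hamp[OF hamp_split'[OF i]]
    longest_of_hamp[OF hamp_attach_arm[OF i]] longest_of_hamp[OF hamp_pair[OF i]] longest_of_hamp[OF hamp_double[OF i]]
    longest_of_hamp[OF hamp_small[OF i]] longest_arm[OF i] longest_bend[OF i] longest_turn[OF i] longest_enter[OF i]
    longest_cutv[OF i] longest_cuth[OF i] longest_cut[OF i] longest_foot[OF i] longest_top[OF i] longest_flat[OF i]
  by presburger

section \<open>Longest paths under reversal and involutions of the grid\<close>

lemma st_path_iff_hamp: "is_st_path V s t p \<longleftrightarrow> hamp (set p) s t p \<and> set p \<subseteq> V"
  by (auto simp: is_st_path_def hamp_def successively_conv_nth)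

lemma longest_rev:
  assumes "is_longest_st_path V s t p"
  shows "is_longest_st_path V t s (rev p)"
proof -
  have "is_st_path V x y (rev q)" if "is_st_path V y x q" for x y q
    using that hamp_rev[of "set q" y x q] by (simp add: st_path_iff_hamp)
  then show ?thesis using assms unfolding is_longest_st_path_def by (metis length_rev)
qed

text \<open>An involution carries a competing path in the image back to the original graph, where
  the length bound is known.\<close>

lemma longest_map:
  assumes p: "is_longest_st_path V s t p" and g: "\<And>u v. sg_adj u v \<Longrightarrow> sg_adj (g u) (g v)" "\<And>u. g (g u) = u"
  shows "is_longest_st_path (g ` V) (g s) (g t) (map g p)"
proof -
  have inj: "inj g" by (metis g(2) injI)
  have *: "is_st_path (g ` W) (g x) (g y) (map g q)" if "is_st_path W x y q" for W x y q
    using that hamp_map[OF _ g(1) inj, of "set q" x y q] by (auto simp: st_path_iff_hamp)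
  have "length q \<le> length p" if "is_st_path (g ` V) (g s) (g t) q" for q
    using *[OF that] p by (simp add: g image_image is_longest_st_path_def) (metis length_map)
  then show ?thesis using * p by (simp add: is_longest_st_path_def)
qed

lemma LV_swap: "prod.swap ` LV a b k l = LV b a l k"
  by (auto simp: LV_def image_Un product_swap)

definition lpath :: lsolver where
  "lpath a b k l sx sy tx ty =
    (if lcase a b k l sx sy tx ty then lsol a b k l sx sy tx ty
     else if lcase a b k l tx ty sx sy then rev (lsol a b k l tx ty sx sy)
     else if lcase b a l k sy sx ty tx then map prod.swap (lsol b a l k sy sx ty tx)
     else map prod.swap (rev (lsol b a l k ty tx sy sx)))"

lemma longest_lpath:
  assumes i: "linst a b k l sx sy tx ty"
  shows "is_longest_st_path (LV a b k l) (sx, sy) (tx, ty) (lpath a b k l sx sy tx ty)"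
proof -
  have i2: "linst a b k l tx ty sx sy" "linst b a l k sy sx ty tx" "linst b a l k ty tx sy sx"
    using i by (auto simp: linst_def)
  have adj: "sg_adj (prod.swap u) (prod.swap v)" if "sg_adj u v" for u v
    using that by (cases u; cases v) auto
  have sw: "is_longest_st_path (LV a b k l) (x, y) (x', y') (map prod.swap p)"
    if "is_longest_st_path (LV b a l k) (y, x) (y', x') p" for x y x' y' p
    using longest_map[OF that, of prod.swap] adj by (simp add: LV_swap)
  consider "lcase a b k l sx sy tx ty" | "\<not> lcase a b k l sx sy tx ty" "lcase a b k l tx ty sx sy"
    | "\<not> lcase a b k l sx sy tx ty" "\<not> lcase a b k l tx ty sx sy" "lcase b a l k sy sx ty tx"
    | "\<not> lcase a b k l sx sy tx ty" "\<not> lcase a b k l tx ty sx sy" "\<not> lcase b a l k sy sx ty tx" "lcase b a l k ty tx sy sx"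
    using lcase_complete[OF i] by blast
  then show ?thesis
  proof cases
    case 1
    then show ?thesis using longest_lsol[OF i 1] by (simp add: lpath_def)
  next
    case 2
    then show ?thesis using longest_rev[OF longest_lsol[OF i2(1) 2(2)]] by (simp add: lpath_def)
  next
    case 3
    then show ?thesis using sw[OF longest_lsol[OF i2(2) 3(3)]] by (simp add: lpath_def)
  next
    case 4
    then show ?thesis using sw[OF longest_rev[OF longest_lsol[OF i2(3) 4(4)]]] by (simp add: lpath_def)
  qed
qed

section \<open>Computability of the complete algorithm\<close>

lemmas lcond_defs = c_corner_def c_split_def c_split'_def c_attach_def c_pair_def c_double_def c_small_def
  c_arm_def c_bend_def c_turn_def c_enter_def c_cutv_def c_cuth_def c_cut_def c_foot_def c_top_def c_flat_def

lemma computable_template: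
  assumes A: "budget (\<lambda>\<sigma>. a \<sigma> + k \<sigma>) (\<lambda>\<sigma>. b \<sigma> + l \<sigma>)" "lin 8 a" "lin 8 b" "lin 8 k" "lin 8 l"
    "lin 8 sx" "lin 8 sy" "lin 8 tx" "lin 8 ty"
  shows "computable (\<lambda>\<sigma>. p_corner (a \<sigma>) (b \<sigma>) (k \<sigma>) (l \<sigma>) (sx \<sigma>) (sy \<sigma>) (tx \<sigma>) (ty \<sigma>))"
    "computable (\<lambda>\<sigma>. p_split (a \<sigma>) (b \<sigma>) (k \<sigma>) (l \<sigma>) (sx \<sigma>) (sy \<sigma>) (tx \<sigma>) (ty \<sigma>))"
    "computable (\<lambda>\<sigma>. p_split' (a \<sigma>) (b \<sigma>) (k \<sigma>) (l \<sigma>) (sx \<sigma>) (sy \<sigma>) (tx \<sigma>) (ty \<sigma>))"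
    "computable (\<lambda>\<sigma>. p_attach (a \<sigma>) (b \<sigma>) (k \<sigma>) (l \<sigma>) (sx \<sigma>) (sy \<sigma>) (tx \<sigma>) (ty \<sigma>))"
    "computable (\<lambda>\<sigma>. p_pair (a \<sigma>) (b \<sigma>) (k \<sigma>) (l \<sigma>) (sx \<sigma>) (sy \<sigma>) (tx \<sigma>) (ty \<sigma>))"
    "computable (\<lambda>\<sigma>. p_double (a \<sigma>) (b \<sigma>) (k \<sigma>) (l \<sigma>) (sx \<sigma>) (sy \<sigma>) (tx \<sigma>) (ty \<sigma>))"
    "computable (\<lambda>\<sigma>. p_small (a \<sigma>) (b \<sigma>) (k \<sigma>) (l \<sigma>) (sx \<sigma>) (sy \<sigma>) (tx \<sigma>) (ty \<sigma>))"
    "computable (\<lambda>\<sigma>. p_arm (a \<sigma>) (b \<sigma>) (k \<sigma>) (l \<sigma>) (sx \<sigma>) (sy \<sigma>) (tx \<sigma>) (ty \<sigma>))"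
    "computable (\<lambda>\<sigma>. p_bend (a \<sigma>) (b \<sigma>) (k \<sigma>) (l \<sigma>) (sx \<sigma>) (sy \<sigma>) (tx \<sigma>) (ty \<sigma>))"
    "computable (\<lambda>\<sigma>. p_turn (a \<sigma>) (b \<sigma>) (k \<sigma>) (l \<sigma>) (sx \<sigma>) (sy \<sigma>) (tx \<sigma>) (ty \<sigma>))"
    "computable (\<lambda>\<sigma>. p_enter (a \<sigma>) (b \<sigma>) (k \<sigma>) (l \<sigma>) (sx \<sigma>) (sy \<sigma>) (tx \<sigma>) (ty \<sigma>))"
    "computable (\<lambda>\<sigma>. p_cutv (a \<sigma>) (b \<sigma>) (k \<sigma>) (l \<sigma>) (sx \<sigma>) (sy \<sigma>) (tx \<sigma>) (ty \<sigma>))"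
    "computable (\<lambda>\<sigma>. p_cuth (a \<sigma>) (b \<sigma>) (k \<sigma>) (l \<sigma>) (sx \<sigma>) (sy \<sigma>) (tx \<sigma>) (ty \<sigma>))"
    "computable (\<lambda>\<sigma>. p_cut (a \<sigma>) (b \<sigma>) (k \<sigma>) (l \<sigma>) (sx \<sigma>) (sy \<sigma>) (tx \<sigma>) (ty \<sigma>))"
    "computable (\<lambda>\<sigma>. p_foot (a \<sigma>) (b \<sigma>) (k \<sigma>) (l \<sigma>) (sx \<sigma>) (sy \<sigma>) (tx \<sigma>) (ty \<sigma>))"
    "computable (\<lambda>\<sigma>. p_top (a \<sigma>) (b \<sigma>) (k \<sigma>) (l \<sigma>) (sx \<sigma>) (sy \<sigma>) (tx \<sigma>) (ty \<sigma>))"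
  unfolding p_corner_def p_split_def p_split'_def p_attach_def p_pair_def p_double_def p_small_def
    p_arm_def p_bend_def p_turn_def p_enter_def p_cutv_def p_cuth_def p_cut_def p_foot_def p_top_def Let_def
  by (intro computable_less computable_intros computable_gp computable_del computable_ins computable_attach A;
      intro lin_simple A)+

lemma cond_template:
  assumes A: "lin 8 a" "lin 8 b" "lin 8 k" "lin 8 l" "lin 8 sx" "lin 8 sy" "lin 8 tx" "lin 8 ty"
  shows "cond (\<lambda>\<sigma>. c_corner (a \<sigma>) (b \<sigma>) (k \<sigma>) (l \<sigma>) (sx \<sigma>) (sy \<sigma>) (tx \<sigma>) (ty \<sigma>))"
    "cond (\<lambda>\<sigma>. c_split (a \<sigma>) (b \<sigma>) (k \<sigma>) (l \<sigma>) (sx \<sigma>) (sy \<sigma>) (tx \<sigma>) (ty \<sigma>))"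
    "cond (\<lambda>\<sigma>. c_split' (a \<sigma>) (b \<sigma>) (k \<sigma>) (l \<sigma>) (sx \<sigma>) (sy \<sigma>) (tx \<sigma>) (ty \<sigma>))"
    "cond (\<lambda>\<sigma>. c_attach (a \<sigma>) (b \<sigma>) (k \<sigma>) (l \<sigma>) (sx \<sigma>) (sy \<sigma>) (tx \<sigma>) (ty \<sigma>))"
    "cond (\<lambda>\<sigma>. c_pair (a \<sigma>) (b \<sigma>) (k \<sigma>) (l \<sigma>) (sx \<sigma>) (sy \<sigma>) (tx \<sigma>) (ty \<sigma>))"
    "cond (\<lambda>\<sigma>. c_double (a \<sigma>) (b \<sigma>) (k \<sigma>) (l \<sigma>) (sx \<sigma>) (sy \<sigma>) (tx \<sigma>) (ty \<sigma>))"
    "cond (\<lambda>\<sigma>. c_small (a \<sigma>) (b \<sigma>) (k \<sigma>) (l \<sigma>) (sx \<sigma>) (sy \<sigma>) (tx \<sigma>) (ty \<sigma>))"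
    "cond (\<lambda>\<sigma>. c_arm (a \<sigma>) (b \<sigma>) (k \<sigma>) (l \<sigma>) (sx \<sigma>) (sy \<sigma>) (tx \<sigma>) (ty \<sigma>))"
    "cond (\<lambda>\<sigma>. c_bend (a \<sigma>) (b \<sigma>) (k \<sigma>) (l \<sigma>) (sx \<sigma>) (sy \<sigma>) (tx \<sigma>) (ty \<sigma>))"
    "cond (\<lambda>\<sigma>. c_turn (a \<sigma>) (b \<sigma>) (k \<sigma>) (l \<sigma>) (sx \<sigma>) (sy \<sigma>) (tx \<sigma>) (ty \<sigma>))"
    "cond (\<lambda>\<sigma>. c_enter (a \<sigma>) (b \<sigma>) (k \<sigma>) (l \<sigma>) (sx \<sigma>) (sy \<sigma>) (tx \<sigma>) (ty \<sigma>))"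
    "cond (\<lambda>\<sigma>. c_cutv (a \<sigma>) (b \<sigma>) (k \<sigma>) (l \<sigma>) (sx \<sigma>) (sy \<sigma>) (tx \<sigma>) (ty \<sigma>))"
    "cond (\<lambda>\<sigma>. c_cuth (a \<sigma>) (b \<sigma>) (k \<sigma>) (l \<sigma>) (sx \<sigma>) (sy \<sigma>) (tx \<sigma>) (ty \<sigma>))"
    "cond (\<lambda>\<sigma>. c_cut (a \<sigma>) (b \<sigma>) (k \<sigma>) (l \<sigma>) (sx \<sigma>) (sy \<sigma>) (tx \<sigma>) (ty \<sigma>))"
    "cond (\<lambda>\<sigma>. c_foot (a \<sigma>) (b \<sigma>) (k \<sigma>) (l \<sigma>) (sx \<sigma>) (sy \<sigma>) (tx \<sigma>) (ty \<sigma>))"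
    "cond (\<lambda>\<sigma>. c_top (a \<sigma>) (b \<sigma>) (k \<sigma>) (l \<sigma>) (sx \<sigma>) (sy \<sigma>) (tx \<sigma>) (ty \<sigma>))"
    "cond (\<lambda>\<sigma>. c_flat (a \<sigma>) (b \<sigma>) (k \<sigma>) (l \<sigma>) (sx \<sigma>) (sy \<sigma>) (tx \<sigma>) (ty \<sigma>))"
  unfolding lcond_defs att_ok_def noncut_def if_bool_eq_conj imp_conv_disj
  by (intro computable_intros; intro lin_simple A)+

lemma computable_lsol:
  assumes A: "budget (\<lambda>\<sigma>. a \<sigma> + k \<sigma>) (\<lambda>\<sigma>. b \<sigma> + l \<sigma>)" "lin 8 a" "lin 8 b" "lin 8 k" "lin 8 l"
    "lin 8 sx" "lin 8 sy" "lin 8 tx" "lin 8 ty"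
  shows "computable (\<lambda>\<sigma>. lsol (a \<sigma>) (b \<sigma>) (k \<sigma>) (l \<sigma>) (sx \<sigma>) (sy \<sigma>) (tx \<sigma>) (ty \<sigma>))"
  unfolding lsol_def by (intro computable_if computable_template cond_template A)

lemma cond_lcase:
  assumes A: "lin 8 a" "lin 8 b" "lin 8 k" "lin 8 l" "lin 8 sx" "lin 8 sy" "lin 8 tx" "lin 8 ty"
  shows "cond (\<lambda>\<sigma>. lcase (a \<sigma>) (b \<sigma>) (k \<sigma>) (l \<sigma>) (sx \<sigma>) (sy \<sigma>) (tx \<sigma>) (ty \<sigma>))"
  unfolding lcase_def by (intro cond_or cond_template A)

lemma computable_lpath:
  assumes A: "budget (\<lambda>\<sigma>. a \<sigma> + k \<sigma>) (\<lambda>\<sigma>. b \<sigma> + l \<sigma>)" "lin 8 a" "lin 8 b" "lin 8 k" "lin 8 l"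
    "lin 8 sx" "lin 8 sy" "lin 8 tx" "lin 8 ty"
  shows "computable (\<lambda>\<sigma>. lpath (a \<sigma>) (b \<sigma>) (k \<sigma>) (l \<sigma>) (sx \<sigma>) (sy \<sigma>) (tx \<sigma>) (ty \<sigma>))"
  unfolding lpath_def by (intro computable_if computable_rev computable_swap computable_lsol cond_lcase A budget_swap[OF A(1)])

theorem theorem4:
  "\<exists>(P :: instr list) (C :: nat). \<forall>m n k l s t.
     1 < m \<and> 1 < n \<and> 1 \<le> k \<and> 1 \<le> l \<and> k < m \<and> l < n \<and>
     s \<in> L_vertices m n k l \<and> t \<in> L_vertices m n k l \<and> s \<noteq> t \<longrightarrow>
     (\<exists>T \<le> C * m * n.
        halted P (run P T (0, input_mem m n k l s t)) \<and>
        is_longest_st_path (L_vertices m n k l) s t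
          (output_path (snd (run P T (0, input_mem m n k l s t)))))"
proof -
  \<comment> \<open>In \<open>L_vertices\<close> the notch is at small second coordinates, in
    \<open>LV\<close> at large ones. So the end points are reflected by \<open>n + 1 - y\<close>
    before the construction, and the path is reflected back.\<close>
  define f :: "(nat \<Rightarrow> int) \<Rightarrow> (int \<times> int) list" where
    "f = (\<lambda>\<sigma>. map (\<lambda>(x, y). (x, \<sigma> 1 + 1 - y)) (lpath (\<sigma> 0 - \<sigma> 2) (\<sigma> 1 - \<sigma> 3) (\<sigma> 2) (\<sigma> 3)
        (\<sigma> 4) (\<sigma> 1 + 1 - \<sigma> 5) (\<sigma> 6) (\<sigma> 1 + 1 - \<sigma> 7)))"
  have v: "lin 8 (\<lambda>\<sigma>. \<sigma> i)" if "i < 8" for i using that by (rule lin_var)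
  \<comment> \<open>The bounds are the sides of the enclosing rectangle: they simplify to
    \<open>\<sigma> 0\<close> and \<open>\<sigma> 1\<close>, whose product is the area.\<close>
  have bu: "budget (\<lambda>\<sigma>. \<sigma> 0 - \<sigma> 2 + \<sigma> 2) (\<lambda>\<sigma>. \<sigma> 1 - \<sigma> 3 + \<sigma> 3)"
    using v[of 0] v[of 1] by (simp add: budget_def area_def)
  have "computable f" unfolding f_def
    by (intro computable_reflect_y computable_lpath bu; intro lin_simple v) simp_all
  then obtain P C where P: "\<And>\<sigma>. Dom \<sigma> \<Longrightarrow> \<exists>T \<le> C * area \<sigma>. halted P (run P T (0, \<sigma>)) \<and>
      output_path (snd (run P T (0, \<sigma>))) = f \<sigma>"
    using computable_program by metis
  show ?thesis
  proof (rule exI[of _ P], rule exI[of _ C], intro allI impI, elim conjE)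
    fix m n k l :: nat and s t :: "int \<times> int"
    assume mn: "1 < m" "1 < n" "1 \<le> k" "1 \<le> l" "k < m" "l < n"
      and st: "s \<in> L_vertices m n k l" "t \<in> L_vertices m n k l" "s \<noteq> t"
    let ?\<sigma> = "input_mem m n k l s t"
    let ?g = "\<lambda>(x, y). (x :: int, int n + 1 - y)"
    obtain sx sy tx ty where e: "s = (sx, sy)" "t = (tx, ty)" by force
    have i: "?\<sigma> 0 = int m" "?\<sigma> 1 = int n" "?\<sigma> 2 = int k" "?\<sigma> 3 = int l" "?\<sigma> 4 = sx" "?\<sigma> 5 = sy" "?\<sigma> 6 = tx" "?\<sigma> 7 = ty"
      by (simp_all add: input_mem_def e)
    have D: "Dom ?\<sigma>" using mn by (simp add: Dom_def i del: One_nat_def)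
    have a: "area ?\<sigma> = m * n" by (simp add: area_def i del: One_nat_def)
    have V: "?g ` LV (int m - int k) (int n - int l) (int k) (int l) = L_vertices m n k l"
    proof -
      have "z \<in> ?g ` LV (int m - int k) (int n - int l) (int k) (int l)" if "z \<in> L_vertices m n k l" for z
        by (rule image_eqI[where x = "?g z"]) (use that mn in \<open>auto simp: L_vertices_def LV_def\<close>)
      moreover have "?g z \<in> L_vertices m n k l" if "z \<in> LV (int m - int k) (int n - int l) (int k) (int l)" for z
        using that mn by (auto simp: L_vertices_def LV_def)
      ultimately show ?thesis by blast
    qed
    have "linst (int m - int k) (int n - int l) (int k) (int l) sx (int n + 1 - sy) tx (int n + 1 - ty)"
      using mn st by (auto simp: linst_def L_vertices_def e)
    moreover have "sg_adj (?g u) (?g v)" if "sg_adj u v" for u v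
      using that by (cases u; cases v) auto
    ultimately have "is_longest_st_path (?g ` LV (int m - int k) (int n - int l) (int k) (int l))
        (?g (sx, int n + 1 - sy)) (?g (tx, int n + 1 - ty)) (map ?g (lpath (int m - int k) (int n - int l)
          (int k) (int l) sx (int n + 1 - sy) tx (int n + 1 - ty)))"
      by (intro longest_map longest_lpath) auto
    then have "is_longest_st_path (L_vertices m n k l) s t (f ?\<sigma>)"
      unfolding V f_def i by (simp add: e)
    with P[OF D] show "\<exists>T \<le> C * m * n. halted P (run P T (0, ?\<sigma>)) \<and>
        is_longest_st_path (L_vertices m n k l) s t (output_path (snd (run P T (0, ?\<sigma>))))"
      unfolding a by (metis mult.assoc)
  qed
qed

end
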